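(* Let $E$ be the elliptic curve $y^2z=x^3-4xz^2$ and $E'$ the elliptic curve $y^2z=x^3+xz^2$ over $\mathbb{C}$, let $E[2]$, $E'[2]$ denote their $2$-torsion subgroups, and let $\mathrm{inv}$ be the involution $(P,Q)\mapsto(-P,-Q)$ of $E\times E'$. Define $S_1=\big((E\setminus E[2])\times E'\big)/\mathrm{inv}$ and $S_2=\big(E\times(E'\setminus E'[2])\big)/\mathrm{inv}$. Then (i) $\pi_1(S_1(\mathbb{C}))\simeq \mathbb{F}_3\ltimes\mathbb{Z}^2$; (ii) $\pi_1(S_2(\mathbb{C}))\simeq\mathbb{F}_3\ltimes\mathbb{Z}^2$, where $\mathbb{F}_3$ is the free group on $3$ generators.
   Context: The surface $V\subset\mathbb{P}^5$ defined by $A^2+C^2-Y^2=B^2+C^2-X^2=A^2+X^2-U^2=0$ is isomorphic to $(E\times E')/\mathrm{inv}$, and $S_1,S_2$ are smooth open subvarieties of it. The notation $\mathbb{F}_3\ltimes\mathbb{Z}^2$ denotes a semidirect product in which $\mathbb{Z}^2$ is the normal subgroup. *)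

theory Defs
  imports "HOL-Analysis.Analysis" "HOL-Algebra.Algebra"
begin

definition loop_join :: "(real \<Rightarrow> 'a) \<Rightarrow> (real \<Rightarrow> 'a) \<Rightarrow> real \<Rightarrow> 'a" where
  "loop_join p q = (\<lambda>t. if t \<le> 1/2 then p (2 * t) else q (2 * t - 1))"

definition loop_at :: "'a topology \<Rightarrow> 'a \<Rightarrow> (real \<Rightarrow> 'a) \<Rightarrow> bool" where
  "loop_at Y x p \<longleftrightarrow> pathin Y p \<and> p 0 = x \<and> p 1 = x"

definition homotopic_loops_in :: "'a topology \<Rightarrow> 'a \<Rightarrow> (real \<Rightarrow> 'a) \<Rightarrow> (real \<Rightarrow> 'a) \<Rightarrow> bool" where
  "homotopic_loops_in Y x p q \<longleftrightarrow> loop_at Y x p \<and> loop_at Y x q \<and>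
     homotopic_with (\<lambda>h. h 0 = x \<and> h 1 = x) (top_of_set {0..1}) Y p q"

definition fundamental_group :: "'a topology \<Rightarrow> 'a \<Rightarrow> (real \<Rightarrow> 'a) set monoid" where
  "fundamental_group Y x =
     \<lparr>carrier = (\<lambda>p. {q. homotopic_loops_in Y x p q}) ` {p. loop_at Y x p},
      monoid.mult = (\<lambda>A B. {r. \<exists>p\<in>A. \<exists>q\<in>B. homotopic_loops_in Y x (loop_join p q) r}),
      one = {q. homotopic_loops_in Y x (\<lambda>t. x) q}\<rparr>"

definition quotient_topology :: "'a topology \<Rightarrow> ('a \<Rightarrow> 'b) \<Rightarrow> 'b topology" where
  "quotient_topology Y f =
     topology (\<lambda>U. U \<subseteq> f ` topspace Y \<and> openin Y {p \<in> topspace Y. f p \<in> U})"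

definition reduced_word :: "(nat \<times> bool) list \<Rightarrow> bool" where
  "reduced_word ws \<longleftrightarrow>
     (\<forall>k. Suc k < length ws \<longrightarrow> \<not> (fst (ws ! k) = fst (ws ! Suc k) \<and> snd (ws ! k) \<noteq> snd (ws ! Suc k)))"

definition word_eval :: "('a, 'b) monoid_scheme \<Rightarrow> (nat \<Rightarrow> 'a) \<Rightarrow> (nat \<times> bool) list \<Rightarrow> 'a" where
  "word_eval G g ws =
     foldr (\<lambda>(i, b) acc. (if b then g i else inv\<^bsub>G\<^esub> (g i)) \<otimes>\<^bsub>G\<^esub> acc) ws \<one>\<^bsub>G\<^esub>"

definition free_of_rank :: "('a, 'b) monoid_scheme \<Rightarrow> nat \<Rightarrow> bool" where
  "free_of_rank G n \<longleftrightarrow> group G \<and>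
     (\<exists>g. g ` {..<n} \<subseteq> carrier G \<and> generate G (g ` {..<n}) = carrier G \<and>
        (\<forall>ws. ws \<noteq> [] \<and> reduced_word ws \<and> (\<forall>(i, b)\<in>set ws. i < n) \<longrightarrow>
              word_eval G g ws \<noteq> \<one>\<^bsub>G\<^esub>))"

definition is_F3_semidirect_Z2 :: "('a, 'b) monoid_scheme \<Rightarrow> bool" where
  "is_F3_semidirect_Z2 G \<longleftrightarrow> group G \<and>
     (\<exists>N K. N \<lhd> G \<and> subgroup K G \<and>
        (G\<lparr>carrier := N\<rparr>) \<cong> (integer_group \<times>\<times> integer_group) \<and>
        free_of_rank (G\<lparr>carrier := K\<rparr>) 3 \<and>
        N \<inter> K = {\<one>\<^bsub>G\<^esub>} \<and> N <#>\<^bsub>G\<^esub> K = carrier G)"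

type_synonym cvec3 = "complex \<times> complex \<times> complex"

definition wcubic :: "complex \<Rightarrow> cvec3 \<Rightarrow> complex" where
  "wcubic a v = (case v of (x, y, z) \<Rightarrow> y^2 * z - x^3 - a * x * z^2)"

definition curve_reps :: "complex \<Rightarrow> cvec3 set" where
  "curve_reps a = {v. v \<noteq> 0 \<and> wcubic a v = 0}"

text \<open>Negation (x:y:z) |-> (x:-y:z) w.r.t. origin (0:1:0).\<close>
definition cneg :: "cvec3 \<Rightarrow> cvec3" where
  "cneg v = (case v of (x, y, z) \<Rightarrow> (x, - y, z))"

text \<open>2-torsion points of y^2 z = x^3 + a x z^2 (origin and the points with y = 0).\<close>
definition two_torsion_reps :: "complex \<Rightarrow> cvec3 set" where
  "two_torsion_reps a = {v \<in> curve_reps a. (case v of (x, y, z) \<Rightarrow> y * z = 0)}"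

definition scaleC3 :: "complex \<Rightarrow> cvec3 \<Rightarrow> cvec3" where
  "scaleC3 c v = (case v of (x, y, z) \<Rightarrow> (c * x, c * y, c * z))"

text \<open>Class of (v,w) in (E x E')/inv, where points of E, E' are given by
  nonzero representatives in C^3 (so we also quotient by independent scalings).\<close>
definition inv_class :: "cvec3 \<times> cvec3 \<Rightarrow> (cvec3 \<times> cvec3) set" where
  "inv_class p = {(v', w'). \<exists>c d. c \<noteq> 0 \<and> d \<noteq> 0 \<and>
      ((v' = scaleC3 c (fst p) \<and> w' = scaleC3 d (snd p)) \<or>
       (v' = scaleC3 c (cneg (fst p)) \<and> w' = scaleC3 d (cneg (snd p))))}"

definition E_a :: complex where "E_a = -4"
definition E'_a :: complex where "E'_a = 1"

definition S1_space :: "(cvec3 \<times> cvec3) set topology" where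
  "S1_space = quotient_topology
     (top_of_set ((curve_reps E_a - two_torsion_reps E_a) \<times> curve_reps E'_a)) inv_class"

definition S2_space :: "(cvec3 \<times> cvec3) set topology" where
  "S2_space = quotient_topology
     (top_of_set (curve_reps E_a \<times> (curve_reps E'_a - two_torsion_reps E'_a))) inv_class"

end

theory Submission
  imports Defs "HOL-Complex_Analysis.Complex_Analysis"
begin

text \<open>
  All curves \<open>y\<^sup>2 = x\<^sup>3 + a x\<close> with \<open>a \<noteq> 0\<close> are isomorphic by rescaling, and the Weierstrass function of
  the Gaussian lattice parametrizes them by the plane. Hence both surfaces are quotients of \<open>W \<times> \<complex>\<close>, where
  \<open>W\<close> is the curve \<open>y\<^sup>2 = x\<^sup>3 - 4 x\<close>, \<open>y \<noteq> 0\<close>, by the group generated by the lattice translations of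
  the second factor and by \<open>((x, y), v) \<mapsto> ((x, - y), - v)\<close>. The coordinate \<open>x\<close> maps such a quotient to
  the plane without \<open>- 2\<close>, \<open>0\<close>, \<open>2\<close>, and \<open>v = 0\<close> is a section; so the fundamental group is the
  semidirect product of that of the punctured plane with the kernel of the projection. A loop in the
  kernel lifts to \<open>W \<times> \<complex>\<close> and is determined by the lattice vector between the ends of its lift.

  Two overlapping starlike sets cover the punctured plane; cutting a loop where it changes from one to
  the other writes it in three generators. They are free because the covering whose sheets are the
  reduced words lets every reduced word act nontrivially on the empty word.\<close>

section \<open>Covering maps and lifting\<close>

text \<open>Removing the 2-torsion is what makes this work: since \<open>y\<close> is nonzero, the
  involution has no fixed point on \<open>W\<close>, so the orbit map from \<open>W x C\<close> is a
  covering although negation on the other factor does have fixed points. One of these,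
  \<open>v = 0\<close>, in turn gives a section that does not see the sign of \<open>y\<close>. The
  kernel is exactly the lattice because \<open>W\<close> is itself a double covering of the
  punctured plane: a null-homotopy in the plane lifts to \<open>W\<close>, and the complex factor is
  deformed linearly. The Gaussian lattice is chosen for its symmetry \<open>z -> i z\<close>, which
  removes the constant term from the cubic of its Weierstrass function. The other coefficient enters
  only through being nonzero, as a fourth root then adjusts it to either curve. The main topological
  obstacle is that the surfaces are quotients of sets of homogeneous representatives, while the
  parametrization of the complete curve is continuous only up to rescaling of representatives; its
  continuity and openness have to be obtained after passing to the quotient.\<close>

definition evenly_covering_map :: "'a topology \<Rightarrow> 'b topology \<Rightarrow> ('a \<Rightarrow> 'b) \<Rightarrow> bool" where
  "evenly_covering_map C Y p \<longleftrightarrow> continuous_map C Y p \<and> open_map C Y p \<and> p ` topspace C = topspace Y \<and>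
     (\<forall>x\<in>topspace Y. \<exists>U \<V>. openin Y U \<and> x \<in> U \<and> disjoint \<V> \<and> \<Union>\<V> = {c \<in> topspace C. p c \<in> U} \<and>
        (\<forall>V\<in>\<V>. openin C V \<and> bij_betw p V U))"

lemma evenly_covering_mapD:
  assumes "evenly_covering_map C Y p"
  shows "continuous_map C Y p" "open_map C Y p" "p ` topspace C = topspace Y"
  using assms by (auto simp: evenly_covering_map_def)

text \<open>Over an evenly covered neighbourhood each of the two maps stays locally in one sheet.
  Equal sheets force agreement by injectivity, distinct sheets force disagreement by disjointness,
  so the set of agreement is open and closed.\<close>

lemma lift_unique:
  assumes cov: "evenly_covering_map C Y p" and Z: "connected_space Z"
    and f: "continuous_map Z C f" and g: "continuous_map Z C g"
    and eq: "\<And>z. z \<in> topspace Z \<Longrightarrow> p (f z) = p (g z)"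
    and z0: "z0 \<in> topspace Z" "f z0 = g z0" and z: "z \<in> topspace Z"
  shows "f z = g z"
proof -
  let ?A = "{z \<in> topspace Z. f z = g z}"
  have nbhd: "\<exists>N. openin Z N \<and> z \<in> N \<and> ((\<forall>y\<in>N. f y = g y) \<or> (\<forall>y\<in>N. f y \<noteq> g y))"
    if z: "z \<in> topspace Z" for z
  proof -
    have fz: "f z \<in> topspace C" and gz: "g z \<in> topspace C"
      using f g z by (auto simp: continuous_map_def)
    then have "p (f z) \<in> topspace Y"
      using evenly_covering_mapD(3)[OF cov] by blast
    then obtain U \<V> where U: "openin Y U" "p (f z) \<in> U" "disjoint \<V>"
        "\<Union>\<V> = {c \<in> topspace C. p c \<in> U}" and V: "\<And>V. V \<in> \<V> \<Longrightarrow> openin C V \<and> bij_betw p V U"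
      using cov unfolding evenly_covering_map_def by meson
    have "f z \<in> \<Union>\<V>" "g z \<in> \<Union>\<V>"
      using fz gz U(2) eq[OF z] unfolding U(4) by auto
    then obtain V V' where VV: "V \<in> \<V>" "f z \<in> V" "V' \<in> \<V>" "g z \<in> V'" by blast
    let ?N = "{y \<in> topspace Z. f y \<in> V} \<inter> {y \<in> topspace Z. g y \<in> V'}"
    have "openin Z ?N"
      using V VV f g by (intro openin_Int openin_continuous_map_preimage) auto
    moreover have "(\<forall>y\<in>?N. f y = g y) \<or> (\<forall>y\<in>?N. f y \<noteq> g y)"
    proof (cases "V = V'")
      case True
      have "inj_on p V" using V VV by (auto simp: bij_betw_def)
      then show ?thesis using eq True by (auto simp: inj_on_def)
    next
      case False
      then have "V \<inter> V' = {}" using U(3) VV by (auto simp: disjoint_def)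
      then show ?thesis by auto
    qed
    ultimately show ?thesis using z VV by blast
  qed
  have "openin Z ?A"
  proof (rule openin_subopen[THEN iffD2], intro ballI)
    fix z assume z: "z \<in> ?A"
    then obtain N where N: "openin Z N" "z \<in> N" "\<forall>y\<in>N. f y = g y"
      using nbhd[of z] by auto
    then show "\<exists>T. openin Z T \<and> z \<in> T \<and> T \<subseteq> ?A"
      using openin_subset[OF N(1)] by blast
  qed
  moreover have "openin Z (topspace Z - ?A)"
  proof (rule openin_subopen[THEN iffD2], intro ballI)
    fix z assume z: "z \<in> topspace Z - ?A"
    then obtain N where N: "openin Z N" "z \<in> N" "\<forall>y\<in>N. f y \<noteq> g y"
      using nbhd[of z] by auto
    then show "\<exists>T. openin Z T \<and> z \<in> T \<and> T \<subseteq> topspace Z - ?A"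
      using openin_subset[OF N(1)] by blast
  qed
  then have "closedin Z ?A" by (auto simp: closedin_def)
  ultimately have "?A = {} \<or> ?A = topspace Z"
    using Z by (auto simp: connected_space_clopen_in)
  then show ?thesis using z0 z by auto
qed

text \<open>Both the point and the value of the lift there are arbitrary. This lets a second piece
  start at whatever value the first piece reaches on the overlap, wherever the prescribed point
  lies.\<close>

definition liftable :: "'c topology \<Rightarrow> 'b topology \<Rightarrow> ('c \<Rightarrow> 'b) \<Rightarrow> ('a::topological_space \<Rightarrow> 'b) \<Rightarrow> 'a set \<Rightarrow> bool" where
  "liftable C Y p h K \<longleftrightarrow> (\<forall>z0\<in>K. \<forall>c\<in>topspace C. p c = h z0 \<longrightarrow>
     (\<exists>f. continuous_map (top_of_set K) C f \<and> (\<forall>z\<in>K. p (f z) = h z) \<and> f z0 = c))"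

text \<open>The two lifts agree at one point of the overlap by construction and on the rest of it by
  \<open>lift_unique\<close>; this is where connectedness of the overlap enters.\<close>

lemma liftable_Un:
  assumes cov: "evenly_covering_map C Y p" and "closed K" "closed L" "connected (K \<inter> L)" "K \<inter> L \<noteq> {}"
    and "liftable C Y p h K" "liftable C Y p h L"
  shows "liftable C Y p h (K \<union> L)"
proof -
  have main: "\<exists>f. continuous_map (top_of_set (K \<union> L)) C f \<and> (\<forall>z\<in>K \<union> L. p (f z) = h z) \<and> f z0 = c"
    if cl: "closed K" "closed L" and co: "connected (K \<inter> L)" and ne: "K \<inter> L \<noteq> {}"
     and K: "liftable C Y p h K" and L: "liftable C Y p h L"
     and z0: "z0 \<in> K" "c \<in> topspace C" "p c = h z0" for K L z0 c
  proof -
    obtain f1 where f1: "continuous_map (top_of_set K) C f1" "\<forall>z\<in>K. p (f1 z) = h z" "f1 z0 = c"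
      using K z0 unfolding liftable_def by blast
    obtain m where m: "m \<in> K" "m \<in> L" using ne by blast
    have f1m: "f1 m \<in> topspace C" using continuous_map_funspace[OF f1(1)] m by auto
    obtain f2 where f2: "continuous_map (top_of_set L) C f2" "\<forall>z\<in>L. p (f2 z) = h z" "f2 m = f1 m"
      using L[unfolded liftable_def, rule_format, OF m(2) f1m] f1(2) m(1) by blast
    have agree: "f1 z = f2 z" if "z \<in> K" "z \<in> L" for z
    proof (rule lift_unique[OF cov, of "top_of_set (K \<inter> L)" f1 f2 m])
      show "connected_space (top_of_set (K \<inter> L))" using co unfolding connectedin_iff_connected[symmetric] connectedin_def by simp
      show "continuous_map (top_of_set (K \<inter> L)) C f1"
        using continuous_map_from_subtopology_mono[OF f1(1)] by auto
      show "continuous_map (top_of_set (K \<inter> L)) C f2"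
        using continuous_map_from_subtopology_mono[OF f2(1)] by auto
    qed (use f1 f2 m that in auto)
    let ?f = "\<lambda>z. if z \<in> K then f1 z else f2 z"
    have "continuous_map (top_of_set (K \<union> L)) C ?f"
    proof (rule pasting_lemma_closed[where I="{True,False}" and T="\<lambda>b. if b then K else L" and f="\<lambda>b. if b then f1 else f2"])
      show "closedin (top_of_set (K \<union> L)) (if i then K else L)" for i
        using cl by (auto simp: closedin_closed_eq intro!: closed_subset)
      show "continuous_map (subtopology (top_of_set (K \<union> L)) (if i then K else L)) C (if i then f1 else f2)" for i
        using f1 f2 by (auto simp: subtopology_subtopology Int_absorb1)
    qed (use agree in \<open>auto split: if_splits\<close>)
    then show ?thesis using f1 f2 z0 agree by (intro exI[of _ ?f]) auto
  qed
  show ?thesis unfolding liftable_def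
  proof safe
    fix z0 c assume c: "c \<in> topspace C" "p c = h z0"
    show "\<exists>f. continuous_map (top_of_set (K \<union> L)) C f \<and> (\<forall>z\<in>K \<union> L. p (f z) = h z) \<and> f z0 = c" if "z0 \<in> K"
      using main[of K L z0 c] assms that c by blast
    show "\<exists>f. continuous_map (top_of_set (K \<union> L)) C f \<and> (\<forall>z\<in>K \<union> L. p (f z) = h z) \<and> f z0 = c" if "z0 \<in> L"
      using main[of L K z0 c] assms that c by (metis Int_commute Un_commute)
  qed
qed

lemma liftable_local:
  assumes cov: "evenly_covering_map C Y p" and h: "continuous_map (top_of_set S) Y h" and z: "z \<in> S"
  shows "\<exists>e>0. \<forall>K. K \<subseteq> S \<inter> ball z e \<longrightarrow> liftable C Y p h K"
proof -
  have "h z \<in> topspace Y" using h z by (auto simp: continuous_map_def)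
  then obtain U \<V> where U: "openin Y U" "h z \<in> U" "disjoint \<V>"
        "\<Union>\<V> = {c \<in> topspace C. p c \<in> U}" and V: "\<And>V. V \<in> \<V> \<Longrightarrow> openin C V \<and> bij_betw p V U"
      using cov unfolding evenly_covering_map_def by meson
  have "openin (top_of_set S) {y \<in> topspace (top_of_set S). h y \<in> U}"
    by (rule openin_continuous_map_preimage[OF h U(1)])
  then obtain e where e: "e > 0" "S \<inter> ball z e \<subseteq> {y \<in> S. h y \<in> U}"
    using z U(2) unfolding openin_contains_ball by (auto simp: Int_commute)
  have "liftable C Y p h K" if K: "K \<subseteq> S \<inter> ball z e" for K
    unfolding liftable_def
  proof (intro ballI impI)
    fix z0 c assume zc: "z0 \<in> K" "c \<in> topspace C" "p c = h z0"
    then have "c \<in> \<Union>\<V>" using e K unfolding U(4) by auto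
    then obtain V where VV: "V \<in> \<V>" "c \<in> V" by auto
    then have op: "openin C V" and bij: "bij_betw p V U" using V by auto
    let ?s = "inv_into V p"
    have s: "?s u \<in> V" "p (?s u) = u" if "u \<in> U" for u
      using bij that by (auto simp: bij_betw_def f_inv_into_f inv_into_into)
    have sp: "?s (p v) = v" if "v \<in> V" for v
      using bij that by (auto simp: bij_betw_def)
    have "continuous_map (subtopology Y U) C ?s"
      unfolding continuous_map_def
    proof safe
      fix u assume "u \<in> topspace (subtopology Y U)"
      then show "?s u \<in> topspace C" using s openin_subset[OF op] by auto
    next
      fix T assume T: "openin C T"
      have "{u \<in> topspace (subtopology Y U). ?s u \<in> T} = p ` (T \<inter> V)"
        using s sp bij openin_subset[OF U(1)] by (force simp: bij_betw_def)
      \<comment> \<open>A sheet is only required to be in bijection with \<open>U\<close>; its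
        inverse is continuous because \<open>p\<close> is open.\<close>
      moreover have "openin Y (p ` (T \<inter> V))"
        using evenly_covering_mapD(2)[OF cov] T op by (auto simp: open_map_def)
      moreover have "p ` (T \<inter> V) \<subseteq> U" using bij by (auto simp: bij_betw_def)
      ultimately show "openin (subtopology Y U) {u \<in> topspace (subtopology Y U). ?s u \<in> T}"
        using openin_open_subtopology[OF U(1)] by simp
    qed
    moreover have "continuous_map (top_of_set K) (subtopology Y U) h"
    proof -
      have "continuous_map (top_of_set K) Y h"
        using continuous_map_from_subtopology_mono[OF h] K by auto
      then show ?thesis using e K by (auto simp: continuous_map_in_subtopology)
    qed
    ultimately have "continuous_map (top_of_set K) C (?s \<circ> h)"
      by (metis continuous_map_compose)
    moreover have "h y \<in> U" if "y \<in> K" for y using e K that by auto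
    ultimately show "\<exists>f. continuous_map (top_of_set K) C f \<and> (\<forall>z\<in>K. p (f z) = h z) \<and> f z0 = c"
      using zc VV s sp by (intro exI[of _ "?s \<circ> h"]) (auto, metis)
  qed
  then show ?thesis using e by blast
qed

text \<open>A Lebesgue number argument by bisection: \<open>Bolzano\<close> is applied horizontally,
  to get a strip of positive height around each level \<open>y\<close>, and then vertically, to
  stack such strips. Rectangles are convex, so their overlaps are connected.\<close>

lemma liftable_square:
  fixes h :: "real \<times> real \<Rightarrow> 'b"
  assumes cov: "evenly_covering_map C Y p"
    and h: "continuous_map (top_of_set ({0..1} \<times> {0..1})) Y h"
  shows "liftable C Y p h ({0..1} \<times> {0..1})"
proof -
  let ?S = "{0..1} \<times> {0..1} :: (real \<times> real) set"
  \<comment> \<open>Cut down to the square because \<open>Bolzano\<close> also tests intervals that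
    stick out of [0,1]; hence the treatment of empty pieces below.\<close>
  let ?L = "\<lambda>s t u v. liftable C Y p h (?S \<inter> ({s..t} \<times> {u..v}))"
  have glue: "liftable C Y p h (A \<union> B)"
    if "convex A" "convex B" "closed A" "closed B" "A \<inter> B \<noteq> {}" "liftable C Y p h A" "liftable C Y p h B" for A B
    using liftable_Un[OF cov] that by (meson convex_Int convex_connected)
  have conv: "convex (?S \<inter> ({s..t} \<times> {u..v}))" "closed (?S \<inter> ({s..t} \<times> {u..v}))" for s t u v :: real
    by (intro convex_Int convex_Times convex_real_interval)
       (intro closed_Int closed_Times closed_real_atLeastAtMost)
  have horiz: "?L s t' u v" if "?L s t u v" "?L t t' u v" "s \<le> t" "t \<le> t'" for s t t' u v
  proof -
    let ?A = "?S \<inter> ({s..t} \<times> {u..v})" and ?B = "?S \<inter> ({t..t'} \<times> {u..v})"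
    have AB: "?S \<inter> ({s..t'} \<times> {u..v}) = ?A \<union> ?B" using that(3,4) by auto
    show ?thesis
    proof (cases "?A = {} \<or> ?B = {}")
      case True
      then have "?A \<union> ?B = ?A \<or> ?A \<union> ?B = ?B" by blast
      then show ?thesis unfolding AB using that(1,2) by (elim disjE) (simp_all only:)
    next
      case False
      then obtain x y where "x \<in> ?A" "y \<in> ?B" by blast
      then have "(t, snd x) \<in> ?A \<inter> ?B" using that by auto
      then show ?thesis unfolding AB by (intro glue conv that(1,2)) blast
    qed
  qed
  have vert: "?L s t u v'" if "?L s t u v" "?L s t v v'" "u \<le> v" "v \<le> v'" for s t u v v'
  proof -
    let ?A = "?S \<inter> ({s..t} \<times> {u..v})" and ?B = "?S \<inter> ({s..t} \<times> {v..v'})"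
    have AB: "?S \<inter> ({s..t} \<times> {u..v'}) = ?A \<union> ?B" using that(3,4) by auto
    show ?thesis
    proof (cases "?A = {} \<or> ?B = {}")
      case True
      then have "?A \<union> ?B = ?A \<or> ?A \<union> ?B = ?B" by blast
      then show ?thesis unfolding AB using that(1,2) by (elim disjE) (simp_all only:)
    next
      case False
      then obtain x y where "x \<in> ?A" "y \<in> ?B" by blast
      then have "(fst x, v) \<in> ?A \<inter> ?B" using that by auto
      then show ?thesis unfolding AB by (intro glue conv that(1,2)) blast
    qed
  qed
  have strip: "\<exists>d>0. \<forall>u v. u \<le> y \<and> y \<le> v \<and> v - u < d \<longrightarrow> ?L 0 1 u v" if y: "0 \<le> y" "y \<le> 1" for y
  proof -
    define P where "P s t \<longleftrightarrow> (\<exists>d>0. \<forall>u v. u \<le> y \<and> y \<le> v \<and> v - u < d \<longrightarrow> ?L s t u v)" for s t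
    have "P 0 1"
    proof (rule Bolzano)
      fix a b c assume ab: "P a b" "P b c" "a \<le> b" "b \<le> c"
      then obtain d d' where d: "d > 0" "\<And>u v. u \<le> y \<and> y \<le> v \<and> v - u < d \<Longrightarrow> ?L a b u v"
        "d' > 0" "\<And>u v. u \<le> y \<and> y \<le> v \<and> v - u < d' \<Longrightarrow> ?L b c u v"
        unfolding P_def by meson
      have "?L a c u v" if "u \<le> y \<and> y \<le> v \<and> v - u < min d d'" for u v
        using horiz[OF d(2) d(4) ab(3,4)] that by simp
      moreover have "min d d' > 0" using d by simp
      ultimately show "P a c" unfolding P_def by blast
    next
      fix x :: real assume local: "0 \<le> x" "x \<le> 1"
      obtain e where e: "e > 0" "\<And>K. K \<subseteq> ?S \<inter> ball (x,y) e \<Longrightarrow> liftable C Y p h K"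
        using liftable_local[OF cov h, of "(x,y)"] local y by auto
      have "?L a b u v" if "a \<le> x \<and> x \<le> b \<and> b - a < e/2" "u \<le> y \<and> y \<le> v \<and> v - u < e/2" for a b u v
      proof (rule e(2), safe)
        fix s t assume st: "s \<in> {a..b}" "t \<in> {u..v}"
        have "dist (x,y) (s,t) \<le> \<bar>x - s\<bar> + \<bar>y - t\<bar>"
          unfolding dist_Pair_Pair dist_real_def by (rule sqrt_sum_squares_le_sum) simp_all
        also have "\<dots> < e" using st that by auto
        finally show "(s,t) \<in> ball (x,y) e" by simp
      qed
      then have "P a b" if "a \<le> x \<and> x \<le> b \<and> b - a < e/2" for a b
        unfolding P_def using that e(1) by (intro exI[of _ "e/2"]) simp
      then show "\<exists>d>0. \<forall>a b. a \<le> x \<and> x \<le> b \<and> b - a < d \<longrightarrow> P a b"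
        using e(1) by (intro exI[of _ "e/2"]) simp
    qed simp
    then show ?thesis unfolding P_def .
  qed
  have "?L 0 1 0 1"
  proof (rule Bolzano[of 0 1 "?L 0 1"])
    show "?L 0 1 a c" if "?L 0 1 a b" "?L 0 1 b c" "a \<le> b" "b \<le> c" for a b c
      by (rule vert[OF that])
  qed (use strip in simp_all)
  then show ?thesis by simp
qed

section \<open>Fundamental groups\<close>

definition path_homotopic :: "'a topology \<Rightarrow> (real \<Rightarrow> 'a) \<Rightarrow> (real \<Rightarrow> 'a) \<Rightarrow> bool" where
  "path_homotopic Y p q \<longleftrightarrow> homotopic_with (\<lambda>h. h 0 = p 0 \<and> h 1 = p 1) (top_of_set {0..1}) Y p q"

lemma path_homotopic_square:
  "path_homotopic Y p q \<longleftrightarrow> (\<exists>h. continuous_map (top_of_set ({0..1} \<times> {0..1} :: (real \<times> real) set)) Y h \<and>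
     (\<forall>t\<in>{0..1}. h (0, t) = p t) \<and> (\<forall>t\<in>{0..1}. h (1, t) = q t) \<and>
     (\<forall>s\<in>{0..1}. h (s, 0) = p 0 \<and> h (s, 1) = p 1))"
  unfolding path_homotopic_def
  by (subst homotopic_with) auto

lemma path_homotopic_top_of_set: "path_homotopic (top_of_set S) p q \<longleftrightarrow> homotopic_paths S p q"
  by (simp add: path_homotopic_def homotopic_paths_def pathstart_def pathfinish_def)

lemma homotopic_loops_in_iff:
  "homotopic_loops_in Y x p q \<longleftrightarrow> path_homotopic Y p q \<and> p 0 = x \<and> p 1 = x"
proof -
  have "loop_at Y x p \<and> loop_at Y x q" if "path_homotopic Y p q" "p 0 = x" "p 1 = x"
    using that homotopic_with_imp_continuous_maps[OF that(1)[unfolded path_homotopic_def]]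
      homotopic_with_imp_property[OF that(1)[unfolded path_homotopic_def]]
    by (auto simp: loop_at_def pathin_def)
  then show ?thesis
    by (auto simp: homotopic_loops_in_def path_homotopic_def loop_at_def)
qed

lemma path_homotopic_imp_pathin: "path_homotopic Y p q \<Longrightarrow> pathin Y p" "path_homotopic Y p q \<Longrightarrow> pathin Y q"
  unfolding path_homotopic_def pathin_def by (auto dest: homotopic_with_imp_continuous_maps)

lemma path_homotopic_ends:
  assumes "path_homotopic Y p q" shows "q 0 = p 0" "q 1 = p 1"
  using homotopic_with_imp_property[OF assms[unfolded path_homotopic_def]] by auto

lemma path_homotopic_refl [simp]: "path_homotopic Y p p \<longleftrightarrow> pathin Y p"
  by (simp add: path_homotopic_def pathin_def)

lemma path_homotopic_sym: "path_homotopic Y p q \<Longrightarrow> path_homotopic Y q p"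
  using path_homotopic_ends[of Y p q] unfolding path_homotopic_def
  by (subst homotopic_with_sym) simp

lemma path_homotopic_trans [trans]:
  assumes pq: "path_homotopic Y p q" and qr: "path_homotopic Y q r"
  shows "path_homotopic Y p r"
proof -
  have "homotopic_with (\<lambda>h. h 0 = p 0 \<and> h 1 = p 1) (top_of_set {0..1}) Y q r"
    using qr path_homotopic_ends[OF pq] unfolding path_homotopic_def by simp
  then show ?thesis
    using pq unfolding path_homotopic_def by (rule homotopic_with_trans[rotated])
qed

lemma path_homotopic_eq:
  assumes p: "pathin Y p" and eq: "\<And>t. t \<in> {0..1} \<Longrightarrow> p t = q t" shows "path_homotopic Y p q"
  unfolding path_homotopic_def
proof (rule homotopic_with_eq)
  show "homotopic_with (\<lambda>h. h 0 = p 0 \<and> h 1 = p 1) (top_of_set {0..1}) Y p p"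
    using p by (simp add: pathin_def)
qed (use eq in simp_all)

lemma path_homotopic_compose:
  assumes "path_homotopic Z p q" "continuous_map Z Y k" shows "path_homotopic Y (k \<circ> p) (k \<circ> q)"
  using assms unfolding path_homotopic_def
  by (rule homotopic_with_compose_continuous_map_left) auto

text \<open>Two self-maps of the interval with the same ends are homotopic along straight lines.
  Associativity, units and inverses below are instances for suitable piecewise linear
  parameters.\<close>

lemma path_homotopic_reparametrize:
  assumes p: "pathin Y p" and f: "continuous_on {0..1} f" "f ` {0..1} \<subseteq> {0..1}"
    and g: "continuous_on {0..1} g" "g ` {0..1} \<subseteq> {0..1}" and "f 0 = g 0" "f 1 = g (1::real)"
  shows "path_homotopic Y (p \<circ> f) (p \<circ> g)"
proof (rule path_homotopic_compose)
  show "path_homotopic (top_of_set {0..1}) f g"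
    unfolding path_homotopic_top_of_set
  proof (rule homotopic_paths_linear)
    show "closed_segment (f t) (g t) \<subseteq> {0..1}" if "t \<in> {0..1}" for t
      using f(2) g(2) that by (intro closed_segment_subset) (auto simp: image_subset_iff)
  qed (simp_all add: path_def pathstart_def pathfinish_def f g assms)
qed (use p in \<open>simp add: pathin_def\<close>)

lemma path_homotopic_join:
  assumes "path_homotopic Y p p'" "path_homotopic Y q q'" "p 1 = q 0"
  shows "path_homotopic Y (loop_join p q) (loop_join p' q')"
proof -
  let ?S = "{0..1} \<times> {0..1} :: (real \<times> real) set"
  obtain h where h: "continuous_map (top_of_set ?S) Y h"
     "\<forall>t\<in>{0..1}. h (0, t) = p t" "\<forall>t\<in>{0..1}. h (1, t) = p' t"
     "\<forall>s\<in>{0..1}. h (s, 0) = p 0 \<and> h (s, 1) = p 1"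
    using assms(1) unfolding path_homotopic_square by blast
  obtain k where k: "continuous_map (top_of_set ?S) Y k"
     "\<forall>t\<in>{0..1}. k (0, t) = q t" "\<forall>t\<in>{0..1}. k (1, t) = q' t"
     "\<forall>s\<in>{0..1}. k (s, 0) = q 0 \<and> k (s, 1) = q 1"
    using assms(2) unfolding path_homotopic_square by blast
  let ?a = "\<lambda>z::real\<times>real. (fst z, 2 * snd z)" and ?b = "\<lambda>z::real\<times>real. (fst z, 2 * snd z - 1)"
  let ?H = "\<lambda>z. if snd z \<le> 1/2 then (h \<circ> ?a) z else (k \<circ> ?b) z"
  have "continuous_map (top_of_set ?S) Y ?H"
  proof (rule continuous_map_cases_le)
    let ?A = "subtopology (top_of_set ?S) {x \<in> topspace (top_of_set ?S). snd x \<le> 1/2}"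
    let ?B = "subtopology (top_of_set ?S) {x \<in> topspace (top_of_set ?S). 1/2 \<le> snd x}"
    have "continuous_map ?A (top_of_set ?S) ?a"
      unfolding subtopology_subtopology continuous_map_in_subtopology
      by (auto intro!: continuous_intros)
    then show "continuous_map ?A Y (h \<circ> ?a)" using h(1) by (rule continuous_map_compose)
    have "continuous_map ?B (top_of_set ?S) ?b"
      unfolding subtopology_subtopology continuous_map_in_subtopology
      by (auto intro!: continuous_intros)
    then show "continuous_map ?B Y (k \<circ> ?b)" using k(1) by (rule continuous_map_compose)
    show "continuous_map (top_of_set ?S) euclideanreal snd" "continuous_map (top_of_set ?S) euclideanreal (\<lambda>z. 1/2)"
      by (simp_all add: continuous_on_snd)
    show "(h \<circ> ?a) x = (k \<circ> ?b) x" if "x \<in> topspace (top_of_set ?S)" "snd x = 1/2" for x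
    proof -
      have a: "x = (fst x, 1/2)" "fst x \<in> {0..1}" using that by (auto simp: prod_eq_iff)
      show ?thesis using h(4) k(4) assms(3) a(2) by (subst (1 2) a(1)) simp
    qed
  qed
  then show ?thesis unfolding path_homotopic_square
    by (rule exI[of _ ?H, OF conjI]) (use h k in \<open>auto simp: loop_join_def\<close>)
qed

lemma pathin_loop_join: "pathin Y p \<Longrightarrow> pathin Y q \<Longrightarrow> p 1 = q 0 \<Longrightarrow> pathin Y (loop_join p q)"
  using path_homotopic_join[of Y p p q q] by simp

lemma loop_join_ends [simp]: "loop_join p q 0 = p 0" "loop_join p q 1 = q 1"
  by (auto simp: loop_join_def)

definition loop_reverse :: "(real \<Rightarrow> 'a) \<Rightarrow> real \<Rightarrow> 'a" where
  "loop_reverse p t = p (1 - t)"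

lemma loop_reverse_loop_reverse [simp]: "loop_reverse (loop_reverse p) = p"
  by (auto simp: loop_reverse_def)

lemma loop_reverse_ends [simp]: "loop_reverse p 0 = p 1" "loop_reverse p 1 = p 0"
  by (auto simp: loop_reverse_def)

lemma pathin_loop_reverse: "pathin Y p \<Longrightarrow> pathin Y (loop_reverse p)"
proof -
  assume "pathin Y p"
  moreover have "continuous_map (top_of_set {0..1}) (top_of_set {0..1::real}) (\<lambda>t. 1 - t)"
    by (auto simp: continuous_map_in_subtopology intro!: continuous_intros)
  ultimately have "pathin Y (p \<circ> (\<lambda>t. 1 - t))"
    unfolding pathin_def by (rule continuous_map_compose[rotated])
  then show ?thesis by (simp add: loop_reverse_def[abs_def] o_def)
qed

lemma path_homotopic_assoc:
  assumes "pathin Y p" "pathin Y q" "pathin Y r" "p 1 = q 0" "q 1 = r 0"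
  shows "path_homotopic Y (loop_join (loop_join p q) r) (loop_join p (loop_join q r))"
proof -
  let ?P = "loop_join p (loop_join q r)"
  \<comment> \<open>Sends the break points 1/4 and 1/2 of the left bracketing to the break points
    1/2 and 3/4 of the right one.\<close>
  let ?f = "\<lambda>t::real. min (2 * t) (min (t + 1/4) ((t + 1) / 2))"
  have P: "pathin Y ?P" using assms by (intro pathin_loop_join) auto
  have A: "path_homotopic Y (?P \<circ> id) (?P \<circ> ?f)"
    using P by (intro path_homotopic_reparametrize continuous_intros) (auto simp: min_def)
  have B: "path_homotopic Y (loop_join (loop_join p q) r) (?P \<circ> ?f)"
    using assms by (intro path_homotopic_eq pathin_loop_join)
      (auto simp: loop_join_def min_def intro!: arg_cong[of _ _ p] arg_cong[of _ _ q] arg_cong[of _ _ r])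
  show ?thesis using path_homotopic_trans[OF B path_homotopic_sym[OF A]] by simp
qed

lemma path_homotopic_rid:
  assumes "pathin Y p" "p 1 = x" shows "path_homotopic Y (loop_join p (\<lambda>t. x)) p"
proof -
  let ?f = "\<lambda>t::real. min (2 * t) 1"
  have A: "path_homotopic Y (p \<circ> ?f) (p \<circ> id)"
    using assms by (intro path_homotopic_reparametrize continuous_intros) (auto simp: min_def max_def)
  from path_homotopic_imp_pathin(1)[OF A] have B: "path_homotopic Y (p \<circ> ?f) (loop_join p (\<lambda>t. x))"
    using assms by (intro path_homotopic_eq) (auto simp: loop_join_def min_def field_simps)
  then show ?thesis using path_homotopic_trans[OF path_homotopic_sym[OF B] A] by simp
qed

lemma path_homotopic_lid:
  assumes "pathin Y p" "p 0 = x" shows "path_homotopic Y (loop_join (\<lambda>t. x) p) p"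
proof -
  let ?f = "\<lambda>t::real. max (2 * t - 1) 0"
  have A: "path_homotopic Y (p \<circ> ?f) (p \<circ> id)"
    using assms by (intro path_homotopic_reparametrize continuous_intros) (auto simp: min_def max_def)
  from path_homotopic_imp_pathin(1)[OF A] have B: "path_homotopic Y (p \<circ> ?f) (loop_join (\<lambda>t. x) p)"
    using assms by (intro path_homotopic_eq) (auto simp: loop_join_def max_def field_simps)
  then show ?thesis using path_homotopic_trans[OF path_homotopic_sym[OF B] A] by simp
qed

lemma path_homotopic_rinv:
  assumes "pathin Y p" "p 0 = x" shows "path_homotopic Y (loop_join p (loop_reverse p)) (\<lambda>t. x)"
proof -
  let ?f = "\<lambda>t::real. min (2 * t) (2 - 2 * t)"
  have A: "path_homotopic Y (p \<circ> ?f) (p \<circ> (\<lambda>t. 0))"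
    using assms by (intro path_homotopic_reparametrize continuous_intros) (auto simp: min_def max_def)
  from path_homotopic_imp_pathin(1)[OF A] have B: "path_homotopic Y (p \<circ> ?f) (loop_join p (loop_reverse p))"
    using assms by (intro path_homotopic_eq) (auto simp: loop_join_def loop_reverse_def min_def field_simps)
  have "p \<circ> (\<lambda>t::real. 0) = (\<lambda>t. x)" using assms by auto
  then show ?thesis using path_homotopic_trans[OF path_homotopic_sym[OF B] A] by simp
qed

lemma path_homotopic_linv:
  assumes "pathin Y p" "p 1 = x" shows "path_homotopic Y (loop_join (loop_reverse p) p) (\<lambda>t. x)"
  using path_homotopic_rinv[OF pathin_loop_reverse[OF assms(1)], of x] assms(2) by simp

definition loop_class :: "'a topology \<Rightarrow> 'a \<Rightarrow> (real \<Rightarrow> 'a) \<Rightarrow> (real \<Rightarrow> 'a) set" where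
  "loop_class Y x p = {q. homotopic_loops_in Y x p q}"

lemma loop_class_eq_iff:
  assumes "loop_at Y x p"
  shows "loop_class Y x p = loop_class Y x q \<longleftrightarrow> path_homotopic Y p q"
proof
  assume "loop_class Y x p = loop_class Y x q"
  moreover have "p \<in> loop_class Y x p" using assms by (simp add: loop_class_def homotopic_loops_in_iff loop_at_def)
  ultimately show "path_homotopic Y p q" by (auto simp: loop_class_def homotopic_loops_in_iff path_homotopic_sym)
next
  assume pq: "path_homotopic Y p q"
  then have "q 0 = p 0" "q 1 = p 1" by (auto dest: path_homotopic_ends)
  then show "loop_class Y x p = loop_class Y x q"
    using path_homotopic_trans[of Y p q] path_homotopic_trans[of Y q p] path_homotopic_sym[of Y p q] pq
    by (auto simp: loop_class_def homotopic_loops_in_iff)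
qed

lemma loop_class_eqI: "path_homotopic Y p q \<Longrightarrow> p 0 = x \<Longrightarrow> p 1 = x \<Longrightarrow> loop_class Y x p = loop_class Y x q"
  using path_homotopic_imp_pathin(1)[of Y p q] by (subst loop_class_eq_iff) (auto simp: loop_at_def)

lemma carrier_fundamental_group: "carrier (fundamental_group Y x) = loop_class Y x ` {p. loop_at Y x p}"
  by (auto simp: fundamental_group_def loop_class_def)

lemma one_fundamental_group: "\<one>\<^bsub>fundamental_group Y x\<^esub> = loop_class Y x (\<lambda>t. x)"
  by (auto simp: fundamental_group_def loop_class_def)

lemma loop_at_join: "loop_at Y x p \<Longrightarrow> loop_at Y x q \<Longrightarrow> loop_at Y x (loop_join p q)"
  by (auto simp: loop_at_def intro: pathin_loop_join)

lemma loop_at_loop_reverse: "loop_at Y x p \<Longrightarrow> loop_at Y x (loop_reverse p)"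
  by (auto simp: loop_at_def intro: pathin_loop_reverse)

lemma loop_class_in_carrier [intro]: "loop_at Y x p \<Longrightarrow> loop_class Y x p \<in> carrier (fundamental_group Y x)"
  by (auto simp: carrier_fundamental_group)

lemma mult_fundamental_group:
  assumes "loop_at Y x p" "loop_at Y x q"
  shows "loop_class Y x p \<otimes>\<^bsub>fundamental_group Y x\<^esub> loop_class Y x q = loop_class Y x (loop_join p q)"
proof -
  have "homotopic_loops_in Y x (loop_join p q) r"
    if "homotopic_loops_in Y x p p'" "homotopic_loops_in Y x q q'" "homotopic_loops_in Y x (loop_join p' q') r" for p' q' r
  proof -
    have "path_homotopic Y (loop_join p q) (loop_join p' q')"
      using that unfolding homotopic_loops_in_iff by (intro path_homotopic_join) auto
    from path_homotopic_trans[OF this, of r] show ?thesis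
      using that unfolding homotopic_loops_in_iff by simp
  qed
  moreover have "homotopic_loops_in Y x p p" "homotopic_loops_in Y x q q"
    using assms by (auto simp: homotopic_loops_in_iff loop_at_def)
  ultimately show ?thesis by (auto simp: fundamental_group_def loop_class_def)
qed

lemma loop_at_const: "x \<in> topspace Y \<Longrightarrow> loop_at Y x (\<lambda>t. x)"
  by (auto simp: loop_at_def pathin_def)

lemma group_fundamental_group:
  assumes x: "x \<in> topspace Y"
  shows "group (fundamental_group Y x)"
proof (rule groupI)
  fix a b c
  assume "a \<in> carrier (fundamental_group Y x)" "b \<in> carrier (fundamental_group Y x)" "c \<in> carrier (fundamental_group Y x)"
  then obtain p q r where *: "loop_at Y x p" "a = loop_class Y x p" "loop_at Y x q" "b = loop_class Y x q"
    "loop_at Y x r" "c = loop_class Y x r" by (auto simp: carrier_fundamental_group)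
  then show "a \<otimes>\<^bsub>fundamental_group Y x\<^esub> b \<otimes>\<^bsub>fundamental_group Y x\<^esub> c =
       a \<otimes>\<^bsub>fundamental_group Y x\<^esub> (b \<otimes>\<^bsub>fundamental_group Y x\<^esub> c)"
    by (simp add: mult_fundamental_group loop_at_join)
      (rule loop_class_eqI, auto simp: loop_at_def intro: path_homotopic_assoc)
next
  fix a b
  assume "a \<in> carrier (fundamental_group Y x)" "b \<in> carrier (fundamental_group Y x)"
  then obtain p q where *: "loop_at Y x p" "a = loop_class Y x p" "loop_at Y x q" "b = loop_class Y x q"
    by (auto simp: carrier_fundamental_group)
  then show "a \<otimes>\<^bsub>fundamental_group Y x\<^esub> b \<in> carrier (fundamental_group Y x)"
    by (simp add: mult_fundamental_group loop_at_join loop_class_in_carrier)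
next
  fix a assume "a \<in> carrier (fundamental_group Y x)"
  then obtain p where p: "loop_at Y x p" "a = loop_class Y x p"
    by (auto simp: carrier_fundamental_group)
  then show "\<one>\<^bsub>fundamental_group Y x\<^esub> \<otimes>\<^bsub>fundamental_group Y x\<^esub> a = a"
    by (simp add: mult_fundamental_group one_fundamental_group loop_at_const x)
       (rule loop_class_eqI, auto simp: loop_at_def intro: path_homotopic_lid)
  have "loop_class Y x (loop_reverse p) \<otimes>\<^bsub>fundamental_group Y x\<^esub> a = \<one>\<^bsub>fundamental_group Y x\<^esub>"
    using p by (simp add: mult_fundamental_group one_fundamental_group loop_at_loop_reverse)
       (rule loop_class_eqI, auto simp: loop_at_def intro: path_homotopic_linv)
  then show "\<exists>y\<in>carrier (fundamental_group Y x). y \<otimes>\<^bsub>fundamental_group Y x\<^esub> a = \<one>\<^bsub>fundamental_group Y x\<^esub>"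
    using loop_class_in_carrier[OF loop_at_loop_reverse[OF p(1)]] by (rule bexI)
qed (auto simp: one_fundamental_group loop_at_const x)

lemma inv_fundamental_group:
  assumes "x \<in> topspace Y" "loop_at Y x p"
  shows "inv\<^bsub>fundamental_group Y x\<^esub> (loop_class Y x p) = loop_class Y x (loop_reverse p)"
proof -
  interpret group "fundamental_group Y x" by (rule group_fundamental_group[OF assms(1)])
  have "loop_class Y x (loop_reverse p) \<otimes>\<^bsub>fundamental_group Y x\<^esub> loop_class Y x p = \<one>\<^bsub>fundamental_group Y x\<^esub>"
    using assms by (simp add: mult_fundamental_group one_fundamental_group loop_at_loop_reverse)
       (rule loop_class_eqI, auto simp: loop_at_def intro: path_homotopic_linv)
  then show ?thesis using assms by (intro inv_equality) (auto intro: loop_at_loop_reverse)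
qed

section \<open>Induced homomorphisms and change of base point\<close>

definition induced_map :: "'b topology \<Rightarrow> 'b \<Rightarrow> ('a \<Rightarrow> 'b) \<Rightarrow> (real \<Rightarrow> 'a) set \<Rightarrow> (real \<Rightarrow> 'b) set" where
  "induced_map Z z k A = {r. \<exists>p\<in>A. homotopic_loops_in Z z (k \<circ> p) r}"

lemma loop_at_compose: "loop_at Y x p \<Longrightarrow> continuous_map Y Z k \<Longrightarrow> k x = z \<Longrightarrow> loop_at Z z (k \<circ> p)"
  by (auto simp: loop_at_def pathin_def intro: continuous_map_compose)

lemma induced_map_loop_class:
  assumes "loop_at Y x p" "continuous_map Y Z k" "k x = z"
  shows "induced_map Z z k (loop_class Y x p) = loop_class Z z (k \<circ> p)"
proof -
  have "homotopic_loops_in Z z (k \<circ> p) r" if "homotopic_loops_in Y x p q" "homotopic_loops_in Z z (k \<circ> q) r" for q r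
  proof -
    have "path_homotopic Z (k \<circ> p) (k \<circ> q)"
      using that(1) path_homotopic_compose assms(2) unfolding homotopic_loops_in_iff by blast
    then have "path_homotopic Z (k \<circ> p) r"
      using that(2) path_homotopic_trans unfolding homotopic_loops_in_iff by blast
    then show ?thesis using that(1) assms(3) unfolding homotopic_loops_in_iff by simp
  qed
  moreover have "homotopic_loops_in Y x p p"
    using assms by (auto simp: homotopic_loops_in_iff loop_at_def)
  ultimately show ?thesis by (auto simp: induced_map_def loop_class_def)
qed

lemma comp_loop_join: "k \<circ> loop_join p q = loop_join (k \<circ> p) (k \<circ> q)"
  by (auto simp: loop_join_def)

lemma induced_map_hom:
  assumes "continuous_map Y Z k" "k x = z"
  shows "induced_map Z z k \<in> hom (fundamental_group Y x) (fundamental_group Z z)"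
proof (rule homI)
  fix a assume "a \<in> carrier (fundamental_group Y x)"
  then show "induced_map Z z k a \<in> carrier (fundamental_group Z z)"
    using assms by (auto simp: carrier_fundamental_group induced_map_loop_class loop_at_compose)
next
  fix a b assume "a \<in> carrier (fundamental_group Y x)" "b \<in> carrier (fundamental_group Y x)"
  then obtain p q where "loop_at Y x p" "a = loop_class Y x p" "loop_at Y x q" "b = loop_class Y x q"
    by (auto simp: carrier_fundamental_group)
  then show "induced_map Z z k (a \<otimes>\<^bsub>fundamental_group Y x\<^esub> b) =
    induced_map Z z k a \<otimes>\<^bsub>fundamental_group Z z\<^esub> induced_map Z z k b"
    using assms
    by (simp add: induced_map_loop_class[OF _ assms] mult_fundamental_group
      loop_at_join loop_at_compose[OF _ assms] comp_loop_join)
qed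

text \<open>Conjugation by the path \<open>g\<close>. The auxiliary \<open>F\<close> takes the path
  and its end point as parameters, so that the cancellation \<open>FF\<close> serves for both
  composites, once for \<open>g\<close> and once for its reverse.\<close>

lemma fundamental_group_base_change:
  assumes g: "pathin Y g" "g 0 = y" "g 1 = x"
  shows "\<exists>\<phi>. \<phi> \<in> iso (fundamental_group Y y) (fundamental_group Y x)"
proof -
  let ?G = "fundamental_group Y y" and ?H = "fundamental_group Y x"
  let ?c = "\<lambda>g p. loop_join (loop_reverse g) (loop_join p g)"
  define F where "F g x A = {r. \<exists>p\<in>A. homotopic_loops_in Y x (?c g p) r}" for g x A
  have lc: "loop_at Y x (?c g p)" if "loop_at Y y p" "pathin Y g" "g 0 = y" "g 1 = x" for p g x y
    using that by (auto simp: loop_at_def intro!: pathin_loop_join pathin_loop_reverse)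
  have F: "F g x (loop_class Y y p) = loop_class Y x (?c g p)"
    if p: "loop_at Y y p" and g: "pathin Y g" "g 0 = y" "g 1 = x" for p g x y
  proof -
    have "homotopic_loops_in Y x (?c g p) r" if "homotopic_loops_in Y y p q" "homotopic_loops_in Y x (?c g q) r" for q r
    proof -
      have "path_homotopic Y (?c g p) (?c g q)"
        using that(1) g unfolding homotopic_loops_in_iff by (intro path_homotopic_join) (auto simp: pathin_loop_reverse)
      then have "path_homotopic Y (?c g p) r"
        using that(2) path_homotopic_trans unfolding homotopic_loops_in_iff by blast
      then show ?thesis using g unfolding homotopic_loops_in_iff by simp
    qed
    moreover have "homotopic_loops_in Y y p p"
      using p by (auto simp: homotopic_loops_in_iff loop_at_def)
    ultimately show ?thesis by (auto simp: F_def loop_class_def)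
  qed
  have FF: "F (loop_reverse g) y (F g x (loop_class Y y p)) = loop_class Y y p"
    if p: "loop_at Y y p" and g: "pathin Y g" "g 0 = y" "g 1 = x" for p g x y
  proof -
    let ?r = "loop_reverse g"
    have r: "pathin Y ?r" "?r 0 = x" "?r 1 = y" and pp: "pathin Y p" "p 0 = y" "p 1 = y"
      using g p by (auto simp: pathin_loop_reverse loop_at_def)
    have "path_homotopic Y (?c ?r (?c g p)) (loop_join g (loop_join ?r (loop_join (loop_join p g) ?r)))"
      unfolding loop_reverse_loop_reverse using g r pp
      by (intro path_homotopic_join[of Y g g] path_homotopic_assoc) (simp_all add: pathin_loop_join)
    also have "path_homotopic Y \<dots> (loop_join (loop_join g ?r) (loop_join (loop_join p g) ?r))"
      using g r pp by (intro path_homotopic_sym[OF path_homotopic_assoc]) (simp_all add: pathin_loop_join)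
    also have "path_homotopic Y \<dots> (loop_join (\<lambda>t. y) (loop_join p (loop_join g ?r)))"
      using g r pp by (intro path_homotopic_join path_homotopic_rinv path_homotopic_assoc) simp_all
    also have "path_homotopic Y \<dots> (loop_join p (loop_join g ?r))"
      using g r pp by (intro path_homotopic_lid) (simp_all add: pathin_loop_join)
    also have "path_homotopic Y \<dots> (loop_join p (\<lambda>t. y))"
      using g r pp by (intro path_homotopic_join[of Y p p] path_homotopic_rinv) simp_all
    also have "path_homotopic Y \<dots> p"
      using pp by (intro path_homotopic_rid) simp_all
    finally have "path_homotopic Y (?c ?r (?c g p)) p" .
    moreover have "F ?r y (F g x (loop_class Y y p)) = loop_class Y y (?c ?r (?c g p))"
      using F[OF p g] F[of x "?c g p" "?r" y] lc[OF p g] r by simp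
    ultimately show ?thesis using r by (simp add: loop_class_eqI)
  qed
  have hom: "F g x \<in> hom ?G ?H"
  proof (rule homI)
    fix a assume "a \<in> carrier ?G"
    then show "F g x a \<in> carrier ?H"
      using F[OF _ g] lc[OF _ g] by (auto simp: carrier_fundamental_group)
  next
    fix a b assume "a \<in> carrier ?G" "b \<in> carrier ?G"
    then obtain p q where pq: "loop_at Y y p" "a = loop_class Y y p" "loop_at Y y q" "b = loop_class Y y q"
      by (auto simp: carrier_fundamental_group)
    let ?r = "loop_reverse g"
    have r: "pathin Y ?r" "?r 0 = x" "?r 1 = y" and pp: "pathin Y p" "p 0 = y" "p 1 = y" "pathin Y q" "q 0 = y" "q 1 = y"
      using g pq by (auto simp: pathin_loop_reverse loop_at_def)
    have "path_homotopic Y (loop_join (?c g p) (?c g q)) (loop_join ?r (loop_join (loop_join p g) (?c g q)))"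
      using g r pp by (intro path_homotopic_assoc) (simp_all add: pathin_loop_join)
    also have "path_homotopic Y \<dots> (loop_join ?r (loop_join p (loop_join g (?c g q))))"
      using g r pp by (intro path_homotopic_join[of Y ?r ?r] path_homotopic_assoc) (simp_all add: pathin_loop_join)
    also have "path_homotopic Y \<dots> (loop_join ?r (loop_join p (loop_join (loop_join g ?r) (loop_join q g))))"
      using g r pp by (intro path_homotopic_join[of Y ?r ?r] path_homotopic_join[of Y p p] path_homotopic_sym[OF path_homotopic_assoc]) (simp_all add: pathin_loop_join)
    also have "path_homotopic Y \<dots> (loop_join ?r (loop_join p (loop_join (\<lambda>t. y) (loop_join q g))))"
      using g r pp by (intro path_homotopic_join[of Y ?r ?r] path_homotopic_join[of Y p p] path_homotopic_join[of Y _ _ "loop_join q g"] path_homotopic_rinv) (simp_all add: pathin_loop_join)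
    also have "path_homotopic Y \<dots> (loop_join ?r (loop_join p (loop_join q g)))"
      using g r pp by (intro path_homotopic_join[of Y ?r ?r] path_homotopic_join[of Y p p] path_homotopic_lid) (simp_all add: pathin_loop_join)
    also have "path_homotopic Y \<dots> (?c g (loop_join p q))"
      using g r pp by (intro path_homotopic_join[of Y ?r ?r] path_homotopic_sym[OF path_homotopic_assoc]) (simp_all add: pathin_loop_join)
    finally have "loop_class Y x (loop_join (?c g p) (?c g q)) = loop_class Y x (?c g (loop_join p q))"
      using r g by (intro loop_class_eqI) auto
    then show "F g x (a \<otimes>\<^bsub>?G\<^esub> b) = F g x a \<otimes>\<^bsub>?H\<^esub> F g x b"
      using pq F[OF _ g] lc[OF _ g] by (simp add: mult_fundamental_group loop_at_join)
  qed
  have "bij_betw (F g x) (carrier ?G) (carrier ?H)"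
  proof (rule bij_betw_byWitness[where f'="F (loop_reverse g) y"])
    have r: "pathin Y (loop_reverse g)" "loop_reverse g 0 = x" "loop_reverse g 1 = y" using g by (auto intro: pathin_loop_reverse)
    show "\<forall>a\<in>carrier ?G. F (loop_reverse g) y (F g x a) = a"
      using FF[OF _ g] by (auto simp: carrier_fundamental_group)
    show "\<forall>a\<in>carrier ?H. F g x (F (loop_reverse g) y a) = a"
      using FF[OF _ r] by (auto simp: carrier_fundamental_group)
    show "F g x ` carrier ?G \<subseteq> carrier ?H"
      using F[OF _ g] lc[OF _ g] by (auto simp: carrier_fundamental_group)
    show "F (loop_reverse g) y ` carrier ?H \<subseteq> carrier ?G"
      using F[OF _ r] lc[OF _ r] by (auto simp: carrier_fundamental_group)
  qed
  then show ?thesis using hom by (auto simp: iso_def)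
qed

section \<open>Lifting paths and homotopies\<close>

lemma connected_space_unit_interval: "connected_space (top_of_set {0..1::real})"
  using connected_Icc[of 0 "1::real"] unfolding connectedin_iff_connected[symmetric] connectedin_def by simp

text \<open>Square lifting is applied to the map that ignores the first coordinate, and the lift is
  read off on the edge where that coordinate is 0.\<close>

lemma path_lift:
  assumes cov: "evenly_covering_map C Y p" and g: "pathin Y g" and c: "c \<in> topspace C" "p c = g 0"
  shows "\<exists>f. pathin C f \<and> f 0 = c \<and> (\<forall>t\<in>{0..1}. p (f t) = g t)"
proof -
  let ?S = "{0..1} \<times> {0..1} :: (real \<times> real) set"
  have "continuous_map (top_of_set ?S) (top_of_set {0..1}) snd"
    by (auto simp: continuous_map_in_subtopology intro!: continuous_intros)
  then have "continuous_map (top_of_set ?S) Y (g \<circ> snd)"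
    using g unfolding pathin_def by (rule continuous_map_compose)
  from liftable_square[OF cov this, unfolded liftable_def, rule_format, of "(0,0)" c]
  obtain f where f: "continuous_map (top_of_set ?S) C f"
    "\<forall>z\<in>?S. p (f z) = (g \<circ> snd) z" "f (0,0) = c"
    using c by auto
  have "continuous_map (top_of_set {0..1}) (top_of_set ?S) (\<lambda>t. (0::real, t))"
    by (auto simp: continuous_map_in_subtopology intro!: continuous_intros)
  then have "continuous_map (top_of_set {0..1}) C (f \<circ> (\<lambda>t. (0, t)))"
    using f(1) by (rule continuous_map_compose)
  then show ?thesis using f by (intro exI[of _ "f \<circ> (\<lambda>t. (0, t))"]) (auto simp: pathin_def)
qed

lemma path_lift_unique:
  assumes cov: "evenly_covering_map C Y p" and f: "pathin C f" and g: "pathin C g" and "f 0 = g 0"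
    and "\<And>t. t \<in> {0..1} \<Longrightarrow> p (f t) = p (g t)" and t: "t \<in> {0..1}"
  shows "f t = g t"
  by (rule lift_unique[OF cov connected_space_unit_interval, of f g 0])
     (use assms in \<open>simp_all add: pathin_def\<close>)

text \<open>The homotopy is lifted as a map of the square. The edges lying over the two end points
  project to constants, so by uniqueness they are constant themselves; the lift is a homotopy with
  fixed ends, and lifts of homotopic paths end at the same point.\<close>

lemma path_homotopic_lift:
  assumes cov: "evenly_covering_map C Y p" and qr: "path_homotopic Y q r"
    and f: "pathin C f" "\<And>t. t \<in> {0..1} \<Longrightarrow> p (f t) = q t"
    and g: "pathin C g" "\<And>t. t \<in> {0..1} \<Longrightarrow> p (g t) = r t" and fg: "f 0 = g 0"
  shows "path_homotopic C f g"
proof -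
  let ?S = "{0..1} \<times> {0..1} :: (real \<times> real) set"
  obtain h where h: "continuous_map (top_of_set ?S) Y h"
     "\<forall>t\<in>{0..1}. h (0, t) = q t" "\<forall>t\<in>{0..1}. h (1, t) = r t"
     "\<forall>s\<in>{0..1}. h (s, 0) = q 0 \<and> h (s, 1) = q 1"
    using qr unfolding path_homotopic_square by blast
  have "f 0 \<in> topspace C" using continuous_map_funspace[OF f(1)[unfolded pathin_def]] by auto
  then obtain k where k: "continuous_map (top_of_set ?S) C k"
    "\<forall>z\<in>?S. p (k z) = h z" "k (0,0) = f 0"
    using liftable_square[OF cov h(1), unfolded liftable_def, rule_format, of "(0,0)" "f 0"] h f(2)[of 0] by auto
  have vert: "pathin C (\<lambda>t. k (s, t))" if "s \<in> {0..1}" for s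
  proof -
    have "continuous_map (top_of_set {0..1}) (top_of_set ?S) (\<lambda>t. (s, t))"
      using that by (auto simp: continuous_map_in_subtopology intro!: continuous_intros)
    from continuous_map_compose[OF this k(1)] show ?thesis by (simp add: pathin_def o_def)
  qed
  have hor: "pathin C (\<lambda>s. k (s, t))" if "t \<in> {0..1}" for t
  proof -
    have "continuous_map (top_of_set {0..1}) (top_of_set ?S) (\<lambda>s. (s, t))"
      using that by (auto simp: continuous_map_in_subtopology intro!: continuous_intros)
    from continuous_map_compose[OF this k(1)] show ?thesis by (simp add: pathin_def o_def)
  qed
  have hconst: "k (s, t) = k (0, t)" if s: "s \<in> {0..1}" and t: "t \<in> {0,1}" for s t
  proof (rule path_lift_unique[OF cov hor _ _ _ s])
    have "k (0, t) \<in> topspace C" using continuous_map_funspace[OF k(1)] t by auto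
    then show "pathin C (\<lambda>s. k (0, t))" by (simp add: pathin_def)
    show "p (k (s', t)) = p (k (0, t))" if "s' \<in> {0..1}" for s'
      using k(2) h(4) t that by auto
  qed (use t in auto)
  have left: "k (0, t) = f t" if t: "t \<in> {0..1}" for t
  proof (rule path_lift_unique[OF cov vert f(1) _ _ t])
    show "p (k (0, t)) = p (f t)" if "t \<in> {0..1}" for t
      using k(2) h(2) f(2) that by auto
  qed (use k in auto)
  have right: "k (1, t) = g t" if t: "t \<in> {0..1}" for t
  proof (rule path_lift_unique[OF cov vert g(1) _ _ t])
    show "p (k (1, t)) = p (g t)" if "t \<in> {0..1}" for t
      using k(2) h(3) g(2) that by auto
    show "k (1, 0) = g 0" using hconst[of 1 0] k(3) fg by simp
  qed auto
  show ?thesis unfolding path_homotopic_square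
  proof (intro exI[of _ k] conjI ballI)
    fix s :: real assume s: "s \<in> {0..1}"
    show "k (s, 0) = f 0" using hconst[OF s, of 0] left[of 0] by simp
    show "k (s, 1) = f 1" using hconst[OF s, of 1] left[of 1] by simp
  qed (use k left right in auto)
qed

section \<open>Words, free groups and split extensions\<close>

lemma word_eval_in_carrier:
  assumes "group G" "g ` {..<n} \<subseteq> carrier G" "\<forall>(i, b)\<in>set ws. i < n"
  shows "word_eval G g ws \<in> carrier G"
proof -
  interpret group G by fact
  show ?thesis using assms(2,3) by (induction ws) (auto simp: word_eval_def image_subset_iff)
qed

lemma word_eval_hom:
  assumes G: "group G" and H: "group H" and h: "h \<in> hom G H" and g: "g ` {..<n} \<subseteq> carrier G"
    and ws: "\<forall>(i, b)\<in>set ws. i < n"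
  shows "word_eval H (h \<circ> g) ws = h (word_eval G g ws)"
proof -
  interpret group_hom G H h using G H h by (simp add: group_hom_def group_hom_axioms_def)
  show ?thesis using ws
  proof (induction ws)
    case Nil then show ?case by (simp add: word_eval_def)
  next
    case (Cons a ws)
    obtain i b where a: "a = (i, b)" by (cases a)
    have i: "g i \<in> carrier G" using Cons.prems g a by auto
    have w: "word_eval G g ws \<in> carrier G" using word_eval_in_carrier[OF G g] Cons.prems by auto
    have "word_eval H (h \<circ> g) (a # ws) = (if b then h (g i) else inv\<^bsub>H\<^esub> (h (g i))) \<otimes>\<^bsub>H\<^esub> word_eval H (h \<circ> g) ws"
      by (simp add: word_eval_def a)
    also have "\<dots> = h ((if b then g i else inv\<^bsub>G\<^esub> (g i)) \<otimes>\<^bsub>G\<^esub> word_eval G g ws)"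
      using Cons.IH Cons.prems i w by (simp add: o_def)
    also have "\<dots> = h (word_eval G g (a # ws))" by (simp add: word_eval_def a)
    finally show ?case .
  qed
qed

lemma free_of_rank_iso:
  assumes G: "group G" and H: "group H" and h: "h \<in> iso G H" and free: "free_of_rank G n"
  shows "free_of_rank H n"
proof -
  interpret group_hom G H h using G H h by (simp add: group_hom_def group_hom_axioms_def iso_def)
  from free[unfolded free_of_rank_def]
  obtain g where g: "g ` {..<n} \<subseteq> carrier G" "generate G (g ` {..<n}) = carrier G"
    and w: "\<forall>ws. ws \<noteq> [] \<and> reduced_word ws \<and> (\<forall>(i, b)\<in>set ws. i < n) \<longrightarrow> word_eval G g ws \<noteq> \<one>\<^bsub>G\<^esub>"
    by (elim conjE exE)
  have bij: "inj_on h (carrier G)" "h ` carrier G = carrier H" using h by (auto simp: iso_def bij_betw_def)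
  have "(h \<circ> g) ` {..<n} \<subseteq> carrier H" using g by auto
  moreover have "generate H ((h \<circ> g) ` {..<n}) = carrier H"
    using generate_img[OF g(1)] g(2) bij by (simp add: image_comp)
  moreover have "word_eval H (h \<circ> g) ws \<noteq> \<one>\<^bsub>H\<^esub>"
    if "ws \<noteq> []" "reduced_word ws" "\<forall>(i, b)\<in>set ws. i < n" for ws
  proof -
    have "word_eval G g ws \<noteq> \<one>\<^bsub>G\<^esub>" "word_eval G g ws \<in> carrier G"
      using w[rule_format, of ws] that word_eval_in_carrier[OF G g(1) that(3)] by simp_all
    then have "h (word_eval G g ws) \<noteq> h \<one>\<^bsub>G\<^esub>" using bij(1) by (auto simp: inj_on_def)
    then show ?thesis using word_eval_hom[OF G H homh g(1) that(3)] by simp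
  qed
  ultimately show ?thesis using H unfolding free_of_rank_def by (intro conjI exI[of _ "h \<circ> g"]) simp_all
qed

text \<open>The kernel of \<open>P\<close> is the normal factor and the image of the section
  \<open>s\<close> the free one: \<open>x\<close> is the product of \<open>x * (s (P x))^-1\<close>,
  which lies in the kernel, and \<open>s (P x)\<close>.\<close>

lemma is_F3_semidirect_Z2_split:
  assumes G: "group G" and F: "group F" and P: "P \<in> hom G F" and s: "s \<in> hom F G"
    and Ps: "\<And>x. x \<in> carrier F \<Longrightarrow> P (s x) = x" and free: "free_of_rank F 3"
    and N: "\<psi> \<in> iso (integer_group \<times>\<times> integer_group) (G\<lparr>carrier := kernel G F P\<rparr>)"
  shows "is_F3_semidirect_Z2 G"
proof -
  interpret P: group_hom G F P using G F P by (simp add: group_hom_def group_hom_axioms_def)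
  interpret s: group_hom F G s using G F s by (simp add: group_hom_def group_hom_axioms_def)
  let ?N = "kernel G F P" and ?K = "s ` carrier F"
  have K: "subgroup ?K G" by (rule s.img_is_subgroup)
  have "?N \<lhd> G" by (rule P.normal_kernel)
  then have subN: "subgroup ?N G" by (rule normal_imp_subgroup)
  have grpK: "group (G\<lparr>carrier := ?K\<rparr>)"
    using subgroup.subgroup_is_group[OF K G] .
  have "(integer_group \<times>\<times> integer_group) \<cong> (G\<lparr>carrier := ?N\<rparr>)" using N by (auto simp: is_iso_def)
  then have "(G\<lparr>carrier := ?N\<rparr>) \<cong> (integer_group \<times>\<times> integer_group)"
    by (rule group.iso_sym[OF DirProd_group[OF group_integer_group group_integer_group]])
  moreover have "s \<in> iso F (G\<lparr>carrier := ?K\<rparr>)"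
  proof -
    have "inj_on s (carrier F)" by (rule inj_on_inverseI[of _ P]) (rule Ps)
    then show ?thesis using s by (simp add: iso_def hom_def bij_betw_def Pi_iff)
  qed
  then have "free_of_rank (G\<lparr>carrier := ?K\<rparr>) 3"
    by (rule free_of_rank_iso[OF F grpK _ free])
  moreover have "?N \<inter> ?K = {\<one>\<^bsub>G\<^esub>}"
  proof -
    have "x = \<one>\<^bsub>G\<^esub>" if xN: "x \<in> ?N" and xK: "x \<in> ?K" for x
    proof -
      obtain y where y: "y \<in> carrier F" "x = s y" using xK by blast
      then have "y = \<one>\<^bsub>F\<^esub>" using xN Ps[OF y(1)] by (simp add: kernel_def)
      then show ?thesis using y by simp
    qed
    moreover have "\<one>\<^bsub>G\<^esub> \<in> ?N" "\<one>\<^bsub>G\<^esub> \<in> ?K" using subgroup.one_closed subN K by blast+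
    ultimately show ?thesis by blast
  qed
  moreover have "?N <#>\<^bsub>G\<^esub> ?K = carrier G"
  proof -
    have "x \<in> ?N <#>\<^bsub>G\<^esub> ?K" if x: "x \<in> carrier G" for x
    proof -
      let ?k = "s (P x)"
      have k: "?k \<in> ?K" "?k \<in> carrier G" using x by auto
      have "x \<otimes>\<^bsub>G\<^esub> inv\<^bsub>G\<^esub> ?k \<in> ?N" using x k Ps by (auto simp: kernel_def)
      moreover have "x = (x \<otimes>\<^bsub>G\<^esub> inv\<^bsub>G\<^esub> ?k) \<otimes>\<^bsub>G\<^esub> ?k" using x k by (simp add: P.G.m_assoc)
      ultimately show ?thesis using k unfolding set_mult_def by blast
    qed
    moreover have "?N <#>\<^bsub>G\<^esub> ?K \<subseteq> carrier G" using subN K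
      by (intro P.G.set_mult_closed) (auto dest: subgroup.subset)
    ultimately show ?thesis by blast
  qed
  ultimately show ?thesis using G \<open>?N \<lhd> G\<close> K unfolding is_F3_semidirect_Z2_def
    by (intro conjI exI[of _ ?N] exI[of _ ?K]) simp_all
qed

text \<open>Moves the splitting along an isomorphism, so that it has to be constructed at one base
  point only.\<close>

lemma is_F3_semidirect_Z2_split_iso:
  assumes G': "group G'" and f: "f \<in> iso G' G"
    and G: "group G" and F: "group F" and P: "P \<in> hom G F" and s: "s \<in> hom F G"
    and Ps: "\<And>x. x \<in> carrier F \<Longrightarrow> P (s x) = x" and free: "free_of_rank F 3"
    and N: "\<psi> \<in> iso (integer_group \<times>\<times> integer_group) (G\<lparr>carrier := kernel G F P\<rparr>)"
  shows "is_F3_semidirect_Z2 G'"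
proof (rule is_F3_semidirect_Z2_split[OF G' F _ _ _ free])
  let ?g = "inv_into (carrier G') f"
  have g: "?g \<in> iso G G'" by (rule group.iso_set_sym[OF G' f])
  have fg: "f (?g x) = x" if "x \<in> carrier G" for x
    using f that by (auto simp: iso_def bij_betw_def f_inv_into_f)
  have gf: "?g (f x) = x" if "x \<in> carrier G'" for x
    using f that by (auto simp: iso_def bij_betw_def)
  have fc: "f x \<in> carrier G" if "x \<in> carrier G'" for x using f that by (auto simp: iso_def hom_def)
  have gc: "?g x \<in> carrier G'" if "x \<in> carrier G" for x using g that by (auto simp: iso_def hom_def)
  show "P \<circ> f \<in> hom G' F" using f P by (intro hom_compose) (auto simp: iso_def)
  show "?g \<circ> s \<in> hom F G'" using g s by (intro hom_compose) (auto simp: iso_def)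
  show "(P \<circ> f) ((?g \<circ> s) x) = x" if "x \<in> carrier F" for x
    using that s Ps by (simp add: fg hom_in_carrier)
  have "?g \<in> iso (G\<lparr>carrier := kernel G F P\<rparr>) (G'\<lparr>carrier := kernel G' F (P \<circ> f)\<rparr>)"
  proof -
    have "?g \<in> hom (G\<lparr>carrier := kernel G F P\<rparr>) (G'\<lparr>carrier := kernel G' F (P \<circ> f)\<rparr>)"
      using g by (auto simp: hom_def iso_def kernel_def fg gc)
    moreover have "bij_betw ?g (kernel G F P) (kernel G' F (P \<circ> f))"
      by (rule bij_betw_byWitness[where f'=f]) (auto simp: kernel_def fg gf fc gc)
    ultimately show ?thesis by (simp add: iso_def)
  qed
  then show "?g \<circ> \<psi> \<in> iso (integer_group \<times>\<times> integer_group) (G'\<lparr>carrier := kernel G' F (P \<circ> f)\<rparr>)"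
    using N by (intro iso_set_trans)
qed

section \<open>The thrice punctured plane\<close>

definition punctured_plane :: "complex set" where "punctured_plane = - {-2, 0, 2}"

text \<open>Each puncture is cut off by a vertical broken line; \<open>upper_slit\<close> and \<open>lower_slit\<close> remove
  the lower and the upper half of these lines. The bends make both sets starlike.\<close>

definition slit_lines :: "complex set" where
  "slit_lines = {z. Re z = - 2 - \<bar>Im z\<bar> \<or> Re z = 0 \<or> Re z = 2 + \<bar>Im z\<bar>}"

definition upper_slit :: "complex set" where "upper_slit = {z. z \<in> slit_lines \<longrightarrow> Im z > 0}"
definition lower_slit :: "complex set" where "lower_slit = {z. z \<in> slit_lines \<longrightarrow> Im z < 0}"

text \<open>Numbers the four strips from left to right. On the lines the value is a convention: the
  two charts of \<open>word_cover\<close> overlap only off the lines.\<close>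

definition region :: "complex \<Rightarrow> nat" where
  "region z = (if Re z \<le> - 2 - \<bar>Im z\<bar> then 0 else if Re z \<le> 0 then 1 else if Re z \<le> 2 + \<bar>Im z\<bar> then 2 else 3)"

definition strip :: "nat \<Rightarrow> complex set" where "strip j = {z. z \<notin> slit_lines \<and> region z = j}"

definition strip_center :: "nat \<Rightarrow> complex" where "strip_center j = of_real (2 * real j - 3)"

lemma slit_Un: "upper_slit \<union> lower_slit = punctured_plane"
  by (auto simp: upper_slit_def lower_slit_def punctured_plane_def slit_lines_def complex_eq_iff)

lemma slit_Int: "upper_slit \<inter> lower_slit = - slit_lines"
  by (auto simp: upper_slit_def lower_slit_def)

lemma closed_halfslit: "closed (slit_lines \<inter> {z. Im z \<le> 0})" "closed (slit_lines \<inter> {z. 0 \<le> Im z})"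
  unfolding slit_lines_def Collect_disj_eq Int_Un_distrib2
  by (intro closed_Un closed_Int closed_Collect_eq closed_Collect_le continuous_intros)+

lemma open_slit: "open upper_slit" "open lower_slit"
proof -
  have "upper_slit = - (slit_lines \<inter> {z. Im z \<le> 0})" "lower_slit = - (slit_lines \<inter> {z. 0 \<le> Im z})"
    by (auto simp: upper_slit_def lower_slit_def)
  then show "open upper_slit" "open lower_slit" using closed_halfslit[THEN open_Compl] by simp_all
qed

lemma strip_eq:
  "strip 0 = {z. Re z < - 2 - \<bar>Im z\<bar>}"
  "strip 1 = {z. - 2 - \<bar>Im z\<bar> < Re z} \<inter> {z. Re z < 0}"
  "strip 2 = {z. 0 < Re z} \<inter> {z. Re z < 2 + \<bar>Im z\<bar>}"
  "strip 3 = {z. 2 + \<bar>Im z\<bar> < Re z}"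
  by (auto simp: strip_def region_def slit_lines_def)

lemma strip_gt: "j > 3 \<Longrightarrow> strip j = {}" by (auto simp: strip_def region_def)

lemma open_strip: "open (strip j)"
proof -
  consider "j = 0" | "j = 1" | "j = 2" | "j = 3" | "j > 3" by linarith
  then show ?thesis
    by cases (auto simp: strip_gt strip_eq[simplified] intro!: open_Int open_Collect_less continuous_intros)
qed

text \<open>The removed lower rays lie on the lines \<open>Re z = 0\<close> and
  \<open>Re z = +-(2 - Im z)\<close>. All three pass through \<open>2 * \<i>\<close>, and the rays
  point away from it, so a segment from this centre that meets a removed ray has its end on that
  ray.\<close>

lemma starlike_upper_slit: "starlike upper_slit"
  unfolding starlike_def
proof (intro bexI ballI subsetI)
  fix z w assume z: "z \<in> upper_slit" and w: "w \<in> closed_segment (2 * \<i>) z"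
  then obtain u where u: "0 \<le> u" "u \<le> 1" "w = (1 - u) *\<^sub>R (2 * \<i>) + u *\<^sub>R z"
    by (auto simp: closed_segment_def)
  have re: "Re w = u * Re z" and im: "Im w = 2 - u * (2 - Im z)" unfolding u(3) by (simp_all add: algebra_simps)
  show "w \<in> upper_slit"
  proof (rule ccontr)
    assume "w \<notin> upper_slit"
    then have sl: "w \<in> slit_lines" and le: "Im w \<le> 0" by (auto simp: upper_slit_def)
    have *: "u * (2 - Im z) \<ge> 2" using le im by simp
    have "u > 0" using * u by (cases "u = 0") auto
    have "2 - Im z \<ge> 2"
    proof (rule ccontr)
      assume "\<not> 2 - Im z \<ge> 2"
      then have "u * (2 - Im z) < u * 2" using \<open>u > 0\<close> by simp
      also have "\<dots> \<le> 2" using u by simp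
      finally show False using * by simp
    qed
    then have iz: "Im z \<le> 0" by simp
    have "Re w = - (u * (2 - Im z)) \<or> Re w = 0 \<or> Re w = u * (2 - Im z)"
      using sl le im by (auto simp: slit_lines_def)
    then have "u * (Re z - Im z + 2) = 0 \<or> u * Re z = 0 \<or> u * (Re z + Im z - 2) = 0"
      unfolding re by (auto simp: algebra_simps)
    then have "z \<in> slit_lines" using \<open>u > 0\<close> iz by (auto simp: slit_lines_def)
    then show False using z iz by (auto simp: upper_slit_def)
  qed
qed (auto simp: upper_slit_def)

lemma starlike_lower_slit: "starlike lower_slit"
proof -
  have eq: "lower_slit = cnj ` upper_slit"
  proof
    have "z \<in> cnj ` upper_slit" if "z \<in> lower_slit" for z
      using that by (intro image_eqI[of _ _ "cnj z"]) (auto simp: upper_slit_def lower_slit_def slit_lines_def)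
    then show "lower_slit \<subseteq> cnj ` upper_slit" by blast
  qed (auto simp: upper_slit_def lower_slit_def slit_lines_def)
  obtain a where a: "a \<in> upper_slit" "\<And>z. z \<in> upper_slit \<Longrightarrow> closed_segment a z \<subseteq> upper_slit"
    using starlike_upper_slit by (auto simp: starlike_def)
  have "closed_segment (cnj a) (cnj z) \<subseteq> cnj ` upper_slit" if "z \<in> upper_slit" for z
    using a(2)[OF that] closed_segment_linear_image[OF bounded_linear.linear[OF bounded_linear_cnj], of a z] by auto
  then show ?thesis unfolding eq starlike_def using a(1) by blast
qed

lemma strip_center_in: "j \<le> 3 \<Longrightarrow> strip_center j \<in> strip j"
proof -
  assume "j \<le> 3"
  then consider "j = 0" | "j = 1" | "j = 2" | "j = 3" by linarith
  then show ?thesis by cases (auto simp: strip_def region_def slit_lines_def strip_center_def)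
qed

text \<open>Strips 1 and 2 are not convex. But the centre is real, so the absolute value of
  \<open>Im\<close> grows linearly along the segment, and each defining inequality becomes a convex
  combination of the one at \<open>z\<close> and the one at the centre, where it holds with margin
  1.\<close>

lemma starlike_strip: "j \<le> 3 \<Longrightarrow> starlike (strip j)"
proof -
  assume j: "j \<le> 3"
  have "closed_segment (strip_center j) z \<subseteq> strip j" if z: "z \<in> strip j" for z
  proof
    fix w assume w: "w \<in> closed_segment (strip_center j) z"
    then obtain u where u: "0 \<le> u" "u \<le> 1" "w = (1 - u) *\<^sub>R strip_center j + u *\<^sub>R z"
      by (auto simp: closed_segment_def)
    have re: "Re w = (1 - u) * (2 * real j - 3) + u * Re z" and im: "Im w = u * Im z"
      unfolding u(3) by (auto simp: strip_center_def)
    have abs: "\<bar>Im w\<bar> = u * \<bar>Im z\<bar>" unfolding im using u(1) by (simp add: abs_mult)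
    have comb: "(1 - u) * a + u * b > 0" if "a > 0" "b > 0" for a b :: real
    proof (cases "u = 0")
      case False
      then have "u * b > 0" "(1 - u) * a \<ge> 0" using u that by auto
      then show ?thesis by linarith
    qed (use that in auto)
    consider "j = 0" | "j = 1" | "j = 2" | "j = 3" using j by linarith
    then show "w \<in> strip j"
    proof cases
      case 1
      have "(1 - u) * 1 + u * (- 2 - \<bar>Im z\<bar> - Re z) > 0"
        by (rule comb) (use z in \<open>auto simp: 1 strip_eq\<close>)
      then show ?thesis unfolding 1 strip_eq using re abs by (auto simp: 1 algebra_simps)
    next
      case 2
      have "(1 - u) * 1 + u * (2 + \<bar>Im z\<bar> + Re z) > 0"
        by (rule comb) (use z in \<open>auto simp: 2 strip_eq[simplified]\<close>)
      moreover have "(1 - u) * 1 + u * (- Re z) > 0"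
        by (rule comb) (use z in \<open>auto simp: 2 strip_eq[simplified]\<close>)
      ultimately show ?thesis using re abs by (auto simp: 2 strip_eq[simplified] algebra_simps)
    next
      case 3
      have "(1 - u) * 1 + u * (2 + \<bar>Im z\<bar> - Re z) > 0"
        by (rule comb) (use z in \<open>auto simp: 3 strip_eq\<close>)
      moreover have "(1 - u) * 1 + u * Re z > 0"
        by (rule comb) (use z in \<open>auto simp: 3 strip_eq\<close>)
      ultimately show ?thesis unfolding 3 strip_eq using re abs by (auto simp: 3 algebra_simps)
    next
      case 4
      have "(1 - u) * 1 + u * (Re z - 2 - \<bar>Im z\<bar>) > 0"
        by (rule comb) (use z in \<open>auto simp: 4 strip_eq\<close>)
      then show ?thesis unfolding 4 strip_eq using re abs by (auto simp: 4 algebra_simps)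
    qed
  qed
  then show ?thesis unfolding starlike_def using strip_center_in[OF j] by blast
qed

section \<open>Free reduction and the action of letters on reduced words\<close>

fun push_letter :: "nat \<times> bool \<Rightarrow> (nat \<times> bool) list \<Rightarrow> (nat \<times> bool) list" where
  "push_letter a [] = [a]"
| "push_letter a (b # ws) = (if fst a = fst b \<and> snd a \<noteq> snd b then ws else a # b # ws)"

lemma reduced_word_Nil [simp]: "reduced_word []"
  and reduced_word_single [simp]: "reduced_word [a]"
  by (auto simp: reduced_word_def)

lemma reduced_word_Cons2 [simp]:
  "reduced_word (a # b # ws) \<longleftrightarrow> \<not> (fst a = fst b \<and> snd a \<noteq> snd b) \<and> reduced_word (b # ws)"
proof
  assume red: "reduced_word (a # b # ws)"
  show "\<not> (fst a = fst b \<and> snd a \<noteq> snd b) \<and> reduced_word (b # ws)"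
  proof
    show "\<not> (fst a = fst b \<and> snd a \<noteq> snd b)" using red[unfolded reduced_word_def, rule_format, of 0] by simp
    show "reduced_word (b # ws)" unfolding reduced_word_def
      using red[unfolded reduced_word_def, rule_format, of "Suc k" for k] by auto
  qed
next
  assume "\<not> (fst a = fst b \<and> snd a \<noteq> snd b) \<and> reduced_word (b # ws)"
  then have A: "\<not> (fst a = fst b \<and> snd a \<noteq> snd b)" and B: "reduced_word (b # ws)" by auto
  show "reduced_word (a # b # ws)" unfolding reduced_word_def
  proof (intro allI impI)
    fix k assume "Suc k < length (a # b # ws)"
    then show "\<not> (fst ((a # b # ws) ! k) = fst ((a # b # ws) ! Suc k) \<and> snd ((a # b # ws) ! k) \<noteq> snd ((a # b # ws) ! Suc k))"
      using A B[unfolded reduced_word_def, rule_format, of "k - 1"] by (cases k) auto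
  qed
qed

lemma reduced_word_tl: "reduced_word (a # ws) \<Longrightarrow> reduced_word ws"
  by (cases ws) auto

lemma reduced_push_letter: "reduced_word ws \<Longrightarrow> reduced_word (push_letter a ws)"
  by (cases ws) (auto dest: reduced_word_tl)

text \<open>\<open>push_letter\<close> is left multiplication by a letter in the free group, written
  on reduced words; hence every letter permutes them.\<close>

lemma push_letter_inverse: "reduced_word ws \<Longrightarrow> push_letter (i, \<not> b) (push_letter (i, b) ws) = ws"
proof (cases ws)
  case (Cons c ws')
  assume "reduced_word ws"
  then show ?thesis using Cons by (cases ws'; cases c) auto
qed auto

text \<open>Nothing cancels on the way, because every intermediate word is a suffix of the reduced
  word \<open>rev ws @ ks\<close>. The order is reversed since letters go to the front.\<close>

lemma fold_push_letter:
  assumes "reduced_word (rev ws @ ks)"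
  shows "fold push_letter ws ks = rev ws @ ks"
  using assms
proof (induction ws arbitrary: ks)
  case (Cons a ws)
  have "reduced_word (a # ks)"
  proof -
    have "reduced_word (us @ vs) \<Longrightarrow> reduced_word vs" for us vs :: "(nat \<times> bool) list"
      by (induction us) (auto dest: reduced_word_tl)
    then show ?thesis using Cons.prems by (metis append.assoc append_Cons append_Nil rev.simps(2))
  qed
  then have "push_letter a ks = a # ks" by (cases ks) auto
  then show ?case using Cons by simp
qed simp

lemma reduced_word_rev: "reduced_word ws \<Longrightarrow> reduced_word (rev ws)"
  unfolding reduced_word_def
proof (intro allI impI)
  fix k assume r: "\<forall>k. Suc k < length ws \<longrightarrow> \<not> (fst (ws ! k) = fst (ws ! Suc k) \<and> snd (ws ! k) \<noteq> snd (ws ! Suc k))"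
    and k: "Suc k < length (rev ws)"
  have "rev ws ! k = ws ! Suc (length ws - Suc (Suc k))" "rev ws ! Suc k = ws ! (length ws - Suc (Suc k))"
    using k by (auto simp: rev_nth Suc_diff_Suc)
  moreover have "Suc (length ws - Suc (Suc k)) < length ws" using k by simp
  ultimately show "\<not> (fst (rev ws ! k) = fst (rev ws ! Suc k) \<and> snd (rev ws ! k) \<noteq> snd (rev ws ! Suc k))"
    using r by metis
qed

text \<open>Gluing a copy of the plane for every reduced word along the regions gives the universal covering
  of the punctured plane, with the words as its fibre.\<close>

definition deck_shift :: "nat \<Rightarrow> (nat \<times> bool) list \<Rightarrow> (nat \<times> bool) list" where
  "deck_shift j ws = (if j = 0 then ws else push_letter (j - 1, False) ws)"

lemma deck_shift_reduced: "reduced_word ws \<Longrightarrow> reduced_word (deck_shift j ws)"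
  by (simp add: deck_shift_def reduced_push_letter)

lemma deck_shift_inj:
  assumes "reduced_word ws" "reduced_word vs" "deck_shift j ws = deck_shift j vs" shows "ws = vs"
proof (cases "j = 0")
  case False
  then show ?thesis using assms push_letter_inverse[of ws "j - 1" False] push_letter_inverse[of vs "j - 1" False]
    by (simp add: deck_shift_def)
qed (use assms in \<open>simp add: deck_shift_def\<close>)

lemma deck_shift_surj:
  assumes "reduced_word ws" shows "\<exists>vs. reduced_word vs \<and> deck_shift j vs = ws"
  using assms push_letter_inverse[OF assms, of "j - 1" True] reduced_push_letter[OF assms, of "(j - 1, True)"]
  by (cases "j = 0") (auto simp: deck_shift_def)

text \<open>A set is open if its trace in every chart is. Over \<open>upper_slit\<close> a chart
  carries one label \<open>k\<close>; over \<open>lower_slit\<close> the label also depends on the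
  region. The charts coincide over strip 0 and differ by the letter \<open>j - 1\<close> over strip
  \<open>j\<close>, so crossing over above and returning below changes the label.\<close>

definition word_cover :: "(complex \<times> (nat \<times> bool) list) topology" where
  "word_cover = topology (\<lambda>W. W \<subseteq> punctured_plane \<times> Collect reduced_word \<and>
     (\<forall>k. reduced_word k \<longrightarrow> open {z \<in> upper_slit. (z, k) \<in> W} \<and> open {z \<in> lower_slit. (z, deck_shift (region z) k) \<in> W}))"

lemma openin_word_cover:
  "openin word_cover W \<longleftrightarrow> W \<subseteq> punctured_plane \<times> Collect reduced_word \<and>
     (\<forall>k. reduced_word k \<longrightarrow> open {z \<in> upper_slit. (z, k) \<in> W} \<and> open {z \<in> lower_slit. (z, deck_shift (region z) k) \<in> W})"
proof -
  define P where "P W \<longleftrightarrow> W \<subseteq> punctured_plane \<times> Collect reduced_word \<and>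
     (\<forall>k. reduced_word k \<longrightarrow> open {z \<in> upper_slit. (z, k) \<in> W} \<and> open {z \<in> lower_slit. (z, deck_shift (region z) k) \<in> W})" for W
  have "istopology P"
    unfolding istopology_def
  proof (intro conjI allI impI)
    fix S T assume S: "P S" and T: "P T"
    have "{z \<in> upper_slit. (z, k) \<in> S \<inter> T} = {z \<in> upper_slit. (z, k) \<in> S} \<inter> {z \<in> upper_slit. (z, k) \<in> T}"
      "{z \<in> lower_slit. (z, deck_shift (region z) k) \<in> S \<inter> T} =
       {z \<in> lower_slit. (z, deck_shift (region z) k) \<in> S} \<inter> {z \<in> lower_slit. (z, deck_shift (region z) k) \<in> T}" for k
      by auto
    then show "P (S \<inter> T)" using S T unfolding P_def by (auto intro: open_Int)
  next
    fix K assume K: "\<forall>S\<in>K. P S"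
    have "{z \<in> upper_slit. (z, k) \<in> \<Union>K} = (\<Union>S\<in>K. {z \<in> upper_slit. (z, k) \<in> S})"
      "{z \<in> lower_slit. (z, deck_shift (region z) k) \<in> \<Union>K} = (\<Union>S\<in>K. {z \<in> lower_slit. (z, deck_shift (region z) k) \<in> S})" for k
      by auto
    then show "P (\<Union>K)" using K unfolding P_def by (auto intro!: open_UN)
  qed
  moreover have "word_cover = topology P" unfolding word_cover_def P_def ..
  ultimately have "openin word_cover = P" using topology_inverse'[of P] by simp
  then show ?thesis by (simp only: P_def)
qed

lemma topspace_word_cover: "topspace word_cover = punctured_plane \<times> Collect reduced_word"
proof
  have "{z \<in> upper_slit. (z, k) \<in> punctured_plane \<times> Collect reduced_word} = upper_slit"
    "{z \<in> lower_slit. (z, deck_shift (region z) k) \<in> punctured_plane \<times> Collect reduced_word} = lower_slit"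
    if "reduced_word k" for k
    using slit_Un that by (auto simp: deck_shift_reduced)
  then have "openin word_cover (punctured_plane \<times> Collect reduced_word)"
    unfolding openin_word_cover using open_slit by auto
  then show "punctured_plane \<times> Collect reduced_word \<subseteq> topspace word_cover" by (rule openin_subset)
  show "topspace word_cover \<subseteq> punctured_plane \<times> Collect reduced_word"
    using openin_topspace[of word_cover] unfolding openin_word_cover by blast
qed

text \<open>The overlap of the charts is a disjoint union of open strips, so the change of labels is
  locally constant; this makes the sheets of one chart open in the other.\<close>

lemma open_region_eq: "open {z \<in> upper_slit \<inter> lower_slit. P (region z)}"
proof -
  have "{z \<in> upper_slit \<inter> lower_slit. P (region z)} = (\<Union>j\<in>Collect P. strip j)"
    by (auto simp: slit_Int strip_def)
  then show ?thesis by (simp add: open_strip open_UN)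
qed

lemma word_cover_covering: "evenly_covering_map word_cover (top_of_set punctured_plane) fst"
  unfolding evenly_covering_map_def
proof (intro conjI)
  have opn: "open punctured_plane" by (auto simp: punctured_plane_def intro: open_Compl)
  show "continuous_map word_cover (top_of_set punctured_plane) fst"
    unfolding continuous_map_def
  proof (intro conjI allI impI)
    fix U assume "openin (top_of_set punctured_plane) U"
    then have U: "open U" "U \<subseteq> punctured_plane" using opn by (auto simp: openin_open_eq)
    have "{z \<in> upper_slit. z \<in> U} = upper_slit \<inter> U" "{z \<in> lower_slit. z \<in> U} = lower_slit \<inter> U" by auto
    moreover have "{x \<in> topspace word_cover. fst x \<in> U} = U \<times> Collect reduced_word"
      using U by (auto simp: topspace_word_cover)
    ultimately show "openin word_cover {x \<in> topspace word_cover. fst x \<in> U}"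
      unfolding openin_word_cover using U open_slit by (auto simp: deck_shift_reduced intro!: open_Int)
  qed (auto simp: topspace_word_cover)
  show "open_map word_cover (top_of_set punctured_plane) fst"
    unfolding open_map_def
  proof (intro allI impI)
    fix W assume W: "openin word_cover W"
    have "fst ` W = (\<Union>k\<in>Collect reduced_word. {z \<in> upper_slit. (z, k) \<in> W} \<union> {z \<in> lower_slit. (z, deck_shift (region z) k) \<in> W})"
      (is "_ = ?R")
    proof
      show "?R \<subseteq> fst ` W" by force
      show "fst ` W \<subseteq> ?R"
      proof
        fix z assume "z \<in> fst ` W"
        then obtain k where k: "(z, k) \<in> W" by auto
        then have z: "z \<in> upper_slit \<union> lower_slit" "reduced_word k"
          using W unfolding openin_word_cover slit_Un by auto
        obtain m where "reduced_word m" "deck_shift (region z) m = k" using deck_shift_surj[OF z(2)] by blast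
        then show "z \<in> ?R" using z k by auto
      qed
    qed
    moreover have "open ?R" using W unfolding openin_word_cover by (intro open_UN open_Un) auto
    moreover have "fst ` W \<subseteq> punctured_plane" using W unfolding openin_word_cover by auto
    ultimately show "openin (top_of_set punctured_plane) (fst ` W)" using opn by (simp add: openin_open_eq)
  qed
  show "fst ` topspace word_cover = topspace (top_of_set punctured_plane)"
    using reduced_word_Nil by (auto simp: topspace_word_cover image_iff simp del: reduced_word_Nil)
  show "\<forall>x\<in>topspace (top_of_set punctured_plane). \<exists>U \<V>. openin (top_of_set punctured_plane) U \<and> x \<in> U \<and> disjoint \<V> \<and>
     \<Union>\<V> = {c \<in> topspace word_cover. fst c \<in> U} \<and> (\<forall>V\<in>\<V>. openin word_cover V \<and> bij_betw fst V U)"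
  proof
    fix x assume "x \<in> topspace (top_of_set punctured_plane)"
    then consider "x \<in> upper_slit" | "x \<in> lower_slit" using slit_Un by auto
    then show "\<exists>U \<V>. openin (top_of_set punctured_plane) U \<and> x \<in> U \<and> disjoint \<V> \<and>
     \<Union>\<V> = {c \<in> topspace word_cover. fst c \<in> U} \<and> (\<forall>V\<in>\<V>. openin word_cover V \<and> bij_betw fst V U)"
    proof cases
      case 1
      let ?V = "\<lambda>k. upper_slit \<times> {k}"
      have "openin word_cover (?V k)" if k: "reduced_word k" for k
        unfolding openin_word_cover
      proof (intro conjI allI impI)
        fix k' assume "reduced_word k'"
        show "open {z \<in> upper_slit. (z, k') \<in> ?V k}" using open_slit by (cases "k = k'") auto
        show "open {z \<in> lower_slit. (z, deck_shift (region z) k') \<in> ?V k}"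
          using open_region_eq[of "\<lambda>j. deck_shift j k' = k"] by (simp add: Int_def conj_ac)
      qed (use k slit_Un in auto)
      moreover have "\<Union>(?V ` Collect reduced_word) = {c \<in> topspace word_cover. fst c \<in> upper_slit}"
        using slit_Un by (auto simp: topspace_word_cover)
      moreover have "disjoint (?V ` Collect reduced_word)" by (auto simp: disjoint_def)
      ultimately show ?thesis using 1 opn open_slit slit_Un
        by (intro exI[of _ upper_slit] exI[of _ "?V ` Collect reduced_word"]) (auto simp: openin_open_eq bij_betw_def inj_on_def)
    next
      case 2
      let ?V = "\<lambda>k. (\<lambda>z. (z, deck_shift (region z) k)) ` lower_slit"
      have "openin word_cover (?V k)" if k: "reduced_word k" for k
        unfolding openin_word_cover
      proof (intro conjI allI impI)
        fix k' assume k': "reduced_word k'"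
        have "{z \<in> upper_slit. (z, k') \<in> ?V k} = {z \<in> upper_slit \<inter> lower_slit. deck_shift (region z) k = k'}" by auto
        then show "open {z \<in> upper_slit. (z, k') \<in> ?V k}"
          using open_region_eq[of "\<lambda>j. deck_shift j k = k'"] by simp
        have "{z \<in> lower_slit. (z, deck_shift (region z) k') \<in> ?V k} = (if k = k' then lower_slit else {})"
          using deck_shift_inj[OF k k'] deck_shift_inj[OF k' k] by auto
        then show "open {z \<in> lower_slit. (z, deck_shift (region z) k') \<in> ?V k}" using open_slit by auto
      qed (use k slit_Un in \<open>auto simp: deck_shift_reduced\<close>)
      moreover have "\<Union>(?V ` Collect reduced_word) = {c \<in> topspace word_cover. fst c \<in> lower_slit}"
      proof
        show "\<Union>(?V ` Collect reduced_word) \<subseteq> {c \<in> topspace word_cover. fst c \<in> lower_slit}"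
          using slit_Un by (auto simp: topspace_word_cover deck_shift_reduced)
        show "{c \<in> topspace word_cover. fst c \<in> lower_slit} \<subseteq> \<Union>(?V ` Collect reduced_word)"
        proof safe
          fix z k assume "(z, k) \<in> topspace word_cover" and z: "fst (z, k) \<in> lower_slit"
          then have "reduced_word k" by (auto simp: topspace_word_cover)
          then obtain m where "reduced_word m" "deck_shift (region z) m = k" using deck_shift_surj by blast
          then show "(z, k) \<in> \<Union>(?V ` Collect reduced_word)" using z by auto
        qed
      qed
      moreover have "disjoint (?V ` Collect reduced_word)"
      proof -
        have "?V k \<inter> ?V k' = {}" if "reduced_word k" "reduced_word k'" "k \<noteq> k'" for k k'
          using deck_shift_inj[OF that(1,2)] that(3) by auto
        then show ?thesis unfolding disjoint_def by blast
      qed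
      ultimately show ?thesis using 2 opn open_slit slit_Un
        by (intro exI[of _ lower_slit] exI[of _ "?V ` Collect reduced_word"]) (auto simp: openin_open_eq bij_betw_def inj_on_def image_image)
    qed
  qed
qed

section \<open>Loops around the punctures and their lifts\<close>

abbreviation slit_base :: complex where "slit_base \<equiv> strip_center 0"

abbreviation plane_group :: "(real \<Rightarrow> complex) set monoid" where
  "plane_group \<equiv> fundamental_group (top_of_set punctured_plane) slit_base"

lemma loop_join_eq_joinpaths: "loop_join p q = p +++ q"
  by (auto simp: loop_join_def joinpaths_def)

lemma path_homotopic_simply_connected:
  fixes S T :: "'a::real_normed_vector set"
  assumes "simply_connected S" "S \<subseteq> T" "pathin (top_of_set S) p" "pathin (top_of_set S) q" "p 0 = q 0" "p 1 = q 1"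
  shows "path_homotopic (top_of_set T) p q"
proof -
  have "homotopic_paths S p q"
    using assms simply_connected_eq_homotopic_paths[THEN iffD1, OF assms(1), THEN conjunct2, rule_format, of p q]
    by (auto simp: pathin_canon_iff pathstart_def pathfinish_def path_image_def)
  then show ?thesis unfolding path_homotopic_top_of_set using assms(2) by (rule homotopic_paths_subset)
qed

lemma pathin_top_of_set_mono: "pathin (top_of_set S) p \<Longrightarrow> S \<subseteq> T \<Longrightarrow> pathin (top_of_set T) p"
  by (auto simp: pathin_canon_iff)

lemma path_homotopic_cancel:
  assumes "pathin Y p" "pathin Y q" "pathin Y r" "p 1 = q 0" "q 0 = r 0"
  shows "path_homotopic Y (loop_join (loop_join p q) (loop_join (loop_reverse q) r)) (loop_join p r)"
proof -
  note [simp] = pathin_loop_join pathin_loop_reverse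
  have "path_homotopic Y (loop_join (loop_join p q) (loop_join (loop_reverse q) r))
         (loop_join p (loop_join q (loop_join (loop_reverse q) r)))"
    using assms by (intro path_homotopic_assoc) simp_all
  also have "path_homotopic Y \<dots> (loop_join p (loop_join (loop_join q (loop_reverse q)) r))"
    using assms by (intro path_homotopic_join[of Y p p] path_homotopic_sym[OF path_homotopic_assoc]) simp_all
  also have "path_homotopic Y \<dots> (loop_join p (loop_join (\<lambda>t. r 0) r))"
    using assms by (intro path_homotopic_join[of Y p p] path_homotopic_join[of Y _ _ r] path_homotopic_rinv) simp_all
  also have "path_homotopic Y \<dots> (loop_join p r)"
    using assms by (intro path_homotopic_join[of Y p p] path_homotopic_lid) simp_all
  finally show ?thesis .
qed

lemma slit_subset: "upper_slit \<subseteq> punctured_plane" "lower_slit \<subseteq> punctured_plane"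
  and strip_subset: "strip j \<subseteq> upper_slit" "strip j \<subseteq> lower_slit"
  using slit_Un slit_Int by (auto simp: strip_def)

lemma path_connected_obtain:
  assumes "path_connected S" "x \<in> S" "y \<in> S"
  obtains p where "pathin (top_of_set S) p" "p 0 = x" "p 1 = y"
proof -
  obtain p where p: "path p" "path_image p \<subseteq> S" "pathstart p = x" "pathfinish p = y"
    using assms unfolding path_connected_def by blast
  show thesis by (rule that[of p]) (use p in \<open>auto simp: pathin_canon_iff path_image_def pathstart_def pathfinish_def\<close>)
qed

text \<open>An arbitrary choice is harmless: the sets \<open>S\<close> in question are starlike,
  hence simply connected, and two paths with the same ends are homotopic there.\<close>

definition path_from_to :: "complex set \<Rightarrow> complex \<Rightarrow> complex \<Rightarrow> real \<Rightarrow> complex" where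
  "path_from_to S x y = (SOME p. pathin (top_of_set S) p \<and> p 0 = x \<and> p 1 = y)"

lemma path_from_to:
  assumes "starlike S" "x \<in> S" "y \<in> S"
  shows "pathin (top_of_set S) (path_from_to S x y)" "path_from_to S x y 0 = x" "path_from_to S x y 1 = y"
proof -
  have "\<exists>p. pathin (top_of_set S) p \<and> p 0 = x \<and> p 1 = y"
    using path_connected_obtain[OF starlike_imp_path_connected[OF assms(1)] assms(2,3)] by metis
  from someI_ex[OF this] show "pathin (top_of_set S) (path_from_to S x y)" "path_from_to S x y 0 = x" "path_from_to S x y 1 = y"
    unfolding path_from_to_def by auto
qed

abbreviation upper_path where "upper_path \<equiv> path_from_to upper_slit"
abbreviation lower_path where "lower_path \<equiv> path_from_to lower_slit"
lemmas upper_path = path_from_to[OF starlike_upper_slit]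
lemmas lower_path = path_from_to[OF starlike_lower_slit]

lemma strip_center_slit: "j \<le> 3 \<Longrightarrow> strip_center j \<in> upper_slit" "j \<le> 3 \<Longrightarrow> strip_center j \<in> lower_slit"
  using strip_center_in strip_subset by blast+

lemma slit_base_in: "slit_base \<in> upper_slit" "slit_base \<in> lower_slit" "slit_base \<in> punctured_plane"
  using strip_center_slit[of 0] slit_subset by auto

text \<open>The loop encircles the \<open>j\<close> leftmost punctures. The generators are therefore
  loops around one, two and three punctures rather than around single ones; this choice matches the
  change of chart over strip \<open>j\<close>, which is a single letter.\<close>

definition region_loop :: "nat \<Rightarrow> real \<Rightarrow> complex" where
  "region_loop j = loop_join (upper_path slit_base (strip_center j)) (lower_path (strip_center j) slit_base)"

lemma loop_at_region_loop: "j \<le> 3 \<Longrightarrow> loop_at (top_of_set punctured_plane) slit_base (region_loop j)"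
  unfolding region_loop_def loop_at_def
  by (auto simp: upper_path lower_path strip_center_slit slit_base_in
      intro!: pathin_loop_join pathin_top_of_set_mono[OF upper_path(1) slit_subset(1)]
        pathin_top_of_set_mono[OF lower_path(1) slit_subset(2)])

text \<open>Shifted by one because \<open>region_loop 0\<close> is null-homotopic.\<close>

definition plane_gen :: "nat \<Rightarrow> (real \<Rightarrow> complex) set" where
  "plane_gen i = loop_class (top_of_set punctured_plane) slit_base (region_loop (Suc i))"

text \<open>The monodromy of \<open>word_cover\<close>, kept as a relation between the labels at the
  two ends; \<open>lifts_to_homotopic\<close> shows that the final label depends only on the
  homotopy class and the initial label.\<close>

definition lifts_to :: "(real \<Rightarrow> complex) \<Rightarrow> (nat \<times> bool) list \<Rightarrow> (nat \<times> bool) list \<Rightarrow> bool" where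
  "lifts_to p k k' \<longleftrightarrow> (\<exists>f. pathin word_cover f \<and> f 0 = (p 0, k) \<and> f 1 = (p 1, k') \<and> (\<forall>t\<in>{0..1}. fst (f t) = p t))"

lemma lifts_to_homotopic:
  assumes "path_homotopic (top_of_set punctured_plane) p q" "lifts_to p k l" "lifts_to q k l'" shows "l = l'"
proof -
  obtain f g where "pathin word_cover f" "f 0 = (p 0, k)" "f 1 = (p 1, l)" "\<forall>t\<in>{0..1}. fst (f t) = p t"
    "pathin word_cover g" "g 0 = (q 0, k)" "g 1 = (q 1, l')" "\<forall>t\<in>{0..1}. fst (g t) = q t"
    using assms(2,3) unfolding lifts_to_def by metis
  moreover from this have "path_homotopic word_cover f g"
    using path_homotopic_ends(1)[OF assms(1)]
    by (intro path_homotopic_lift[OF word_cover_covering assms(1)]) auto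
  ultimately show ?thesis using path_homotopic_ends(2)[of word_cover f g] by simp
qed

lemma lifts_to_join:
  assumes "lifts_to p k l" "lifts_to q l m" "p 1 = q 0"
  shows "lifts_to (loop_join p q) k m"
proof -
  obtain f g where "pathin word_cover f" "f 0 = (p 0, k)" "f 1 = (p 1, l)" "\<forall>t\<in>{0..1}. fst (f t) = p t"
    "pathin word_cover g" "g 0 = (q 0, l)" "g 1 = (q 1, m)" "\<forall>t\<in>{0..1}. fst (g t) = q t"
    using assms(1,2) unfolding lifts_to_def by metis
  moreover from this have "fst (loop_join f g t) = loop_join p q t" if "t \<in> {0..1}" for t
    using that by (simp add: loop_join_def)
  ultimately show ?thesis unfolding lifts_to_def using assms(3)
    by (intro exI[of _ "loop_join f g"]) (simp add: pathin_loop_join)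
qed

lemma lifts_to_reverse:
  assumes "lifts_to p k l" shows "lifts_to (loop_reverse p) l k"
proof -
  obtain f where "pathin word_cover f" "f 0 = (p 0, k)" "f 1 = (p 1, l)" "\<forall>t\<in>{0..1}. fst (f t) = p t"
    using assms unfolding lifts_to_def by metis
  then show ?thesis unfolding lifts_to_def
    by (intro exI[of _ "loop_reverse f"]) (auto simp: pathin_loop_reverse, simp add: loop_reverse_def)
qed

lemma lifts_to_upper:
  assumes "pathin (top_of_set upper_slit) p" "reduced_word k" shows "lifts_to p k k"
proof -
  have "continuous_map (top_of_set upper_slit) word_cover (\<lambda>z. (z, k))"
    unfolding continuous_map_def
    using assms(2) slit_subset by (auto simp: topspace_word_cover openin_word_cover openin_open_eq open_slit)
  from continuous_map_compose[OF assms(1)[unfolded pathin_def] this]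
  show ?thesis unfolding lifts_to_def pathin_def by (intro exI[of _ "(\<lambda>z. (z, k)) \<circ> p"]) auto
qed

lemma lifts_to_lower:
  assumes "pathin (top_of_set lower_slit) p" "reduced_word m"
  shows "lifts_to p (deck_shift (region (p 0)) m) (deck_shift (region (p 1)) m)"
proof -
  have "continuous_map (top_of_set lower_slit) word_cover (\<lambda>z. (z, deck_shift (region z) m))"
    unfolding continuous_map_def
    using assms(2) slit_subset by (auto simp: topspace_word_cover openin_word_cover openin_open_eq open_slit deck_shift_reduced)
  from continuous_map_compose[OF assms(1)[unfolded pathin_def] this]
  show ?thesis unfolding lifts_to_def pathin_def by (intro exI[of _ "(\<lambda>z. (z, deck_shift (region z) m)) \<circ> p"]) auto
qed

lemma lifts_to_region_loop:
  assumes i: "i < 3" and k: "reduced_word k" shows "lifts_to (region_loop (Suc i)) k (push_letter (i, True) k)"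
proof -
  \<comment> \<open>The lower chart indexed by \<open>?m\<close> has label \<open>k\<close> over
    strip \<open>Suc i\<close>, by \<open>push_letter_inverse\<close>, and label \<open>?m\<close>
    over strip 0. So the way out keeps \<open>k\<close> and the way back turns it into
    \<open>?m\<close>.\<close>
  let ?c = "strip_center (Suc i)" and ?m = "push_letter (i, True) k"
  have c: "?c \<in> upper_slit" "?c \<in> lower_slit" using i by (auto intro: strip_center_slit)
  have m: "reduced_word ?m" using k by (rule reduced_push_letter)
  have reg: "region ?c = Suc i" "region slit_base = 0" using strip_center_in[of "Suc i"] strip_center_in[of 0] i by (auto simp: strip_def)
  have "lifts_to (upper_path slit_base ?c) k k" by (intro lifts_to_upper upper_path k c slit_base_in)
  moreover have "lifts_to (lower_path ?c slit_base) k ?m"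
    using lifts_to_lower[OF lower_path(1)[OF c(2) slit_base_in(2)] m] push_letter_inverse[OF k, of i True] reg
    by (simp add: lower_path c slit_base_in deck_shift_def)
  ultimately show ?thesis unfolding region_loop_def
    by (rule lifts_to_join) (simp add: upper_path lower_path c slit_base_in)
qed

text \<open>The path runs through the first letter first, so the label is changed by the letters
  from left to right: a \<open>fold\<close>, although \<open>word_eval\<close> is a
  \<open>foldr\<close>.\<close>

lemma lifts_to_word:
  assumes ws: "\<forall>(i, b)\<in>set ws. i < 3" and k: "reduced_word k"
  shows "\<exists>p. loop_at (top_of_set punctured_plane) slit_base p \<and>
     word_eval plane_group plane_gen ws = loop_class (top_of_set punctured_plane) slit_base p \<and>
     lifts_to p k (fold push_letter ws k)"
  using assms
proof (induction ws arbitrary: k)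
  case Nil
  have "lifts_to (\<lambda>t. slit_base) k k"
    using Nil slit_base_in by (intro lifts_to_upper) (auto simp: pathin_def)
  moreover have "loop_at (top_of_set punctured_plane) slit_base (\<lambda>t. slit_base)"
    using slit_base_in by (intro loop_at_const) simp
  ultimately show ?case by (intro exI[of _ "\<lambda>t. slit_base"]) (simp add: word_eval_def one_fundamental_group)
next
  case (Cons a ws)
  obtain i b where a: "a = (i, b)" by (cases a)
  have i: "i < 3" using Cons.prems a by auto
  let ?k = "push_letter a k"
  have k': "reduced_word ?k" using Cons.prems by (intro reduced_push_letter)
  then obtain q where q: "loop_at (top_of_set punctured_plane) slit_base q"
     "word_eval plane_group plane_gen ws = loop_class (top_of_set punctured_plane) slit_base q"
     "lifts_to q ?k (fold push_letter ws ?k)"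
    using Cons.IH[OF _ k'] Cons.prems by auto
  let ?g = "region_loop (Suc i)"
  let ?p = "if b then ?g else loop_reverse ?g"
  have g: "loop_at (top_of_set punctured_plane) slit_base ?g" using i by (intro loop_at_region_loop) simp
  then have p: "loop_at (top_of_set punctured_plane) slit_base ?p" by (simp add: loop_at_loop_reverse)
  have lp: "lifts_to ?p k ?k"
  proof (cases b)
    case False
    have "lifts_to ?g ?k (push_letter (i, True) ?k)" by (rule lifts_to_region_loop[OF i k'])
    then have "lifts_to ?g ?k k" using push_letter_inverse[of k i False] Cons.prems False a by simp
    then show ?thesis using False lifts_to_reverse by simp
  qed (use lifts_to_region_loop[OF i Cons.prems(2)] a in simp)
  have "lifts_to (loop_join ?p q) k (fold push_letter (a # ws) k)"
    using lifts_to_join[OF lp q(3)] p q(1) by (simp add: loop_at_def)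
  moreover have "word_eval plane_group plane_gen (a # ws) =
      loop_class (top_of_set punctured_plane) slit_base ?p \<otimes>\<^bsub>plane_group\<^esub> word_eval plane_group plane_gen ws"
    using g slit_base_in(3) by (simp add: word_eval_def a plane_gen_def inv_fundamental_group)
  then have "word_eval plane_group plane_gen (a # ws) = loop_class (top_of_set punctured_plane) slit_base (loop_join ?p q)"
    using mult_fundamental_group[OF p q(1)] q(2) by simp
  ultimately show ?case using loop_at_join[OF p q(1)] by blast
qed

lemma plane_words_nontrivial:
  assumes "ws \<noteq> []" "reduced_word ws" "\<forall>(i, b)\<in>set ws. i < 3"
  shows "word_eval plane_group plane_gen ws \<noteq> \<one>\<^bsub>plane_group\<^esub>"
proof
  let ?Y = "top_of_set punctured_plane"
  assume one: "word_eval plane_group plane_gen ws = \<one>\<^bsub>plane_group\<^esub>"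
  obtain p where p: "loop_at ?Y slit_base p" "word_eval plane_group plane_gen ws = loop_class ?Y slit_base p"
     "lifts_to p [] (fold push_letter ws [])"
    using lifts_to_word[OF assms(3) reduced_word_Nil] by blast
  have "path_homotopic ?Y p (\<lambda>t. slit_base)"
    using one p by (simp add: one_fundamental_group loop_class_eq_iff)
  moreover have "lifts_to (\<lambda>t. slit_base) [] []"
    using slit_base_in by (intro lifts_to_upper) (auto simp: pathin_def)
  ultimately have "fold push_letter ws [] = []" using lifts_to_homotopic p(3) by blast
  moreover have "fold push_letter ws [] = rev ws"
    using fold_push_letter[of ws "[]"] reduced_word_rev[OF assms(2)] by simp
  ultimately show False using assms(1) by simp
qed

section \<open>Generation by the three loops\<close>

lemma simply_connected_slit: "simply_connected upper_slit" "simply_connected lower_slit"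
  using starlike_imp_simply_connected starlike_upper_slit starlike_lower_slit by auto

text \<open>Paths to the base are taken in \<open>upper_slit\<close> whenever possible. With this
  preference a piece of a loop inside \<open>upper_slit\<close> closes up to a null-homotopic loop,
  and only pieces in \<open>lower_slit\<close> contribute.\<close>

definition tail_path :: "complex \<Rightarrow> real \<Rightarrow> complex" where
  "tail_path x = (if x \<in> upper_slit then upper_path slit_base x else lower_path slit_base x)"

lemma tail_path:
  assumes "x \<in> punctured_plane"
  shows "pathin (top_of_set punctured_plane) (tail_path x)" "tail_path x 0 = slit_base" "tail_path x 1 = x"
proof -
  have "x \<in> upper_slit \<or> x \<in> lower_slit" using assms slit_Un by auto
  then show "pathin (top_of_set punctured_plane) (tail_path x)" "tail_path x 0 = slit_base" "tail_path x 1 = x"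
    unfolding tail_path_def using upper_path[OF slit_base_in(1)] lower_path[OF slit_base_in(2)]
      pathin_top_of_set_mono[OF _ slit_subset(1)] pathin_top_of_set_mono[OF _ slit_subset(2)] by auto
qed

abbreviation plane_span :: "(real \<Rightarrow> complex) set set" where
  "plane_span \<equiv> generate plane_group (plane_gen ` {..<3})"

abbreviation plane_class :: "(real \<Rightarrow> complex) \<Rightarrow> (real \<Rightarrow> complex) set" where
  "plane_class \<equiv> loop_class (top_of_set punctured_plane) slit_base"

lemma group_plane: "group plane_group"
  using slit_base_in by (intro group_fundamental_group) simp

lemma plane_gen_carrier: "plane_gen ` {..<3} \<subseteq> carrier plane_group"
  unfolding plane_gen_def by (auto intro!: loop_class_in_carrier loop_at_region_loop)

lemma region_loop_span:
  assumes "j \<le> 3" shows "plane_class (region_loop j) \<in> plane_span"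
proof (cases j)
  case 0
  have "path_homotopic (top_of_set punctured_plane) (upper_path slit_base slit_base) (\<lambda>t. slit_base)"
    by (rule path_homotopic_simply_connected[OF simply_connected_slit(1) slit_subset(1)])
       (simp_all add: upper_path slit_base_in)
  moreover have "path_homotopic (top_of_set punctured_plane) (lower_path slit_base slit_base) (\<lambda>t. slit_base)"
    by (rule path_homotopic_simply_connected[OF simply_connected_slit(2) slit_subset(2)])
       (simp_all add: lower_path slit_base_in)
  ultimately have "path_homotopic (top_of_set punctured_plane) (region_loop 0) (loop_join (\<lambda>t. slit_base) (\<lambda>t. slit_base))"
    unfolding region_loop_def by (intro path_homotopic_join) (simp_all add: upper_path lower_path slit_base_in)
  moreover have "loop_join (\<lambda>t. slit_base) (\<lambda>t. slit_base) = (\<lambda>t. slit_base)" by (auto simp: loop_join_def)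
  ultimately have "plane_class (region_loop 0) = \<one>\<^bsub>plane_group\<^esub>"
    using loop_at_region_loop[of 0] by (simp add: one_fundamental_group loop_class_eq_iff)
  then show ?thesis using 0 by (simp add: generate.one)
next
  case (Suc i)
  then show ?thesis using assms by (intro generate.incl) (auto simp: plane_gen_def)
qed

text \<open>If \<open>x\<close> also lies in \<open>upper_slit\<close>, it lies in some strip
  \<open>j\<close>; a detour inside the strip to its centre and back turns the loop into
  \<open>region_loop j\<close>. Otherwise the tail is the lower path itself and cancels.\<close>

lemma tail_lower_span:
  assumes x: "x \<in> lower_slit"
  shows "plane_class (loop_join (tail_path x) (loop_reverse (lower_path slit_base x))) \<in> plane_span"
proof (cases "x \<in> upper_slit")
  case False
  have "path_homotopic (top_of_set punctured_plane) (loop_join (tail_path x) (loop_reverse (lower_path slit_base x))) (\<lambda>t. slit_base)"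
    unfolding tail_path_def using False x
    by (simp, intro path_homotopic_rinv pathin_top_of_set_mono[OF lower_path(1) slit_subset(2)])
       (auto simp: lower_path slit_base_in)
  then have "plane_class (loop_join (tail_path x) (loop_reverse (lower_path slit_base x))) = plane_class (\<lambda>t. slit_base)"
    using tail_path(2)[of x] x slit_subset lower_path[OF slit_base_in(2) x] by (intro loop_class_eqI) auto
  then show ?thesis using generate.one[of plane_group] by (simp add: one_fundamental_group)
next
  case True
  define j where "j = region x"
  have j: "j \<le> 3" "x \<in> strip j" using True x slit_Int by (auto simp: j_def region_def strip_def)
  define z where "z = path_from_to (strip j) (strip_center j) x"
  have z: "pathin (top_of_set (strip j)) z" "z 0 = strip_center j" "z 1 = x"
    using path_from_to[OF starlike_strip[OF j(1)] strip_center_in[OF j(1)] j(2)] by (auto simp: z_def)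
  note zu = pathin_top_of_set_mono[OF z(1) strip_subset(1)] and zl = pathin_top_of_set_mono[OF z(1) strip_subset(2)]
  note c = strip_center_slit[OF j(1)]
  let ?g = "upper_path slit_base (strip_center j)" and ?d = "lower_path (strip_center j) slit_base"
  let ?Y = "top_of_set punctured_plane"
  note up = upper_path[OF slit_base_in(1) c(1)] and lo = lower_path[OF c(2) slit_base_in(2)]
    and ux = upper_path[OF slit_base_in(1) True] and lx = lower_path[OF slit_base_in(2) x]
  have "path_homotopic ?Y (loop_join (tail_path x) (loop_reverse (lower_path slit_base x)))
      (loop_join (loop_join ?g z) (loop_join (loop_reverse z) ?d))"
  proof (rule path_homotopic_join)
    show "path_homotopic ?Y (tail_path x) (loop_join ?g z)"
      using True up ux z zu by (intro path_homotopic_simply_connected[OF simply_connected_slit(1) slit_subset(1)])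
       (simp_all add: tail_path_def pathin_loop_join)
    show "path_homotopic ?Y (loop_reverse (lower_path slit_base x)) (loop_join (loop_reverse z) ?d)"
      using lo lx z zl by (intro path_homotopic_simply_connected[OF simply_connected_slit(2) slit_subset(2)])
       (simp_all add: pathin_loop_join pathin_loop_reverse)
  qed (use True ux lx in \<open>simp add: tail_path_def\<close>)
  also have "path_homotopic ?Y \<dots> (region_loop j)"
    unfolding region_loop_def using up lo z zu slit_subset
    by (intro path_homotopic_cancel) (auto intro: pathin_top_of_set_mono)
  finally have "plane_class (loop_join (tail_path x) (loop_reverse (lower_path slit_base x))) = plane_class (region_loop j)"
    using tail_path(2)[of x] x slit_subset lx by (intro loop_class_eqI) auto
  then show ?thesis using region_loop_span[OF j(1)] by simp
qed

lemma pathin_subpath: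
  assumes "pathin (top_of_set S) p" "a \<in> {0..1}" "b \<in> {0..1}"
  shows "pathin (top_of_set S) (subpath a b p)"
  using assms path_subpath[of p a b] path_image_subpath_subset[of a b p] by (auto simp: pathin_canon_iff path_image_def image_subset_iff Pi_iff)

lemma subpath_ends: "subpath a b p 0 = p a" "subpath a b p 1 = p b"
  by (auto simp: subpath_def)

text \<open>By bisection, the piece of \<open>p\<close> between \<open>a\<close> and
  \<open>b\<close>, closed up by tails, lies in the span: adjacent pieces multiply because the tails
  at the common point cancel, and short pieces lie in one of the two slit sets.\<close>

lemma plane_span_all:
  assumes p: "loop_at (top_of_set punctured_plane) slit_base p"
  shows "plane_class p \<in> plane_span"
proof -
  let ?Y = "top_of_set punctured_plane"
  interpret group plane_group by (rule group_plane)
  have pp: "pathin ?Y p" "p 0 = slit_base" "p 1 = slit_base" using p by (auto simp: loop_at_def)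
  have pB: "p t \<in> punctured_plane" if "t \<in> {0..1}" for t using pp(1) that by (auto simp: pathin_canon_iff)
  let ?L = "\<lambda>a b. loop_join (loop_join (tail_path (p a)) (subpath a b p)) (loop_reverse (tail_path (p b)))"
  note [simp] = pathin_loop_join pathin_loop_reverse subpath_ends tail_path[OF pB] pathin_subpath[OF pp(1)]
  have loopL: "loop_at ?Y slit_base (?L a b)" if "a \<in> {0..1}" "b \<in> {0..1}" for a b
    using that by (simp add: loop_at_def)
  \<comment> \<open>The guards are for intervals that stick out of [0,1], on which
    \<open>Bolzano\<close> also evaluates \<open>Q\<close>.\<close>
  define Q where "Q a b \<longleftrightarrow> (0 \<le> a \<longrightarrow> b \<le> 1 \<longrightarrow> plane_class (?L a b) \<in> plane_span)" for a b
  have "Q 0 1"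
  proof (rule Bolzano)
    fix a b c assume ab: "Q a b" "Q b c" "a \<le> b" "b \<le> c"
    show "Q a c" unfolding Q_def
    proof (intro impI)
      assume ac: "0 \<le> a" "c \<le> 1"
      then have abc: "a \<in> {0..1}" "b \<in> {0..1}" "c \<in> {0..1}" using ab by auto
      let ?s = "loop_join (subpath b c p) (loop_reverse (tail_path (p c)))"
      have "path_homotopic ?Y (loop_join (?L a b) (?L b c))
         (loop_join (?L a b) (loop_join (loop_reverse (loop_reverse (tail_path (p b)))) ?s))"
        unfolding loop_reverse_loop_reverse using abc
        by (intro path_homotopic_join[of ?Y "?L a b" "?L a b"] path_homotopic_assoc) simp_all
      also have "path_homotopic ?Y \<dots> (loop_join (loop_join (tail_path (p a)) (subpath a b p)) ?s)"
        using abc by (intro path_homotopic_cancel) simp_all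
      also have "path_homotopic ?Y \<dots> (loop_join (loop_join (loop_join (tail_path (p a)) (subpath a b p)) (subpath b c p)) (loop_reverse (tail_path (p c))))"
        using abc by (intro path_homotopic_sym[OF path_homotopic_assoc]) simp_all
      also have "path_homotopic ?Y \<dots> (loop_join (loop_join (tail_path (p a)) (loop_join (subpath a b p) (subpath b c p))) (loop_reverse (tail_path (p c))))"
        using abc by (intro path_homotopic_join[of ?Y _ _ "loop_reverse (tail_path (p c))"] path_homotopic_assoc) simp_all
      also have "path_homotopic ?Y \<dots> (?L a c)"
      proof (intro path_homotopic_join[of ?Y _ _ "loop_reverse (tail_path (p c))"] path_homotopic_join[of ?Y "tail_path (p a)"])
        show "path_homotopic ?Y (loop_join (subpath a b p) (subpath b c p)) (subpath a c p)"
          unfolding path_homotopic_top_of_set loop_join_eq_joinpaths using pp(1) abc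
          by (intro homotopic_join_subpaths) (auto simp: pathin_canon_iff path_image_def)
      qed (use abc in simp_all)
      finally have "plane_class (loop_join (?L a b) (?L b c)) = plane_class (?L a c)"
        using abc by (intro loop_class_eqI) simp_all
      moreover have "plane_class (loop_join (?L a b) (?L b c)) = plane_class (?L a b) \<otimes>\<^bsub>plane_group\<^esub> plane_class (?L b c)"
        using mult_fundamental_group[OF loopL loopL] abc by simp
      ultimately show "plane_class (?L a c) \<in> plane_span"
        using generate.eng[of "plane_class (?L a b)" plane_group _ "plane_class (?L b c)"] ab ac unfolding Q_def by auto
    qed
  next
    fix x :: real assume x: "0 \<le> x" "x \<le> 1"
    have cp: "continuous_on {0..1} p" using pp(1) by (simp add: pathin_canon_iff path_def)
    have nbhd: "\<exists>d>0. \<forall>t\<in>{0..1}. \<bar>t - x\<bar> < d \<longrightarrow> p t \<in> U" if U: "open U" "p x \<in> U" for U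
    proof -
      obtain e where e: "e > 0" "ball (p x) e \<subseteq> U" using U by (auto simp: open_contains_ball)
      then obtain d where "d > 0" "\<forall>t\<in>{0..1}. dist t x < d \<longrightarrow> dist (p t) (p x) < e"
        using cp x unfolding continuous_on_iff by (metis atLeastAtMost_iff)
      then show ?thesis using e(2) by (intro exI[of _ d]) (auto simp: dist_real_def dist_commute subset_iff)
    qed
    have sub: "pathin (top_of_set U) (subpath a b p)"
      if "\<forall>t\<in>{0..1}. \<bar>t - x\<bar> < d \<longrightarrow> p t \<in> U" "0 \<le> a" "a \<le> x" "x \<le> b" "b \<le> 1" "b - a < d" for a b d U
    proof -
      have "path (subpath a b p)" using pp(1) that by (intro path_subpath) (auto simp: pathin_canon_iff)
      moreover have "path_image (subpath a b p) \<subseteq> U"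
        using that by (auto simp: path_image_subpath)
      ultimately show ?thesis by (auto simp: pathin_canon_iff path_image_def)
    qed
    have "p x \<in> upper_slit \<or> p x \<in> lower_slit" using pB[of x] x slit_Un by auto
    then show "\<exists>d>0. \<forall>a b. a \<le> x \<and> x \<le> b \<and> b - a < d \<longrightarrow> Q a b"
    proof
      assume "p x \<in> upper_slit"
      then obtain d where d: "d > 0" "\<forall>t\<in>{0..1}. \<bar>t - x\<bar> < d \<longrightarrow> p t \<in> upper_slit" using nbhd open_slit by blast
      have "plane_class (?L a b) \<in> plane_span" if "a \<le> x" "x \<le> b" "b - a < d" "0 \<le> a" "b \<le> 1" for a b
      proof -
        have s: "pathin (top_of_set upper_slit) (subpath a b p)" by (rule sub[OF d(2)]) (use that in auto)
        have ab: "p a \<in> upper_slit" "p b \<in> upper_slit" using d(2) that by auto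
        have "path_homotopic ?Y (?L a b) (\<lambda>t. slit_base)"
          using s ab upper_path[OF slit_base_in(1) ab(1)] upper_path[OF slit_base_in(1) ab(2)] slit_base_in
          by (intro path_homotopic_simply_connected[OF simply_connected_slit(1) slit_subset(1)])
             (simp_all add: tail_path_def)
        then have "plane_class (?L a b) = \<one>\<^bsub>plane_group\<^esub>"
          using that by (simp add: one_fundamental_group loop_class_eqI)
        then show ?thesis using generate.one[of plane_group] by simp
      qed
      then show ?thesis using d(1) unfolding Q_def by blast
    next
      assume "p x \<in> lower_slit"
      then obtain d where d: "d > 0" "\<forall>t\<in>{0..1}. \<bar>t - x\<bar> < d \<longrightarrow> p t \<in> lower_slit" using nbhd open_slit by blast
      have "plane_class (?L a b) \<in> plane_span" if abx: "a \<le> x" "x \<le> b" "b - a < d" "0 \<le> a" "b \<le> 1" for a b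
      proof -
        have I: "a \<in> {0..1}" "b \<in> {0..1}" using abx by auto
        have s: "pathin (top_of_set lower_slit) (subpath a b p)" by (rule sub[OF d(2)]) (use abx in auto)
        have ab: "p a \<in> lower_slit" "p b \<in> lower_slit" using d(2) abx by auto
        let ?A = "lower_path slit_base (p a)" and ?B = "lower_path slit_base (p b)"
        note A = lower_path[OF slit_base_in(2) ab(1)] and B = lower_path[OF slit_base_in(2) ab(2)]
        have AY: "pathin ?Y ?A" "pathin ?Y ?B" using A(1) B(1) slit_subset by (auto intro: pathin_top_of_set_mono)
        let ?ea = "loop_join (tail_path (p a)) (loop_reverse ?A)" and ?eb = "loop_join (tail_path (p b)) (loop_reverse ?B)"
        have ea: "loop_at ?Y slit_base ?ea" and eb: "loop_at ?Y slit_base ?eb"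
          using AY A B I by (simp_all add: loop_at_def)
        \<comment> \<open>In the simply connected \<open>lower_slit\<close> the piece may be
          rerouted through the base. This splits the loop into the correction loop
          \<open>?ea\<close> and the inverse of \<open>?eb\<close>, both covered by
          \<open>tail_lower_span\<close>.\<close>
        have "path_homotopic ?Y (?L a b) (loop_join (loop_join (tail_path (p a)) (loop_join (loop_reverse ?A) ?B)) (loop_reverse (tail_path (p b))))"
        proof (intro path_homotopic_join[of ?Y _ _ "loop_reverse (tail_path (p b))"] path_homotopic_join[of ?Y "tail_path (p a)"])
          show "path_homotopic ?Y (subpath a b p) (loop_join (loop_reverse ?A) ?B)"
            using s A B by (intro path_homotopic_simply_connected[OF simply_connected_slit(2) slit_subset(2)]) simp_all
        qed (use I A B AY in simp_all)
        also have "path_homotopic ?Y \<dots> (loop_join (loop_join ?ea ?B) (loop_reverse (tail_path (p b))))"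
          using I A B AY by (intro path_homotopic_join[of ?Y _ _ "loop_reverse (tail_path (p b))"] path_homotopic_sym[OF path_homotopic_assoc]) simp_all
        also have "path_homotopic ?Y \<dots> (loop_join ?ea (loop_join ?B (loop_reverse (tail_path (p b)))))"
          using I A B AY by (intro path_homotopic_assoc) simp_all
        also have "path_homotopic ?Y \<dots> (loop_join ?ea (loop_reverse ?eb))"
        proof -
          have "loop_join ?B (loop_reverse (tail_path (p b))) t = loop_reverse ?eb t" for t
            using B I unfolding loop_join_def loop_reverse_def by (auto simp: algebra_simps)
          then have "loop_join ?B (loop_reverse (tail_path (p b))) = loop_reverse ?eb" by (rule ext)
          then show ?thesis using I A B AY by simp
        qed
        finally have "plane_class (?L a b) = plane_class (loop_join ?ea (loop_reverse ?eb))"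
          using I A B AY by (intro loop_class_eqI) simp_all
        also have "\<dots> = plane_class ?ea \<otimes>\<^bsub>plane_group\<^esub> inv\<^bsub>plane_group\<^esub> plane_class ?eb"
          using mult_fundamental_group[OF ea loop_at_loop_reverse[OF eb]] inv_fundamental_group[OF _ eb] slit_base_in by simp
        also have "\<dots> \<in> plane_span"
          using tail_lower_span[OF ab(1)] tail_lower_span[OF ab(2)] generate_m_inv_closed[OF plane_gen_carrier]
          by (intro generate.eng) auto
        finally show ?thesis .
      qed
      then show ?thesis using d(1) unfolding Q_def by blast
    qed
  qed simp
  then have "plane_class (?L 0 1) \<in> plane_span" by (simp add: Q_def)
  moreover have "plane_class (?L 0 1) = plane_class p"
  proof (rule loop_class_eqI)
    \<comment> \<open>The tail at the base point is some loop in \<open>upper_slit\<close>, not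
      literally the constant one.\<close>
    have null: "path_homotopic ?Y (tail_path slit_base) (\<lambda>t. slit_base)"
      "path_homotopic ?Y (loop_reverse (tail_path slit_base)) (\<lambda>t. slit_base)"
      using upper_path[OF slit_base_in(1) slit_base_in(1)] slit_base_in
      by (intro path_homotopic_simply_connected[OF simply_connected_slit(1) slit_subset(1)];
          simp add: tail_path_def)+
    have "path_homotopic ?Y (?L 0 1) (loop_join (loop_join (\<lambda>t. slit_base) p) (\<lambda>t. slit_base))"
      using null pp tail_path[OF slit_base_in(3)] by (intro path_homotopic_join) simp_all
    also have "path_homotopic ?Y \<dots> (loop_join (\<lambda>t. slit_base) p)"
      using pp slit_base_in by (intro path_homotopic_rid) simp_all
    also have "path_homotopic ?Y \<dots> p" using pp by (intro path_homotopic_lid) simp_all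
    finally show "path_homotopic ?Y (?L 0 1) p" .
  qed (simp_all add: pp tail_path[OF slit_base_in(3)])
  ultimately show ?thesis by simp
qed

theorem plane_group_free: "free_of_rank plane_group 3"
proof -
  have "generate plane_group (plane_gen ` {..<3}) = carrier plane_group"
    using plane_span_all group.generate_incl[OF group_plane plane_gen_carrier]
    by (auto simp: carrier_fundamental_group)
  then show ?thesis
    unfolding free_of_rank_def using group_plane plane_gen_carrier plane_words_nontrivial
    by (intro conjI exI[of _ plane_gen] allI impI) auto
qed

section \<open>Quotients by the involution\<close>

definition affine_cubic :: "(complex \<times> complex) set" where
  "affine_cubic = {(x, y). y\<^sup>2 = x ^ 3 - 4 * x \<and> y \<noteq> 0}"

definition gauss_lattice :: "complex set" where
  "gauss_lattice = {z. \<exists>m n :: int. z = of_int m + \<i> * of_int n}"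

lemma gauss_lattice_0: "0 \<in> gauss_lattice"
  unfolding gauss_lattice_def by (auto intro!: exI[of _ 0])

lemma gauss_lattice_add: "a \<in> gauss_lattice \<Longrightarrow> b \<in> gauss_lattice \<Longrightarrow> a + b \<in> gauss_lattice"
proof -
  assume "a \<in> gauss_lattice" "b \<in> gauss_lattice"
  then obtain m n m' n' where "a = of_int m + \<i> * of_int n" "b = of_int m' + \<i> * of_int n'" by (auto simp: gauss_lattice_def)
  then have "a + b = of_int (m + m') + \<i> * of_int (n + n')" by (simp add: algebra_simps)
  then show ?thesis unfolding gauss_lattice_def by blast
qed

lemma gauss_lattice_minus: "a \<in> gauss_lattice \<Longrightarrow> - a \<in> gauss_lattice"
proof -
  assume "a \<in> gauss_lattice"
  then obtain m n where "a = of_int m + \<i> * of_int n" by (auto simp: gauss_lattice_def)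
  then have "- a = of_int (- m) + \<i> * of_int (- n)" by (simp add: algebra_simps)
  then show ?thesis unfolding gauss_lattice_def by blast
qed

lemma gauss_lattice_diff: "a \<in> gauss_lattice \<Longrightarrow> b \<in> gauss_lattice \<Longrightarrow> a - b \<in> gauss_lattice"
  using gauss_lattice_add[of a "- b"] gauss_lattice_minus[of b] by simp

lemma gauss_lattice_uminus_iff [simp]: "- a \<in> gauss_lattice \<longleftrightarrow> a \<in> gauss_lattice"
  using gauss_lattice_minus[of a] gauss_lattice_minus[of "- a"] by auto

lemma gauss_lattice_norm: "a \<in> gauss_lattice \<Longrightarrow> a \<noteq> 0 \<Longrightarrow> norm a \<ge> 1"
proof -
  assume a: "a \<in> gauss_lattice" "a \<noteq> 0"
  then obtain m n where mn: "a = of_int m + \<i> * of_int n" by (auto simp: gauss_lattice_def)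
  have re: "Re a = of_int m" "Im a = of_int n" using mn by auto
  have "m \<noteq> 0 \<or> n \<noteq> 0" using a(2) mn by auto
  then have "\<bar>Re a\<bar> \<ge> 1 \<or> \<bar>Im a\<bar> \<ge> 1" unfolding re by linarith
  then show ?thesis using abs_Re_le_cmod[of a] abs_Im_le_cmod[of a] by linarith
qed

lemma affine_cubic_fst: "w \<in> affine_cubic \<Longrightarrow> fst w \<in> punctured_plane"
  by (auto simp: affine_cubic_def punctured_plane_def)

lemma cubic_nonzero: "x \<in> punctured_plane \<Longrightarrow> x ^ 3 - 4 * x \<noteq> (0::complex)"
proof
  assume x: "x \<in> punctured_plane" "x ^ 3 - 4 * x = 0"
  then have "x * (x - 2) * (x + 2) = 0" by (simp add: algebra_simps power3_eq_cube)
  then show False using x(1) by (auto simp: punctured_plane_def eq_neg_iff_add_eq_0)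
qed

lemma affine_cubic_lift: "x \<in> punctured_plane \<Longrightarrow> (x, csqrt (x ^ 3 - 4 * x)) \<in> affine_cubic"
  using cubic_nonzero[of x] by (auto simp: affine_cubic_def)

lemma affine_cubic_neg: "(x, y) \<in> affine_cubic \<Longrightarrow> (x, - y) \<in> affine_cubic"
  by (auto simp: affine_cubic_def)

lemma affine_cubic_same_fst:
  assumes "w \<in> affine_cubic" "w' \<in> affine_cubic" "fst w = fst w'" shows "snd w' = snd w \<or> snd w' = - snd w"
proof -
  have "(snd w')\<^sup>2 = (snd w)\<^sup>2" using assms by (auto simp: affine_cubic_def)
  then show ?thesis by (simp add: power2_eq_iff)
qed

lemma affine_cubic_covering:
  "evenly_covering_map (top_of_set affine_cubic) (top_of_set punctured_plane) fst"
  unfolding evenly_covering_map_def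
proof (intro conjI)
  have opn: "open punctured_plane" by (auto simp: punctured_plane_def intro: open_Compl)
  define f :: "complex \<Rightarrow> complex" where "f x = x ^ 3 - 4 * x" for x
  have fcont: "continuous_on A f" for A unfolding f_def by (intro continuous_intros)
  \<comment> \<open>On \<open>U x0\<close> the quotient \<open>f x / f x0\<close> has distance less
    than 1 from 1, so it stays in the right half-plane, where \<open>csqrt\<close> is continuous.
    This yields the local branch \<open>s\<close> of \<open>y\<close> through a given point.\<close>
  define U where "U x0 = {x. norm (f x - f x0) < norm (f x0)}" for x0
  have Uopen: "open (U x0)" for x0
    unfolding U_def by (intro open_Collect_less continuous_intros fcont)
  have Usub: "U x0 \<subseteq> punctured_plane" for x0
  proof
    fix x assume "x \<in> U x0"
    then have "f x \<noteq> 0" unfolding U_def by (cases "f x = 0") simp_all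
    then show "x \<in> punctured_plane" by (auto simp: punctured_plane_def f_def)
  qed
  have Ure: "Re (f x / f x0) > 0" if "x \<in> U x0" for x x0
  proof -
    have f0: "f x0 \<noteq> 0" using that by (auto simp: U_def)
    have "norm (f x / f x0 - 1) < 1"
    proof -
      have "f x / f x0 - 1 = (f x - f x0) / f x0" using f0 by (simp add: diff_divide_distrib)
      then show ?thesis using that f0 by (simp add: norm_divide U_def)
    qed
    then have "\<bar>Re (f x / f x0 - 1)\<bar> < 1" using abs_Re_le_cmod[of "f x / f x0 - 1"] by linarith
    then show ?thesis by simp
  qed
  define s where "s x0 y0 x = y0 * csqrt (f x / f x0)" for x0 y0 x
  have scont: "continuous_on (U x0) (s x0 y0)" for x0 y0
    unfolding s_def
  proof (intro continuous_on_mult continuous_on_const)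
    have "continuous_on (U x0) (\<lambda>x. f x / f x0)"
      by (cases "f x0 = 0") (auto intro!: continuous_intros fcont)
    moreover have "continuous_on ((\<lambda>x. f x / f x0) ` U x0) csqrt"
    proof (intro continuous_at_imp_continuous_on ballI continuous_at_csqrt)
      fix z assume "z \<in> (\<lambda>x. f x / f x0) ` U x0"
      then have "Re z > 0" using Ure by blast
      then show "z \<notin> \<real>\<^sub>\<le>\<^sub>0" by (auto simp: complex_nonpos_Reals_iff)
    qed
    ultimately show "continuous_on (U x0) (\<lambda>x. csqrt (f x / f x0))"
      by (rule continuous_on_compose[unfolded o_def])
  qed
  have sin: "(x, s x0 y0 x) \<in> affine_cubic" if "x \<in> U x0" "(x0, y0) \<in> affine_cubic" for x x0 y0
  proof -
    have "f x0 = y0\<^sup>2" "y0 \<noteq> 0" using that(2) by (auto simp: affine_cubic_def f_def)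
    moreover have "f x \<noteq> 0" using Usub that(1) cubic_nonzero by (auto simp: f_def)
    ultimately show ?thesis by (auto simp: affine_cubic_def s_def power_mult_distrib f_def[symmetric])
  qed
  have Umem: "x0 \<in> U x0" if "x0 \<in> punctured_plane" for x0 using cubic_nonzero[OF that] by (simp add: U_def f_def)
  show "continuous_map (top_of_set affine_cubic) (top_of_set punctured_plane) fst"
    using affine_cubic_fst by (auto intro!: continuous_intros)
  show "open_map (top_of_set affine_cubic) (top_of_set punctured_plane) fst"
    unfolding open_map_def
  proof (intro allI impI)
    fix T assume T: "openin (top_of_set affine_cubic) T"
    then obtain T' where T': "open T'" "T = affine_cubic \<inter> T'" by (auto simp: openin_open)
    have "\<exists>S. open S \<and> x0 \<in> S \<and> S \<subseteq> fst ` T" if x0: "x0 \<in> fst ` T" for x0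
    proof -
      obtain y0 where y0: "(x0, y0) \<in> T" using x0 by auto
      then have w: "(x0, y0) \<in> affine_cubic" "(x0, y0) \<in> T'" using T' by auto
      let ?S = "U x0 \<inter> (\<lambda>x. (x, s x0 y0 x)) -` T'"
      have "open ?S"
        by (rule continuous_open_preimage[OF continuous_on_Pair[OF continuous_on_id scont] Uopen T'(1)])
      moreover have "x0 \<in> ?S" using Umem[of x0] affine_cubic_fst[OF w(1)] w cubic_nonzero[of x0] by (simp add: s_def f_def)
      moreover have "?S \<subseteq> fst ` T" using sin[OF _ w(1)] T' by force
      ultimately show ?thesis by blast
    qed
    then have "open (fst ` T)" by (subst open_subopen) blast
    then show "openin (top_of_set punctured_plane) (fst ` T)"
      using affine_cubic_fst T' opn by (auto simp: openin_open_eq)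
  qed
  show "fst ` topspace (top_of_set affine_cubic) = topspace (top_of_set punctured_plane)"
    using affine_cubic_fst affine_cubic_lift by force
  show "\<forall>x\<in>topspace (top_of_set punctured_plane). \<exists>U \<V>. openin (top_of_set punctured_plane) U \<and> x \<in> U \<and> disjoint \<V> \<and>
     \<Union>\<V> = {c \<in> topspace (top_of_set affine_cubic). fst c \<in> U} \<and> (\<forall>V\<in>\<V>. openin (top_of_set affine_cubic) V \<and> bij_betw fst V U)"
  proof
    fix x0 assume "x0 \<in> topspace (top_of_set punctured_plane)"
    then have x0: "x0 \<in> punctured_plane" by simp
    define y0 where "y0 = csqrt (f x0)"
    have w0: "(x0, y0) \<in> affine_cubic" "(x0, - y0) \<in> affine_cubic"
      using affine_cubic_lift[OF x0] affine_cubic_neg by (auto simp: y0_def f_def)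
    then have fx0: "f x0 = y0\<^sup>2" "y0 \<noteq> 0" by (auto simp: affine_cubic_def f_def)
    \<comment> \<open>The two sheets are told apart by the sign of the real part of
      \<open>y / y0\<close>, which is nonzero because the square of this quotient has positive real
      part.\<close>
    define V where "V e = {w \<in> affine_cubic. fst w \<in> U x0 \<and> Re (e * (snd w / y0)) > 0}" for e :: complex
    have cover: "w \<in> V 1 \<or> w \<in> V (- 1)" if w: "w \<in> affine_cubic" "fst w \<in> U x0" for w
    proof -
      have "(snd w / y0)\<^sup>2 = f (fst w) / f x0" using w fx0 by (auto simp: affine_cubic_def f_def power_divide)
      then have "Re ((snd w / y0)\<^sup>2) > 0" using Ure[OF w(2)] by simp
      then have less: "(Im (snd w / y0))\<^sup>2 < (Re (snd w / y0))\<^sup>2" by (simp only: Re_power2 diff_gt_0_iff_gt)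
      have "Re (snd w / y0) \<noteq> 0"
      proof
        assume "Re (snd w / y0) = 0"
        then show False using less by (simp only: power_zero_numeral) (simp add: not_less)
      qed
      then show ?thesis using w by (auto simp: V_def)
    qed
    have disj: "V 1 \<inter> V (- 1) = {}" by (auto simp: V_def)
    have Vopen: "openin (top_of_set affine_cubic) (V e)" for e
    proof -
      have "open {w :: complex \<times> complex. fst w \<in> U x0 \<and> Re (e * (snd w / y0)) > 0}"
      proof -
        have "open {w :: complex \<times> complex. Re (e * (snd w / y0)) > 0}"
          using fx0 by (intro open_Collect_less continuous_intros) auto
        moreover have "open (fst -` U x0 :: (complex \<times> complex) set)" by (rule open_vimage_fst[OF Uopen])
        ultimately show ?thesis by (auto simp: vimage_def Collect_conj_eq intro!: open_Int)
      qed
      moreover have "V e = affine_cubic \<inter> {w. fst w \<in> U x0 \<and> Re (e * (snd w / y0)) > 0}" by (auto simp: V_def)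
      ultimately show ?thesis by (auto simp: openin_open)
    qed
    have Vbij: "bij_betw fst (V e) (U x0)" if e: "e \<in> {1, - 1}" for e
    proof -
      have "inj_on fst (V e)"
      proof (rule inj_onI)
        fix w w' assume w: "w \<in> V e" "w' \<in> V e" "fst w = fst w'"
        then have "snd w' = snd w \<or> snd w' = - snd w" by (intro affine_cubic_same_fst) (auto simp: V_def)
        moreover have "snd w' \<noteq> - snd w" using w(1,2) by (auto simp: V_def)
        ultimately show "w = w'" using w(3) by (auto simp: prod_eq_iff)
      qed
      moreover have "x \<in> fst ` V e" if x: "x \<in> U x0" for x
      proof -
        have "(x, s x0 (e * y0) x) \<in> affine_cubic" using sin[OF x] w0 e by auto
        moreover have "Re (e * (s x0 (e * y0) x / y0)) > 0"
        proof -
          have "e * (s x0 (e * y0) x / y0) = csqrt (f x / f x0)" using e fx0 by (auto simp: s_def)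
          moreover have "Re (csqrt (f x / f x0)) > 0"
          proof -
            define c where "c = csqrt (f x / f x0)"
            have "c\<^sup>2 = f x / f x0" by (simp add: c_def)
            then have "Re (c\<^sup>2) > 0" using Ure[OF x] by simp
            then have less: "(Im c)\<^sup>2 < (Re c)\<^sup>2" by (simp only: Re_power2 diff_gt_0_iff_gt)
            have "Re c \<noteq> 0"
            proof
              assume "Re c = 0"
              then show False using less by (simp only: power_zero_numeral) (simp add: not_less)
            qed
            then show ?thesis using Re_csqrt[of "f x / f x0"] unfolding c_def by linarith
          qed
          ultimately show ?thesis by simp
        qed
        ultimately have "(x, s x0 (e * y0) x) \<in> V e" using x by (simp add: V_def)
        then show ?thesis by force
      qed
      ultimately show ?thesis by (auto simp: bij_betw_def V_def)
    qed
    show "\<exists>U \<V>. openin (top_of_set punctured_plane) U \<and> x0 \<in> U \<and> disjoint \<V> \<and>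
     \<Union>\<V> = {c \<in> topspace (top_of_set affine_cubic). fst c \<in> U} \<and> (\<forall>V\<in>\<V>. openin (top_of_set affine_cubic) V \<and> bij_betw fst V U)"
    proof (intro exI conjI)
      show "openin (top_of_set punctured_plane) (U x0)" using Uopen Usub opn by (simp add: openin_open_eq)
      show "x0 \<in> U x0" using Umem x0 .
      show "disjoint {V 1, V (- 1)}" using disj by (auto simp: disjoint_def)
      show "\<Union>{V 1, V (- 1)} = {c \<in> topspace (top_of_set affine_cubic). fst c \<in> U x0}"
        using cover by (auto simp: V_def)
      show "\<forall>V\<in>{V 1, V (- 1)}. openin (top_of_set affine_cubic) V \<and> bij_betw fst V (U x0)"
        using Vopen Vbij by auto
    qed
  qed
qed

text \<open>What the two surfaces have in common. The alternatives in \<open>fibre\<close> are the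
  two kinds of group elements: translations by the lattice, and their composites with the sign
  change in \<open>y\<close> and \<open>v\<close>.\<close>

locale inv_quotient =
  fixes Y :: "'a topology" and p :: "(complex \<times> complex) \<times> complex \<Rightarrow> 'a"
  assumes cont: "continuous_map (top_of_set (affine_cubic \<times> UNIV)) Y p"
    and opn: "open_map (top_of_set (affine_cubic \<times> UNIV)) Y p"
    and surj: "p ` (affine_cubic \<times> UNIV) = topspace Y"
    and fibre: "\<And>x y x' y' v v'. (x, y) \<in> affine_cubic \<Longrightarrow> (x', y') \<in> affine_cubic \<Longrightarrow>
      p ((x, y), v) = p ((x', y'), v') \<longleftrightarrow>
      x' = x \<and> ((y' = y \<and> v' - v \<in> gauss_lattice) \<or> (y' = - y \<and> v' + v \<in> gauss_lattice))"
begin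

text \<open>The group acts freely because \<open>y\<close> never vanishes: an element with a sign
  change moves \<open>(x, y)\<close>, and a nonzero translation moves \<open>v\<close>.\<close>

lemma covering: "evenly_covering_map (top_of_set (affine_cubic \<times> UNIV)) Y p"
  unfolding evenly_covering_map_def
proof (intro conjI cont opn)
  let ?Z = "top_of_set (affine_cubic \<times> (UNIV :: complex set))"
  show "p ` topspace ?Z = topspace Y" using surj by simp
  show "\<forall>x\<in>topspace Y. \<exists>U \<V>. openin Y U \<and> x \<in> U \<and> disjoint \<V> \<and>
     \<Union>\<V> = {c \<in> topspace ?Z. p c \<in> U} \<and> (\<forall>V\<in>\<V>. openin ?Z V \<and> bij_betw p V U)"
  proof
    fix a assume "a \<in> topspace Y"
    then obtain x0 y0 v0 where a: "(x0, y0) \<in> affine_cubic" "a = p ((x0, y0), v0)" using surj by force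
    then have y0: "y0 \<noteq> 0" by (auto simp: affine_cubic_def)
    \<comment> \<open>Sheets are indexed by a sign \<open>e\<close> and a lattice vector
      \<open>l\<close>. The radius \<open>norm y0\<close> prevents \<open>y\<close> and
      \<open>- y\<close> from both qualifying, and 1/2 is half the minimal distance between lattice
      points.\<close>
    define V where "V e l = {((x, y), v). (x, y) \<in> affine_cubic \<and> norm (e * y - y0) < norm y0 \<and> norm (v - (e * v0 + l)) < 1/2}"
      for e l :: complex
    let ?I = "{1, - 1} \<times> gauss_lattice"
    have Vopen: "openin ?Z (V e l)" for e l
    proof -
      have "open {w :: (complex \<times> complex) \<times> complex. norm (e * snd (fst w) - y0) < norm y0 \<and> norm (snd w - (e * v0 + l)) < 1/2}"
        unfolding Collect_conj_eq by (intro open_Int open_Collect_less continuous_intros)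
      moreover have "V e l = (affine_cubic \<times> UNIV) \<inter>
        {w :: (complex \<times> complex) \<times> complex. norm (e * snd (fst w) - y0) < norm y0 \<and> norm (snd w - (e * v0 + l)) < 1/2}"
        by (auto simp: V_def)
      ultimately show ?thesis by (auto simp: openin_open)
    qed
    define U where "U = p ` V 1 0"
    have Uopen: "openin Y U" using opn Vopen by (auto simp: open_map_def U_def)
    have aU: "a \<in> U" using a y0 by (force simp: U_def V_def)
    have sign: False if "norm (y - y0) < norm y0" "norm (- y - y0) < norm y0" for y
    proof -
      have "norm (2 * y0) = norm (- ((y - y0) + (- y - y0)))" by simp
      also have "\<dots> \<le> norm (y - y0) + norm (- y - y0)" using norm_triangle_ineq[of "y - y0" "- y - y0"] by (simp only: norm_minus_cancel)
      finally show False using that by simp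
    qed
    have small: "l = l'" if "norm (v - (c + l)) < 1/2" "norm (v - (c + l')) < 1/2" "l \<in> gauss_lattice" "l' \<in> gauss_lattice"
      for v c l l'
    proof -
      have "norm (l' - l) = norm ((v - (c + l)) - (v - (c + l')))" by simp
      also have "\<dots> \<le> norm (v - (c + l)) + norm (v - (c + l'))" by (rule norm_triangle_ineq4)
      finally have "norm (l' - l) < 1" using that by simp
      then show ?thesis using gauss_lattice_norm[of "l' - l"] gauss_lattice_diff[OF that(4,3)] by fastforce
    qed
    have near: "v = v'" if "norm (v - c) < 1/2" "norm (v' - c) < 1/2" "v' - v \<in> gauss_lattice" for v v' c
    proof -
      have "norm (v' - v) \<le> norm (v' - c) + norm (v - c)" using norm_triangle_ineq4[of "v' - c" "v - c"] by simp
      then show ?thesis using that gauss_lattice_norm[of "v' - v"] by fastforce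
    qed
    have inj: "inj_on p (V e l)" if e: "e \<in> {1, - 1}" for e l
    proof (rule inj_onI)
      fix c c' assume "c \<in> V e l" "c' \<in> V e l" and eq: "p c = p c'"
      then obtain x y v x' y' v' where c: "c = ((x, y), v)" "c' = ((x', y'), v')"
        "(x, y) \<in> affine_cubic" "norm (e * y - y0) < norm y0" "norm (v - (e * v0 + l)) < 1/2"
        "(x', y') \<in> affine_cubic" "norm (e * y' - y0) < norm y0" "norm (v' - (e * v0 + l)) < 1/2"
        by (auto simp: V_def)
      have "x' = x \<and> ((y' = y \<and> v' - v \<in> gauss_lattice) \<or> (y' = - y \<and> v' + v \<in> gauss_lattice))"
        using eq fibre[OF c(3) c(6)] c by simp
      moreover have "y' \<noteq> - y" using sign[of "e * y"] c(4,7) by auto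
      ultimately show "c = c'" using near[OF c(5) c(8)] c by auto
    qed
    have img: "p ` V e l = U" if e: "e \<in> {1, - 1}" and l: "l \<in> gauss_lattice" for e l
    proof
      show "p ` V e l \<subseteq> U"
      proof
        fix b assume "b \<in> p ` V e l"
        then obtain x y v where c: "b = p ((x, y), v)" "(x, y) \<in> affine_cubic" "norm (e * y - y0) < norm y0" "norm (v - (e * v0 + l)) < 1/2"
          by (auto simp: V_def)
        have "(x, e * y) \<in> affine_cubic" using c(2) e affine_cubic_neg by auto
        moreover have "norm (e * (v - l) - v0) = norm (v - (e * v0 + l))"
        proof -
          have "e * (v - l) - v0 = e * (v - (e * v0 + l))" using e by (auto simp: algebra_simps)
          then show ?thesis using e by (auto simp: norm_mult)
        qed
        ultimately have "((x, e * y), e * (v - l)) \<in> V 1 0" using c by (auto simp: V_def)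
        moreover have "p ((x, y), v) = p ((x, e * y), e * (v - l))"
          using e l fibre[OF c(2) \<open>(x, e * y) \<in> affine_cubic\<close>, of v "e * (v - l)"] by auto
        ultimately show "b \<in> U" unfolding U_def c(1) by blast
      qed
      show "U \<subseteq> p ` V e l"
      proof
        fix b assume "b \<in> U"
        then obtain x y v where c: "b = p ((x, y), v)" "(x, y) \<in> affine_cubic" "norm (y - y0) < norm y0" "norm (v - v0) < 1/2"
          by (auto simp: V_def U_def)
        have "(x, e * y) \<in> affine_cubic" using c(2) e affine_cubic_neg by auto
        moreover have "norm (e * v + l - (e * v0 + l)) = norm (v - v0)"
        proof -
          have "e * v + l - (e * v0 + l) = e * (v - v0)" by (auto simp: algebra_simps)
          then show ?thesis using e by (auto simp: norm_mult)
        qed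
        ultimately have "((x, e * y), e * v + l) \<in> V e l" using c e by (auto simp: V_def)
        moreover have "p ((x, y), v) = p ((x, e * y), e * v + l)"
          using e l fibre[OF c(2) \<open>(x, e * y) \<in> affine_cubic\<close>, of v "e * v + l"] by auto
        ultimately show "b \<in> p ` V e l" unfolding c(1) by blast
      qed
    qed
    have union: "\<Union>((\<lambda>(e, l). V e l) ` ?I) = {c \<in> topspace ?Z. p c \<in> U}"
    proof
      show "\<Union>((\<lambda>(e, l). V e l) ` ?I) \<subseteq> {c \<in> topspace ?Z. p c \<in> U}"
      proof
        fix c assume "c \<in> \<Union>((\<lambda>(e, l). V e l) ` ?I)"
        then obtain e l where el: "e \<in> {1, - 1}" "l \<in> gauss_lattice" "c \<in> V e l" by blast
        then have "p c \<in> U" using img by blast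
        moreover have "c \<in> topspace ?Z" using el(3) by (auto simp: V_def)
        ultimately show "c \<in> {c \<in> topspace ?Z. p c \<in> U}" by blast
      qed
      show "{c \<in> topspace ?Z. p c \<in> U} \<subseteq> \<Union>((\<lambda>(e, l). V e l) ` ?I)"
      proof safe
        fix x' y' v' assume c': "((x', y'), v') \<in> topspace ?Z" "p ((x', y'), v') \<in> U"
        then obtain x y v where c: "p ((x', y'), v') = p ((x, y), v)" "(x, y) \<in> affine_cubic" "norm (y - y0) < norm y0" "norm (v - v0) < 1/2"
          by (auto simp: V_def U_def)
        have w': "(x', y') \<in> affine_cubic" using c' by auto
        have "x' = x \<and> ((y' = y \<and> v' - v \<in> gauss_lattice) \<or> (y' = - y \<and> v' + v \<in> gauss_lattice))"
          using fibre[OF c(2) w', of v v'] c(1) by simp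
        then consider "x' = x" "y' = y" "v' - v \<in> gauss_lattice" | "x' = x" "y' = - y" "v' + v \<in> gauss_lattice" by blast
        then show "((x', y'), v') \<in> \<Union>((\<lambda>(e, l). V e l) ` ?I)"
        proof cases
          case 1
          then have "((x', y'), v') \<in> V 1 (v' - v)" using c w' by (auto simp: V_def)
          then show ?thesis using 1 by blast
        next
          case 2
          have "norm (v' - (- v0 + (v' + v))) = norm (v - v0)" by (simp add: norm_minus_commute)
          then have "((x', y'), v') \<in> V (- 1) (v' + v)" using 2 c w' by (auto simp: V_def)
          then show ?thesis using 2 by blast
        qed
      qed
    qed
    have disj: "disjoint ((\<lambda>(e, l). V e l) ` ?I)"
    proof -
      have "e = e' \<and> l = l'" if el: "e \<in> {1, - 1}" "l \<in> gauss_lattice" "e' \<in> {1, - 1}" "l' \<in> gauss_lattice" "c \<in> V e l" "c \<in> V e' l'" for e l e' l' c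
      proof -
        obtain x y v where c: "norm (e * y - y0) < norm y0" "norm (v - (e * v0 + l)) < 1/2"
           "norm (e' * y - y0) < norm y0" "norm (v - (e' * v0 + l')) < 1/2"
          using el(5,6) by (auto simp: V_def)
        have "e = e'" using sign[of y] c(1,3) el(1,3) by auto
        then show ?thesis using small[of v "e * v0" l l'] c el by auto
      qed
      note uniq = this
      show ?thesis unfolding disjoint_def
      proof (intro ballI impI)
        fix A B assume "A \<in> (\<lambda>(e, l). V e l) ` ?I" "B \<in> (\<lambda>(e, l). V e l) ` ?I" and ne: "A \<noteq> B"
        then obtain e l e' l' where el: "e \<in> {1, - 1}" "l \<in> gauss_lattice" "A = V e l"
           "e' \<in> {1, - 1}" "l' \<in> gauss_lattice" "B = V e' l'" by blast
        show "A \<inter> B = {}"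
        proof (rule ccontr)
          assume "A \<inter> B \<noteq> {}"
          then obtain c where "c \<in> V e l" "c \<in> V e' l'" using el by blast
          then have "e = e' \<and> l = l'" using uniq el by blast
          then show False using ne el by simp
        qed
      qed
    qed
    show "\<exists>U \<V>. openin Y U \<and> a \<in> U \<and> disjoint \<V> \<and>
       \<Union>\<V> = {c \<in> topspace ?Z. p c \<in> U} \<and> (\<forall>V\<in>\<V>. openin ?Z V \<and> bij_betw p V U)"
      by (intro exI[of _ U] exI[of _ "(\<lambda>(e, l). V e l) ` ?I"] conjI Uopen aU disj union)
         (use Vopen inj img in \<open>auto simp: bij_betw_def\<close>)
  qed
qed

section \<open>Projection, zero section and base point\<close>

definition base_y :: complex where "base_y = csqrt (slit_base ^ 3 - 4 * slit_base)"
definition base_w :: "complex \<times> complex" where "base_w = (slit_base, base_y)"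
definition base_pt :: 'a where "base_pt = p (base_w, 0)"

definition proj :: "'a \<Rightarrow> complex" where
  "proj a = fst (fst (SOME c. c \<in> affine_cubic \<times> UNIV \<and> p c = a))"

text \<open>\<open>csqrt\<close> jumps across its cut, but its sign is invisible here:
  \<open>(x, y)\<close> and \<open>(x, - y)\<close> with \<open>v = 0\<close> lie in one orbit.
  Continuity is therefore obtained through the quotient map \<open>fst\<close> on
  \<open>affine_cubic\<close>, with no choice of a root.\<close>

definition zero_section :: "complex \<Rightarrow> 'a" where
  "zero_section x = p ((x, csqrt (x ^ 3 - 4 * x)), 0)"

lemma base_w: "base_w \<in> affine_cubic" "fst base_w = slit_base"
  using affine_cubic_lift[OF slit_base_in(3)] by (auto simp: base_w_def base_y_def)

lemma p_in: "w \<in> affine_cubic \<Longrightarrow> p (w, v) \<in> topspace Y"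
  using surj by auto

lemma base_pt_in: "base_pt \<in> topspace Y"
  using p_in base_w by (simp add: base_pt_def)

lemma proj_p: "w \<in> affine_cubic \<Longrightarrow> proj (p (w, v)) = fst w"
proof -
  assume w: "w \<in> affine_cubic"
  have "\<exists>c. c \<in> affine_cubic \<times> UNIV \<and> p c = p (w, v)" using w by blast
  from someI_ex[OF this] obtain w' v' where c: "(SOME c. c \<in> affine_cubic \<times> UNIV \<and> p c = p (w, v)) = (w', v')"
    "w' \<in> affine_cubic" "p (w', v') = p (w, v)" by (metis (no_types, lifting) mem_Sigma_iff surj_pair)
  then have "fst w = fst w'" using fibre[of "fst w'" "snd w'" "fst w" "snd w" v' v] w by simp
  then show ?thesis unfolding proj_def c(1) by simp
qed

lemma quotient_p: "quotient_map (top_of_set (affine_cubic \<times> UNIV)) Y p"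
  using cont opn surj by (intro continuous_open_imp_quotient_map) auto

lemma proj_cont: "continuous_map Y (top_of_set punctured_plane) proj"
proof (rule continuous_compose_quotient_map[OF quotient_p])
  have "continuous_map (top_of_set (affine_cubic \<times> UNIV)) (top_of_set punctured_plane) (fst \<circ> fst)"
    using affine_cubic_fst by (auto simp: continuous_map_in_subtopology o_def intro!: continuous_intros)
  then show "continuous_map (top_of_set (affine_cubic \<times> UNIV)) (top_of_set punctured_plane) (proj \<circ> p)"
    by (rule continuous_map_eq) (auto simp: proj_p)
qed

lemma zero_section_eq: "w \<in> affine_cubic \<Longrightarrow> zero_section (fst w) = p (w, 0)"
  unfolding zero_section_def
  using fibre[of "fst w" "csqrt (fst w ^ 3 - 4 * fst w)" "fst w" "snd w" 0 0] affine_cubic_lift[OF affine_cubic_fst[of w]]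
    affine_cubic_same_fst[of "(fst w, csqrt (fst w ^ 3 - 4 * fst w))" w] gauss_lattice_0 by auto

lemma zero_section_cont: "continuous_map (top_of_set punctured_plane) Y zero_section"
proof (rule continuous_compose_quotient_map)
  show "quotient_map (top_of_set affine_cubic) (top_of_set punctured_plane) fst"
    using evenly_covering_mapD[OF affine_cubic_covering] by (intro continuous_open_imp_quotient_map)
  have "continuous_map (top_of_set affine_cubic) (top_of_set (affine_cubic \<times> UNIV)) (\<lambda>w. (w, 0))"
    by (auto simp: continuous_map_in_subtopology intro!: continuous_intros)
  then have "continuous_map (top_of_set affine_cubic) Y (p \<circ> (\<lambda>w. (w, 0)))" using cont by (rule continuous_map_compose)
  then show "continuous_map (top_of_set affine_cubic) Y (zero_section \<circ> fst)"
    by (rule continuous_map_eq) (auto simp: zero_section_eq)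
qed

lemma proj_zero_section: "x \<in> punctured_plane \<Longrightarrow> proj (zero_section x) = x"
  unfolding zero_section_def using proj_p[OF affine_cubic_lift] by simp

lemma base_pt_maps: "proj base_pt = slit_base" "zero_section slit_base = base_pt"
  using proj_p[OF base_w(1)] zero_section_eq[OF base_w(1)] base_w(2) by (auto simp: base_pt_def)

section \<open>The kernel of the projection\<close>

abbreviation base_group :: "(real \<Rightarrow> 'a) set monoid" where "base_group \<equiv> fundamental_group Y base_pt"

abbreviation proj_hom :: "(real \<Rightarrow> 'a) set \<Rightarrow> (real \<Rightarrow> complex) set" where
  "proj_hom \<equiv> induced_map (top_of_set punctured_plane) slit_base proj"

lemma path_homotopic_p: "path_homotopic (top_of_set (affine_cubic \<times> UNIV)) f g \<Longrightarrow> path_homotopic Y (p \<circ> f) (p \<circ> g)"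
  by (rule path_homotopic_compose[OF _ cont])

definition fibre_path :: "complex \<Rightarrow> real \<Rightarrow> (complex \<times> complex) \<times> complex" where
  "fibre_path a t = (base_w, of_real t * a)"

lemma pathin_fibre_path: "pathin (top_of_set (affine_cubic \<times> UNIV)) (fibre_path a)"
  unfolding pathin_canon_iff path_def fibre_path_def[abs_def] using base_w by (auto intro!: continuous_intros)

lemma p_lattice: "w \<in> affine_cubic \<Longrightarrow> a \<in> gauss_lattice \<Longrightarrow> p (w, a + v) = p (w, v)"
  using fibre[of "fst w" "snd w" "fst w" "snd w" "a + v" v] by simp

lemma loop_at_fibre_path:
  assumes "a \<in> gauss_lattice" shows "loop_at Y base_pt (p \<circ> fibre_path a)"
proof -
  have "pathin Y (p \<circ> fibre_path a)"
    using pathin_fibre_path cont unfolding pathin_def by (rule continuous_map_compose)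
  moreover have "p (base_w, a) = p (base_w, 0)" using p_lattice[OF base_w(1) assms, of 0] by simp
  ultimately show ?thesis by (simp add: loop_at_def fibre_path_def base_pt_def)
qed

lemma fibre_path_join:
  assumes a: "a \<in> gauss_lattice" and b: "b \<in> gauss_lattice"
  shows "path_homotopic Y (loop_join (p \<circ> fibre_path a) (p \<circ> fibre_path b)) (p \<circ> fibre_path (a + b))"
proof -
  let ?Z = "top_of_set ({base_w} \<times> (UNIV :: complex set))"
  \<comment> \<open>The lift of the second loop that starts where the lift of the first one ends.
    Both then lie in the convex set \<open>{base_w} x C\<close>, where the homotopy takes
    place.\<close>
  let ?b = "\<lambda>t. (base_w, a + of_real t * b)"
  have pa: "pathin ?Z (fibre_path a)" "pathin ?Z ?b" "pathin ?Z (fibre_path (a + b))"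
    unfolding pathin_canon_iff path_def fibre_path_def[abs_def] by (auto intro!: continuous_intros)
  have "pathin ?Z (loop_join (fibre_path a) ?b)"
    using pa by (intro pathin_loop_join) (auto simp: fibre_path_def)
  moreover have "simply_connected ({base_w} \<times> (UNIV :: complex set))"
    by (intro convex_imp_simply_connected convex_Times) auto
  ultimately have "path_homotopic (top_of_set (affine_cubic \<times> UNIV)) (loop_join (fibre_path a) ?b) (fibre_path (a + b))"
    using pa base_w by (intro path_homotopic_simply_connected[of "{base_w} \<times> UNIV"]) (auto simp: fibre_path_def)
  then have "path_homotopic Y (p \<circ> loop_join (fibre_path a) ?b) (p \<circ> fibre_path (a + b))" by (rule path_homotopic_p)
  moreover have "p \<circ> loop_join (fibre_path a) ?b = loop_join (p \<circ> fibre_path a) (p \<circ> fibre_path b)"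
    unfolding comp_loop_join by (auto simp: loop_join_def fibre_path_def p_lattice base_w a)
  ultimately show ?thesis by simp
qed

text \<open>The two straight paths are lifts with a common start, so a homotopy of their images
  lifts to one with fixed ends and their end points agree.\<close>

lemma fibre_path_inj:
  assumes "path_homotopic Y (p \<circ> fibre_path a) (p \<circ> fibre_path b)" shows "a = b"
proof -
  have "path_homotopic (top_of_set (affine_cubic \<times> UNIV)) (fibre_path a) (fibre_path b)"
    by (rule path_homotopic_lift[OF covering assms]) (auto simp: pathin_fibre_path, auto simp: fibre_path_def)
  from path_homotopic_ends(2)[OF this] show ?thesis by (simp add: fibre_path_def)
qed

lemma proj_fibre_path: "proj \<circ> (p \<circ> fibre_path a) = (\<lambda>t. slit_base)"
  using proj_p[OF base_w(1)] base_w(2) by (auto simp: fibre_path_def)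

text \<open>In the lift \<open>(w, v)\<close> of \<open>r\<close>, the part \<open>w\<close> lifts a
  null-homotopic path along the double covering \<open>affine_cubic\<close>, hence contracts to
  \<open>base_w\<close> with fixed ends. So \<open>w\<close> returns to the same \<open>y\<close>,
  and the ends of the lift differ by a translation, not by a sign change.\<close>

lemma null_proj_imp_fibre_path:
  assumes r: "loop_at Y base_pt r" and null: "path_homotopic (top_of_set punctured_plane) (proj \<circ> r) (\<lambda>t. slit_base)"
  shows "\<exists>a\<in>gauss_lattice. path_homotopic Y r (p \<circ> fibre_path a)"
proof -
  let ?Z = "top_of_set (affine_cubic \<times> (UNIV :: complex set))" and ?S = "{0..1} \<times> {0..1} :: (real \<times> real) set"
  have rr: "pathin Y r" "r 0 = base_pt" "r 1 = base_pt" using r by (auto simp: loop_at_def)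
  obtain c where c: "pathin ?Z c" "c 0 = (base_w, 0)" "\<And>t. t \<in> {0..1} \<Longrightarrow> p (c t) = r t"
    using path_lift[OF covering rr(1), of "(base_w, 0)"] rr base_w by (auto simp: base_pt_def)
  define w v where "w t = fst (c t)" and "v t = snd (c t)" for t
  have cc: "continuous_on {0..1} c" "\<And>t. t \<in> {0..1} \<Longrightarrow> c t \<in> affine_cubic \<times> UNIV"
    using c(1) unfolding pathin_canon_iff path_def by blast+
  have w: "pathin (top_of_set affine_cubic) w"
    using cc by (fastforce simp: pathin_canon_iff path_def w_def[abs_def] intro!: continuous_intros)
  have vc: "continuous_on {0..1} v" using cc by (auto simp: v_def[abs_def] intro!: continuous_intros)
  have "path_homotopic (top_of_set affine_cubic) w (\<lambda>t. base_w)"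
  proof (rule path_homotopic_lift[OF affine_cubic_covering null w])
    show "fst (w t) = (proj \<circ> r) t" if "t \<in> {0..1}" for t
      using c(3)[OF that] proj_p[of "fst (c t)" "snd (c t)"] cc(2)[OF that] by (auto simp: w_def)
  qed (use base_w c in \<open>auto simp: w_def\<close>)
  then obtain h where h: "continuous_map (top_of_set ?S) (top_of_set affine_cubic) h"
     "\<forall>t\<in>{0..1}. h (0, t) = w t" "\<forall>t\<in>{0..1}. h (1, t) = base_w"
     "\<forall>s\<in>{0..1}. h (s, 0) = w 0 \<and> h (s, 1) = w 1"
    unfolding path_homotopic_square by blast
  have w1: "w 1 = base_w" using h(3,4) by (metis atLeastAtMost_iff order_refl zero_le_one)
  define a where "a = v 1"
  have c1: "c 1 = (base_w, a)" using w1 by (simp add: w_def a_def v_def prod_eq_iff)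
  have "p (base_w, a) = p (base_w, 0)" using c(3)[of 1] c1 rr(3) by (simp add: base_pt_def)
  then have a: "a \<in> gauss_lattice"
    using fibre[of "fst base_w" "snd base_w" "fst base_w" "snd base_w" a 0] base_w(1) by auto
  \<comment> \<open>Contracts \<open>w\<close> by \<open>h\<close> and simultaneously moves
    \<open>v\<close> along straight lines to the linear path from 0 to \<open>a\<close>; both ends
    stay fixed.\<close>
  let ?H = "\<lambda>z. (h z, of_real (1 - fst z) * v (snd z) + of_real (fst z) * (of_real (snd z) * a))"
  have "path_homotopic ?Z c (fibre_path a)" unfolding path_homotopic_square
  proof (intro exI[of _ ?H] conjI ballI)
    have "continuous_on ?S h" "h ` ?S \<subseteq> affine_cubic" using h(1) by (auto simp: continuous_map_in_subtopology)
    moreover have "continuous_on ?S (\<lambda>z. v (snd z))"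
      by (rule continuous_on_compose2[OF vc]) (auto intro!: continuous_intros)
    ultimately show "continuous_map (top_of_set ?S) ?Z ?H"
      by (auto simp: continuous_map_in_subtopology intro!: continuous_intros)
    fix t :: real assume t: "t \<in> {0..1}"
    show "?H (0, t) = c t" using h(2) t by (simp add: w_def v_def)
    show "?H (1, t) = fibre_path a t" using h(3) t by (simp add: fibre_path_def)
    have "v 0 = 0" using c(2) by (simp add: v_def)
    then show "?H (t, 0) = c 0" using h(4) t c(2) by (simp add: w_def)
    show "?H (t, 1) = c 1" using h(4) t c1 w1 by (simp add: a_def algebra_simps)
  qed
  then have "path_homotopic Y (p \<circ> c) (p \<circ> fibre_path a)" by (rule path_homotopic_p)
  moreover have "path_homotopic Y r (p \<circ> c)" using rr(1) c(3) by (intro path_homotopic_eq) auto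
  ultimately show ?thesis using a path_homotopic_trans by blast
qed

definition lattice_class :: "int \<times> int \<Rightarrow> (real \<Rightarrow> 'a) set" where
  "lattice_class k = loop_class Y base_pt (p \<circ> fibre_path (of_int (fst k) + \<i> * of_int (snd k)))"

lemma lattice_class_iso:
  "lattice_class \<in> iso (integer_group \<times>\<times> integer_group) (base_group\<lparr>carrier := kernel base_group plane_group proj_hom\<rparr>)"
proof -
  let ?l = "\<lambda>k :: int \<times> int. of_int (fst k) + \<i> * of_int (snd k)"
  let ?N = "kernel base_group plane_group proj_hom"
  have l: "?l k \<in> gauss_lattice" for k by (auto simp: gauss_lattice_def)
  have inN: "lattice_class k \<in> ?N" for k
    using loop_at_fibre_path[OF l] induced_map_loop_class[OF loop_at_fibre_path[OF l] proj_cont base_pt_maps(1)]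
    by (auto simp: kernel_def lattice_class_def proj_fibre_path one_fundamental_group)
  have "lattice_class \<in> hom (integer_group \<times>\<times> integer_group) (base_group\<lparr>carrier := ?N\<rparr>)"
  proof (rule homI)
    fix x y assume "x \<in> carrier (integer_group \<times>\<times> integer_group)" "y \<in> carrier (integer_group \<times>\<times> integer_group)"
    have "loop_class Y base_pt (loop_join (p \<circ> fibre_path (?l x)) (p \<circ> fibre_path (?l y))) =
       loop_class Y base_pt (p \<circ> fibre_path (?l x + ?l y))"
      using loop_at_fibre_path[OF l] by (intro loop_class_eqI fibre_path_join l) (auto simp: loop_at_def)
    moreover have "?l x + ?l y = ?l (x \<otimes>\<^bsub>integer_group \<times>\<times> integer_group\<^esub> y)"
      by (cases x; cases y) (auto simp: DirProd_def integer_group_def algebra_simps)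
    ultimately show "lattice_class (x \<otimes>\<^bsub>integer_group \<times>\<times> integer_group\<^esub> y) =
       lattice_class x \<otimes>\<^bsub>base_group\<lparr>carrier := ?N\<rparr>\<^esub> lattice_class y"
      by (simp add: lattice_class_def mult_fundamental_group loop_at_fibre_path l)
  qed (use inN in auto)
  moreover have "bij_betw lattice_class UNIV ?N"
    unfolding bij_betw_def
  proof
    show "inj lattice_class"
    proof (rule injI)
      fix x y assume "lattice_class x = lattice_class y"
      then have "path_homotopic Y (p \<circ> fibre_path (?l x)) (p \<circ> fibre_path (?l y))"
        unfolding lattice_class_def by (simp add: loop_class_eq_iff[OF loop_at_fibre_path[OF l]])
      then have "?l x = ?l y" by (rule fibre_path_inj)
      then show "x = y" by (auto simp: complex_eq_iff prod_eq_iff)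
    qed
    show "range lattice_class = ?N"
    proof
      show "?N \<subseteq> range lattice_class"
      proof
        fix A assume A: "A \<in> ?N"
        then obtain r where r: "loop_at Y base_pt r" "A = loop_class Y base_pt r"
          by (auto simp: kernel_def carrier_fundamental_group)
        have "loop_class (top_of_set punctured_plane) slit_base (proj \<circ> r) = loop_class (top_of_set punctured_plane) slit_base (\<lambda>t. slit_base)"
          using A induced_map_loop_class[OF r(1) proj_cont base_pt_maps(1)] by (simp add: kernel_def r(2) one_fundamental_group)
        then have "path_homotopic (top_of_set punctured_plane) (proj \<circ> r) (\<lambda>t. slit_base)"
          using loop_class_eq_iff[OF loop_at_compose[OF r(1) proj_cont base_pt_maps(1)]] by simp
        from null_proj_imp_fibre_path[OF r(1) this] obtain a where a: "a \<in> gauss_lattice" "path_homotopic Y r (p \<circ> fibre_path a)" by blast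
        then obtain m n where "a = ?l (m, n)" by (auto simp: gauss_lattice_def)
        then have "A = lattice_class (m, n)"
          using a r by (simp add: lattice_class_def loop_class_eq_iff)
        then show "A \<in> range lattice_class" by blast
      qed
    qed (use inN in auto)
  qed
  ultimately show ?thesis by (simp add: iso_def integer_group_def DirProd_def)
qed

text \<open>First inside the fibre to \<open>v = 0\<close>, then along the zero section over a path
  in the plane.\<close>

lemma path_to_base:
  assumes "a \<in> topspace Y" shows "\<exists>g. pathin Y g \<and> g 0 = a \<and> g 1 = base_pt"
proof -
  obtain w v where w: "w \<in> affine_cubic" "a = p (w, v)" using assms surj by force
  let ?f = "\<lambda>t::real. (w, of_real (1 - t) * v)"
  have "pathin (top_of_set (affine_cubic \<times> UNIV)) ?f"
    using w by (auto simp: pathin_canon_iff path_def intro!: continuous_intros)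
  then have 1: "pathin Y (p \<circ> ?f)" using cont unfolding pathin_def by (rule continuous_map_compose)
  let ?g = "zero_section \<circ> loop_reverse (tail_path (fst w))"
  have x: "fst w \<in> punctured_plane" using w(1) by (rule affine_cubic_fst)
  have 2: "pathin Y ?g" using pathin_loop_reverse[OF tail_path(1)[OF x]] zero_section_cont
    unfolding pathin_def by (rule continuous_map_compose)
  show ?thesis
  proof (intro exI conjI)
    show "pathin Y (loop_join (p \<circ> ?f) ?g)"
      using 1 2 by (rule pathin_loop_join) (simp add: tail_path[OF x] zero_section_eq[OF w(1)])
  qed (simp_all add: w tail_path[OF x] base_pt_maps)
qed

theorem is_F3_semidirect_Z2_fundamental_group:
  assumes s: "s \<in> topspace Y" shows "is_F3_semidirect_Z2 (fundamental_group Y s)"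
proof -
  let ?\<sigma> = "induced_map Y base_pt zero_section"
  obtain g where g: "pathin Y g" "g 0 = s" "g 1 = base_pt" using path_to_base[OF s] by blast
  obtain \<phi> where \<phi>: "\<phi> \<in> iso (fundamental_group Y s) base_group"
    using fundamental_group_base_change[OF g] by (rule exE)
  show ?thesis
  proof (rule is_F3_semidirect_Z2_split_iso)
    show "group (fundamental_group Y s)" "group base_group"
      using s base_pt_in by (simp_all add: group_fundamental_group)
    show "\<phi> \<in> iso (fundamental_group Y s) base_group" by fact
    show "group plane_group" by (rule group_plane)
    show "free_of_rank plane_group 3" by (rule plane_group_free)
    show "lattice_class \<in> iso (integer_group \<times>\<times> integer_group) (base_group\<lparr>carrier := kernel base_group plane_group proj_hom\<rparr>)"
      by (rule lattice_class_iso)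
    show "proj_hom \<in> hom base_group plane_group" by (rule induced_map_hom[OF proj_cont base_pt_maps(1)])
    show "?\<sigma> \<in> hom plane_group base_group" by (rule induced_map_hom[OF zero_section_cont base_pt_maps(2)])
    fix A assume "A \<in> carrier plane_group"
    then obtain r where r: "loop_at (top_of_set punctured_plane) slit_base r" "A = plane_class r"
      by (auto simp: carrier_fundamental_group)
    have "proj_hom (?\<sigma> A) = plane_class (proj \<circ> (zero_section \<circ> r))"
      using induced_map_loop_class[OF r(1) zero_section_cont base_pt_maps(2)]
        induced_map_loop_class[OF loop_at_compose[OF r(1) zero_section_cont base_pt_maps(2)] proj_cont base_pt_maps(1)] r(2) by simp
    also have "\<dots> = plane_class r"
    proof (rule loop_class_eqI[OF path_homotopic_sym])
      have "r t \<in> punctured_plane" if "t \<in> {0..1}" for t using r(1) that by (auto simp: loop_at_def pathin_canon_iff)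
      then show "path_homotopic (top_of_set punctured_plane) r (proj \<circ> (zero_section \<circ> r))"
        using r(1) by (intro path_homotopic_eq) (auto simp: loop_at_def proj_zero_section)
    qed (use r(1) slit_base_in in \<open>auto simp: loop_at_def proj_zero_section\<close>)
    finally show "proj_hom (?\<sigma> A) = A" using r(2) by simp
  qed
qed

end

section \<open>The Weierstrass function of the Gaussian lattice\<close>

text \<open>The exponent is chosen so that the product over both coordinates of a lattice point
  \<open>w\<close> bounds \<open>1 / norm w ^ 3\<close>, while a single factor still decays like
  \<open>m powr (-3/2)\<close>.\<close>

lemma summable_on_int_powr: "(\<lambda>m::int. (1 + (of_int m)\<^sup>2) powr (-3/4) :: real) summable_on UNIV"
proof -
  let ?u = "\<lambda>m::int. (1 + (of_int m)\<^sup>2) powr (-3/4) :: real"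
  have nat: "(\<lambda>n::nat. ?u (int n)) summable_on UNIV"
  proof (rule summable_nonneg_imp_summable_on)
    have s: "summable (\<lambda>n::nat. real n powr (-3/2))" by (subst summable_real_powr_iff) simp
    show "summable (\<lambda>n. ?u (int n))"
    proof (rule summable_comparison_test_ev[OF _ s])
      show "\<forall>\<^sub>F n in sequentially. norm (?u (int n)) \<le> real n powr (-3/2)"
      proof (rule eventually_sequentiallyI[of 1])
        fix n :: nat assume n: "1 \<le> n"
        have "(1 + (real n)\<^sup>2) powr (-3/4) \<le> ((real n)\<^sup>2) powr (-3/4)"
          using n by (intro powr_mono2') auto
        also have "\<dots> = real n powr (-3/2)"
          using n by (simp add: powr_powr flip: powr_numeral)
        finally show "norm (?u (int n)) \<le> real n powr (-3/2)" by simp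
      qed
    qed
  qed simp
  have "?u summable_on range int" using nat by (simp add: summable_on_reindex o_def)
  moreover have "?u summable_on (range (\<lambda>n. - int (Suc n)))"
  proof -
    have "?u \<circ> (\<lambda>n. - int (Suc n)) = (\<lambda>n. ?u (int n)) \<circ> Suc"
      by (rule ext) (simp add: power2_eq_square algebra_simps)
    moreover have "((\<lambda>n. ?u (int n)) \<circ> Suc) summable_on UNIV"
      using summable_on_subset_banach[OF nat, of "range Suc"] by (subst summable_on_reindex[symmetric]) auto
    ultimately show ?thesis by (subst summable_on_reindex) (auto simp: inj_on_def)
  qed
  ultimately have "?u summable_on (range int \<union> range (\<lambda>n. - int (Suc n)))"
    by (rule summable_on_Un_disjoint) auto
  moreover have "range int \<union> range (\<lambda>n. - int (Suc n)) = UNIV"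
  proof -
    have "m \<in> range int \<union> range (\<lambda>n. - int (Suc n))" for m
      by (cases m rule: int_cases) auto
    then show ?thesis by blast
  qed
  ultimately show ?thesis by simp
qed

lemma gauss_lattice_range: "gauss_lattice = range (\<lambda>k. of_int (fst k) + \<i> * of_int (snd k))"
  by (simp add: gauss_lattice_def image_def)

text \<open>For the squared coordinates \<open>a\<close>, \<open>b\<close> one has
  \<open>(1 + a) * (1 + b) <= (1 + a + b)^2 <= 4 * N^4\<close>, using \<open>N >= 1\<close>. So the
  summand is at most a constant times a product of functions of one coordinate each, and the double
  sum separates.\<close>

lemma gauss_lattice_summable: "(\<lambda>w. 1 / norm w ^ 3) summable_on (gauss_lattice - {0})"
proof -
  let ?u = "\<lambda>m::int. (1 + (of_int m)\<^sup>2) powr (-3/4) :: real"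
  let ?l = "\<lambda>k :: int \<times> int. of_int (fst k) + \<i> * of_int (snd k) :: complex"
  have inj: "inj ?l" by (auto simp: inj_on_def complex_eq_iff)
  have hs: "(?u has_sum infsum ?u UNIV) UNIV" using summable_on_int_powr by (simp add: has_sum_infsum)
  have "(\<lambda>k. ?u (fst k) * ?u (snd k)) summable_on (Sigma UNIV (\<lambda>_. UNIV))"
  proof (rule summable_on_SigmaI)
    show "((\<lambda>y. ?u (fst (x, y)) * ?u (snd (x, y))) has_sum (?u x * infsum ?u UNIV)) UNIV" for x
      using has_sum_cmult_right[OF hs, of "?u x"] by simp
    show "(\<lambda>x. ?u x * infsum ?u UNIV) summable_on UNIV" by (intro summable_on_cmult_left summable_on_int_powr)
  qed auto
  then have "(\<lambda>k. 4 * (?u (fst k) * ?u (snd k))) summable_on UNIV" by (intro summable_on_cmult_right) simp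
  then have S: "(\<lambda>k. 4 * (?u (fst k) * ?u (snd k))) summable_on (- {(0, 0)})" by (rule summable_on_subset_banach) simp
  have "(\<lambda>k. 1 / norm (?l k) ^ 3) summable_on (- {(0, 0)})"
  proof (rule summable_on_comparison_test[OF S])
    fix k :: "int \<times> int" assume k: "k \<in> - {(0, 0)}"
    obtain m n where mn: "k = (m, n)" by (cases k)
    define a b where "a = (of_int m :: real)\<^sup>2" and "b = (of_int n :: real)\<^sup>2"
    define N where "N = norm (?l k)"
    have N2: "N\<^sup>2 = a + b" by (simp add: N_def mn cmod_power2 a_def b_def)
    have "?l k \<noteq> 0" using k mn by (auto simp: complex_eq_iff)
    then have "N \<ge> 1" unfolding N_def by (intro gauss_lattice_norm) (auto simp: gauss_lattice_range)
    then have N1: "a + b \<ge> 1" using N2 one_le_power[of N 2] by simp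
    have ab: "a \<ge> 0" "b \<ge> 0" by (auto simp: a_def b_def)
    have "(1 + a) * (1 + b) \<le> (1 + a + b)\<^sup>2" using ab by (simp add: power2_eq_square algebra_simps)
    also have "\<dots> \<le> (2 * N\<^sup>2)\<^sup>2" unfolding N2 using ab N1 by (intro power_mono) auto
    finally have le: "(1 + a) * (1 + b) \<le> 4 * N ^ 4" by (simp add: power_mult_distrib)
    have "1 / N ^ 3 = (N ^ 4) powr (-3/4)"
      using \<open>N \<ge> 1\<close> by (simp add: powr_powr powr_minus_divide flip: powr_numeral)
    also have "\<dots> \<le> ((1 + a) * (1 + b) / 4) powr (-3/4)"
      using le ab by (intro powr_mono2') auto
    also have "\<dots> = (1 + a) powr (-3/4) * (1 + b) powr (-3/4) / 4 powr (-3/4)"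
      using ab by (simp add: powr_mult powr_divide)
    also have "\<dots> = 4 powr (3/4) * ((1 + a) powr (-3/4) * (1 + b) powr (-3/4))"
      by (simp add: powr_minus_divide)
    also have "\<dots> \<le> 4 * ((1 + a) powr (-3/4) * (1 + b) powr (-3/4))"
      using powr_mono[of "3/4" 1 "4::real"] by (intro mult_right_mono) auto
    finally show "1 / norm (?l k) ^ 3 \<le> 4 * (?u (fst k) * ?u (snd k))"
      by (simp add: N_def a_def b_def mn)
  qed auto
  moreover have "?l ` (- {(0, 0)}) = gauss_lattice - {0}"
    using image_set_diff[OF inj, of UNIV "{(0,0)}"] by (simp add: gauss_lattice_range Compl_eq_Diff_UNIV)
  ultimately show ?thesis
    using summable_on_reindex[OF inj_on_subset[OF inj], of "- {(0,0)}" "\<lambda>w. 1 / norm w ^ 3"] by (simp add: o_def)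
qed

section \<open>The Weierstrass sum and its regular part at 0\<close>

lemma finite_gauss_lattice_norm_less: "finite {w \<in> gauss_lattice. norm w < r}"
proof (rule finite_subset)
  let ?A = "{- \<lceil>r\<rceil> .. \<lceil>r\<rceil>}"
  show "{w \<in> gauss_lattice. norm w < r} \<subseteq> (\<lambda>(m, n). of_int m + \<i> * of_int n) ` (?A \<times> ?A)"
  proof
    fix w assume "w \<in> {w \<in> gauss_lattice. norm w < r}"
    then obtain m n where mn: "w = of_int m + \<i> * of_int n" "norm w < r" by (auto simp: gauss_lattice_def)
    have "\<bar>of_int m\<bar> < r" "\<bar>of_int n\<bar> < r" using abs_Re_le_cmod[of w] abs_Im_le_cmod[of w] mn by auto
    then have "m \<in> ?A" "n \<in> ?A" by (auto simp: abs_le_iff; linarith)+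
    then show "w \<in> (\<lambda>(m, n). of_int m + \<i> * of_int n) ` (?A \<times> ?A)" using mn by auto
  qed
qed auto

text \<open>The summand of the Weierstrass p-function. Treating the pole at the origin as the term
  \<open>w = 0\<close> makes \<open>wp\<close> a single sum over the lattice, so that negation,
  rotation and translation are plain reindexings.\<close>

definition wp_term :: "complex \<Rightarrow> complex \<Rightarrow> complex" where
  "wp_term z w = (if w = 0 then 1 / z\<^sup>2 else 1 / (z - w)\<^sup>2 - 1 / w\<^sup>2)"

definition wp :: "complex \<Rightarrow> complex" where
  "wp z = (\<Sum>\<^sub>\<infinity>w\<in>gauss_lattice. wp_term z w)"

definition wp_reg :: "complex \<Rightarrow> complex" where
  "wp_reg z = (\<Sum>\<^sub>\<infinity>w\<in>gauss_lattice - {0}. wp_term z w)"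

text \<open>The factor 1/5 fits the radius 4/5 used below: \<open>norm w - 4/5 >= norm w / 5\<close>
  as soon as \<open>norm w >= 1\<close>. The constant is 75 = 3 * 5^2, with 3 coming from
  \<open>norm (2 * w - z) <= 3 * norm w\<close>.\<close>

lemma wp_term_bound:
  assumes "w \<noteq> 0" "norm z \<le> norm w" "norm w / 5 \<le> norm (z - w)"
  shows "norm (wp_term z w) \<le> 75 * norm z * (1 / norm w ^ 3)"
proof -
  have zw: "z - w \<noteq> 0" using assms by auto
  have "wp_term z w = (w\<^sup>2 - (z - w)\<^sup>2) / (w\<^sup>2 * (z - w)\<^sup>2)"
    using assms(1) zw by (simp add: wp_term_def diff_frac_eq mult.commute)
  also have "w\<^sup>2 - (z - w)\<^sup>2 = z * (2 * w - z)" by (simp add: power2_eq_square algebra_simps)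
  finally have "wp_term z w = z * (2 * w - z) / (w\<^sup>2 * (z - w)\<^sup>2)" .
  then have "norm (wp_term z w) = norm z * norm (2 * w - z) / (norm w ^ 2 * norm (z - w) ^ 2)"
    by (simp add: norm_mult norm_divide norm_power)
  also have "\<dots> \<le> norm z * (3 * norm w) / (norm w ^ 2 * (norm w / 5) ^ 2)"
  proof (intro frac_le mult_left_mono mult_nonneg_nonneg power_mono)
    have "norm (2 * w - z) \<le> 2 * norm w + norm z" using norm_triangle_ineq4[of "2 * w" z] by (simp add: norm_mult)
    then show "norm (2 * w - z) \<le> 3 * norm w" using assms(2) by simp
  qed (use assms in auto)
  also have "\<dots> = 75 * norm z * (1 / norm w ^ 3)"
    using assms(1) by (simp add: field_simps power2_eq_square power3_eq_cube)
  finally show ?thesis .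
qed

lemma wp_term_summable: "wp_term z summable_on gauss_lattice"
proof -
  \<comment> \<open>Outside this finite set \<open>norm w\<close> exceeds \<open>2 * norm z\<close>,
    which gives both norm hypotheses of \<open>wp_term_bound\<close>.\<close>
  let ?F = "{w \<in> gauss_lattice. norm w < 2 * norm z + 1}"
  have "(\<lambda>w. 75 * norm z * (1 / norm w ^ 3)) summable_on (gauss_lattice - {0})"
    by (intro summable_on_cmult_right gauss_lattice_summable)
  then have S: "(\<lambda>w. 75 * norm z * (1 / norm w ^ 3)) summable_on (gauss_lattice - ?F)"
  proof (rule summable_on_subset_banach)
    have "0 < 2 * norm z + 1" by (simp add: add_nonneg_pos)
    then show "gauss_lattice - ?F \<subseteq> gauss_lattice - {0}" by auto
  qed
  have "(\<lambda>w. norm (wp_term z w)) summable_on (gauss_lattice - ?F)"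
  proof (rule summable_on_comparison_test[OF S])
    fix w assume w: "w \<in> gauss_lattice - ?F"
    then have nw: "norm w \<ge> 2 * norm z + 1" by auto
    have "norm w - norm z \<le> norm (z - w)" using norm_triangle_ineq2[of w z] by (simp add: norm_minus_commute)
    then show "norm (wp_term z w) \<le> 75 * norm z * (1 / norm w ^ 3)"
    proof (intro wp_term_bound)
      show "norm z \<le> norm w" "norm w / 5 \<le> norm (z - w)"
        using nw norm_ge_zero[of z] \<open>norm w - norm z \<le> norm (z - w)\<close> by linarith+
      show "w \<noteq> 0" using nw norm_ge_zero[of z] by (metis add_nonneg_pos le_less_trans less_irrefl mult_2 norm_zero zero_less_one add_nonneg_nonneg)
    qed
  qed auto
  then have "wp_term z summable_on (gauss_lattice - ?F)" by (rule Infinite_Sum.abs_summable_summable)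
  moreover have "wp_term z summable_on ?F" using finite_gauss_lattice_norm_less by (rule summable_on_finite)
  ultimately have "wp_term z summable_on ((gauss_lattice - ?F) \<union> ?F)" by (rule summable_on_Un_disjoint) auto
  moreover have "(gauss_lattice - ?F) \<union> ?F = gauss_lattice" by auto
  ultimately show ?thesis by simp
qed

lemma wp_eq_reg: "wp z = 1 / z\<^sup>2 + wp_reg z"
proof -
  have "wp z = infsum (wp_term z) ({0} \<union> (gauss_lattice - {0}))"
    unfolding wp_def using gauss_lattice_0 by (simp add: insert_absorb)
  also have "\<dots> = infsum (wp_term z) {0} + wp_reg z"
    unfolding wp_reg_def using summable_on_cofin_subset[OF wp_term_summable, of "{0}"] by (intro infsum_Un_disjoint) auto
  finally show ?thesis by (simp add: wp_term_def)
qed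

lemma wp_reg_0: "wp_reg 0 = 0"
proof -
  have "infsum (wp_term 0) (gauss_lattice - {0}) = infsum (\<lambda>_. 0) (gauss_lattice - {0})"
    by (rule infsum_cong) (auto simp: wp_term_def)
  then show ?thesis by (simp add: wp_reg_def)
qed

text \<open>The radius 4/5 is below 1, the distance from 0 to the other lattice points, and above
  sqrt(1/2), so that discs of this radius about the lattice points cover the plane. The M-test runs
  on the closed disc.\<close>

lemma wp_reg_holomorphic: "wp_reg holomorphic_on ball 0 (4/5)"
proof -
  have "uniform_limit (cball 0 (4/5)) (\<lambda>F z. \<Sum>w\<in>F. wp_term z w) (\<lambda>z. \<Sum>\<^sub>\<infinity>w\<in>gauss_lattice - {0}. wp_term z w)
     (finite_subsets_at_top (gauss_lattice - {0}))"
  proof (rule Weierstrass_m_test_general)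
    show "(\<lambda>w. 75 * (1 / norm w ^ 3)) summable_on (gauss_lattice - {0})"
      by (intro summable_on_cmult_right gauss_lattice_summable)
    fix w z :: complex assume w: "w \<in> gauss_lattice - {0}" and z: "z \<in> cball 0 (4/5)"
    have w1: "norm w \<ge> 1" using w gauss_lattice_norm by auto
    have "norm w - norm z \<le> norm (z - w)" using norm_triangle_ineq2[of w z] by (simp add: norm_minus_commute)
    then have "norm (wp_term z w) \<le> 75 * norm z * (1 / norm w ^ 3)"
      using w w1 z by (intro wp_term_bound) auto
    also have "\<dots> \<le> 75 * 1 * (1 / norm w ^ 3)" using z by (intro mult_right_mono mult_left_mono) auto
    finally show "norm (wp_term z w) \<le> 75 * (1 / norm w ^ 3)" by simp
  qed
  then have ul: "uniform_limit (cball 0 (4/5)) (\<lambda>F z. \<Sum>w\<in>F. wp_term z w) wp_reg (finite_subsets_at_top (gauss_lattice - {0}))"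
    by (simp add: wp_reg_def[abs_def])
  show ?thesis
  proof (rule holomorphic_uniform_limit[OF _ ul])
    have hol: "(\<lambda>z. wp_term z w) holomorphic_on cball 0 (4/5)" if "w \<in> gauss_lattice - {0}" for w
    proof -
      have "norm w \<ge> 1" using that gauss_lattice_norm by auto
      then have "z - w \<noteq> 0" if "z \<in> cball 0 (4/5)" for z using that by auto
      moreover have "(\<lambda>z. wp_term z w) = (\<lambda>z. 1 / (z - w)\<^sup>2 - 1 / w\<^sup>2)" using that by (auto simp: wp_term_def)
      ultimately show ?thesis by (auto intro!: holomorphic_intros)
    qed
    have "(\<lambda>z. \<Sum>w\<in>F. wp_term z w) holomorphic_on cball 0 (4/5)" if "F \<subseteq> gauss_lattice - {0}" for F
      using hol that by (intro holomorphic_intros) auto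
    then show "\<forall>\<^sub>F F in finite_subsets_at_top (gauss_lattice - {0}). continuous_on (cball 0 (4/5)) (\<lambda>z. \<Sum>w\<in>F. wp_term z w) \<and>
       (\<lambda>z. \<Sum>w\<in>F. wp_term z w) holomorphic_on ball 0 (4/5)"
      by (intro eventually_finite_subsets_at_top_weakI)
         (auto intro: holomorphic_on_imp_continuous_on holomorphic_on_subset[OF _ ball_subset_cball])
  qed auto
qed

section \<open>Symmetries of the lattice sum\<close>

lemma wp_uminus: "wp (- z) = wp z"
proof -
  have "wp z = (\<Sum>\<^sub>\<infinity>w\<in>gauss_lattice. wp_term z (- w))"
    unfolding wp_def by (rule infsum_reindex_bij_witness[of _ uminus uminus]) auto
  also have "\<dots> = wp (- z)" unfolding wp_def
    by (rule infsum_cong) (auto simp: wp_term_def power2_eq_square algebra_simps)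
  finally show ?thesis ..
qed

lemma gauss_lattice_mult_i: "\<i> * w \<in> gauss_lattice \<longleftrightarrow> w \<in> gauss_lattice"
proof -
  have *: "\<i> * w \<in> gauss_lattice" if w: "w \<in> gauss_lattice" for w
  proof -
    obtain m n where "w = of_int m + \<i> * of_int n" using w by (auto simp: gauss_lattice_def)
    then have "\<i> * w = of_int (- n) + \<i> * of_int m" by (simp add: algebra_simps)
    then show ?thesis unfolding gauss_lattice_def by blast
  qed
  have "w \<in> gauss_lattice" if "\<i> * w \<in> gauss_lattice"
  proof -
    have "- (\<i> * (\<i> * w)) \<in> gauss_lattice" using *[OF that] by simp
    then show ?thesis by (simp flip: mult.assoc)
  qed
  then show ?thesis using * by blast
qed

text \<open>The lattice is stable under multiplication by \<open>\<i>\<close>, and every term is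
  homogeneous of degree -2 in \<open>(z, w)\<close>, which produces the factor
  \<open>\<i>^-2 = -1\<close>.\<close>

lemma wp_mult_i: "wp (\<i> * z) = - wp z"
proof -
  have "wp (\<i> * z) = (\<Sum>\<^sub>\<infinity>w\<in>gauss_lattice. wp_term (\<i> * z) (\<i> * w))"
    unfolding wp_def by (rule infsum_reindex_bij_witness[of _ "\<lambda>w. \<i> * w" "\<lambda>w. - (\<i> * w)"])
      (auto simp: gauss_lattice_mult_i simp flip: mult.assoc)
  also have "\<dots> = (\<Sum>\<^sub>\<infinity>w\<in>gauss_lattice. - wp_term z w)"
  proof (rule infsum_cong)
    fix w
    have "(\<i> * z - \<i> * w)\<^sup>2 = - (z - w)\<^sup>2" by (simp add: power_mult_distrib flip: right_diff_distrib)
    then show "wp_term (\<i> * z) (\<i> * w) = - wp_term z w" by (simp add: wp_term_def power_mult_distrib)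
  qed
  also have "\<dots> = - wp z" by (simp add: infsum_uminus wp_def)
  finally show ?thesis .
qed

text \<open>Shifting the lattice sum changes \<open>wp\<close> by a constant, which vanishes because \<open>wp\<close> is even.\<close>

lemma wp_periodic:
  assumes l: "l \<in> gauss_lattice" shows "wp (z + l) = wp z"
proof -
  define C where "C = (\<Sum>\<^sub>\<infinity>w\<in>gauss_lattice. (if w = 0 then 0 else 1 / w\<^sup>2) - (if w + l = 0 then 0 else 1 / (w + l)\<^sup>2))"
  have shift: "wp (z + l) = wp z + C" for z
  proof -
    have bij: "bij_betw (\<lambda>w. w + l) gauss_lattice gauss_lattice"
      by (rule bij_betw_byWitness[where f'="\<lambda>w. w - l"]) (use l gauss_lattice_add gauss_lattice_diff in auto)
    have s: "(\<lambda>w. wp_term (z + l) (w + l)) summable_on gauss_lattice"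
      using wp_term_summable[of "z + l"] summable_on_reindex_bij_betw[OF bij, of "wp_term (z + l)"] by simp
    have "wp (z + l) = (\<Sum>\<^sub>\<infinity>w\<in>gauss_lattice. wp_term (z + l) (w + l))"
      unfolding wp_def using infsum_reindex_bij_betw[OF bij, of "wp_term (z + l)"] by simp
    then have "wp (z + l) - wp z = (\<Sum>\<^sub>\<infinity>w\<in>gauss_lattice. wp_term (z + l) (w + l) - wp_term z w)"
      using infsum_add[OF s summable_on_uminus[THEN iffD2, OF wp_term_summable[of z]]] by (simp add: wp_def infsum_uminus)
    also have "\<dots> = C" unfolding C_def
      by (rule infsum_cong) (auto simp: wp_term_def add_eq_0_iff)
    finally show ?thesis by (simp add: algebra_simps)
  qed
  have "wp (- z) = wp (- (z + l)) + C" using shift[of "- (z + l)"] by simp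
  then have "wp z = wp (z + l) + C" by (simp only: wp_uminus)
  then have "wp (z + l) + C - wp z = 0" by simp
  then have "C = 0" unfolding shift[of z] by simp
  then show ?thesis using shift by simp
qed

section \<open>Expansion at the lattice points and a Liouville argument\<close>

lemma holomorphic_divide_zero:
  assumes "f holomorphic_on ball 0 r" "r > 0" "f 0 = 0"
  obtains g where "g holomorphic_on ball 0 r" "\<And>z. z \<in> ball 0 r \<Longrightarrow> f z = z * g z"
proof
  show "(\<lambda>z. if z = 0 then deriv f 0 else (f z - f 0) / (z - 0)) holomorphic_on ball 0 r"
    using assms by (intro pole_lemma) auto
qed (use assms in auto)

lemma isCont_holomorphic_ball:
  assumes "f holomorphic_on ball 0 r" "r > 0" shows "isCont f 0"
  using continuous_on_interior[OF holomorphic_on_imp_continuous_on[OF assms(1)], of 0] assms(2) by simp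

lemma eventually_punctured_ball: "r > 0 \<Longrightarrow> \<forall>\<^sub>F z in at (0::complex). z \<in> ball 0 r - {0}"
  unfolding eventually_at by (intro exI[of _ r]) (auto simp: dist_commute)

text \<open>By continuity the relation extends to 0, where it reads \<open>g 0 = k * g 0\<close>. It
  is assumed off 0 only, since it will be derived by cancelling powers of \<open>z\<close>.\<close>

lemma rotation_symmetric_zero:
  assumes g: "g holomorphic_on ball 0 r" "r > 0" and sym: "\<And>z. z \<in> ball 0 r \<Longrightarrow> z \<noteq> 0 \<Longrightarrow> g (\<i> * z) = k * g z"
    and "k \<noteq> 1"
  shows "g 0 = 0"
proof -
  have cont: "isCont g 0" using g by (rule isCont_holomorphic_ball)
  then have "isCont (\<lambda>z. g (\<i> * z) - k * g z) 0"
    by (intro continuous_intros isCont_o2[of 0 "\<lambda>z. \<i> * z" g]) auto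
  then have "((\<lambda>z. g (\<i> * z) - k * g z) \<longlongrightarrow> g 0 - k * g 0) (at 0)" by (simp add: isCont_def)
  moreover have "\<forall>\<^sub>F z in at 0. g (\<i> * z) - k * g z = 0"
    unfolding eventually_at using g(2) sym by (intro exI[of _ r]) auto
  then have "((\<lambda>z. g (\<i> * z) - k * g z) \<longlongrightarrow> 0) (at 0)" by (rule tendsto_eventually)
  ultimately have "g 0 - k * g 0 = 0" using tendsto_unique[OF at_neq_bot] by blast
  then have "(1 - k) * g 0 = 0" by (simp add: algebra_simps)
  then show ?thesis using assms(4) by simp
qed

lemma wp_reg_mult_i: "wp_reg (\<i> * z) = - wp_reg z"
  using wp_mult_i[of z] unfolding wp_eq_reg by (simp add: power_mult_distrib)

text \<open>Rotation by \<open>\<i>\<close> only leaves the exponents 2, 6, 10, \<dots> in the expansion of \<open>wp_reg\<close>;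
  this is what makes the cubic equation below free of a constant term.\<close>

lemma wp_reg_expansion:
  obtains c n where "n holomorphic_on ball 0 (4/5)" "n 0 = 0"
    "\<And>z. z \<in> ball 0 (4/5) \<Longrightarrow> wp_reg z = c * z\<^sup>2 + z ^ 4 * n z"
proof -
  let ?B = "ball (0::complex) (4/5)"
  have r: "(4/5::real) > 0" by simp
  have iB: "\<i> * z \<in> ?B" if "z \<in> ?B" for z using that by (simp add: norm_mult)
  \<comment> \<open>Factors \<open>z\<close> are split off one at a time. Under
    \<open>z -> \<i> * z\<close> the successive functions \<open>g\<close>, \<open>m\<close>,
    \<open>p\<close>, \<open>n\<close> are multiplied by \<open>\<i>\<close>, 1,
    \<open>- \<i>\<close>, -1, so of their values at 0 only that of \<open>m\<close> can be
    nonzero.\<close>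
  obtain g where g: "g holomorphic_on ?B" "\<And>z. z \<in> ?B \<Longrightarrow> wp_reg z = z * g z"
    by (rule holomorphic_divide_zero[OF wp_reg_holomorphic r wp_reg_0]) blast
  have "g (\<i> * z) = \<i> * g z" if "z \<in> ?B" "z \<noteq> 0" for z
  proof -
    have "\<i> * z * g (\<i> * z) = - (z * g z)" using wp_reg_mult_i[of z] g(2)[OF that(1)] g(2)[OF iB[OF that(1)]] by simp
    then have "z * (\<i> * g (\<i> * z)) = z * (- g z)" by (simp add: mult_ac)
    then have "\<i> * g (\<i> * z) = - g z" using that(2) by (simp only: mult_cancel_left) simp
    then have "\<i> * (\<i> * g (\<i> * z)) = \<i> * - g z" by simp
    then show ?thesis by (simp flip: mult.assoc)
  qed
  from rotation_symmetric_zero[OF g(1) r this] have "g 0 = 0" by (simp add: complex_eq_iff)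
  then obtain m where m: "m holomorphic_on ?B" "\<And>z. z \<in> ?B \<Longrightarrow> g z = z * m z"
    by (rule holomorphic_divide_zero[OF g(1) r]) blast
  have reg_m: "wp_reg z = z\<^sup>2 * m z" if "z \<in> ?B" for z using g(2) m(2) that by (simp add: power2_eq_square)
  have m_sym: "m (\<i> * z) = m z" if "z \<in> ?B" "z \<noteq> 0" for z
    using wp_reg_mult_i[of z] reg_m[OF that(1)] reg_m[OF iB[OF that(1)]] that(2) by (simp add: power_mult_distrib)
  define c where "c = m 0"
  obtain p where p: "p holomorphic_on ?B" "\<And>z. z \<in> ?B \<Longrightarrow> m z - c = z * p z"
  proof (rule holomorphic_divide_zero[of "\<lambda>z. m z - c", OF _ r])
    show "(\<lambda>z. m z - c) holomorphic_on ?B" by (intro holomorphic_intros m)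
  qed (auto simp: c_def)
  have p_sym: "\<i> * p (\<i> * z) = p z" if "z \<in> ?B" "z \<noteq> 0" for z
  proof -
    have "\<i> * z * p (\<i> * z) = z * p z"
      using p(2)[OF that(1)] p(2)[OF iB[OF that(1)]] m_sym[OF that] by metis
    then have "z * (\<i> * p (\<i> * z)) = z * p z" by (simp add: mult_ac)
    then show ?thesis using that(2) by (simp only: mult_cancel_left) simp
  qed
  have "p (\<i> * z) = - \<i> * p z" if "z \<in> ?B" "z \<noteq> 0" for z
    unfolding p_sym[OF that, symmetric] by (simp flip: mult.assoc)
  from rotation_symmetric_zero[OF p(1) r this] have "p 0 = 0" by (simp add: complex_eq_iff)
  then obtain n where n: "n holomorphic_on ?B" "\<And>z. z \<in> ?B \<Longrightarrow> p z = z * n z"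
    by (rule holomorphic_divide_zero[OF p(1) r]) blast
  have "n (\<i> * z) = - 1 * n z" if "z \<in> ?B" "z \<noteq> 0" for z
  proof -
    have "\<i> * (\<i> * z * n (\<i> * z)) = z * n z" using p_sym[OF that] n(2)[OF that(1)] n(2)[OF iB[OF that(1)]] by simp
    then have "- (z * n (\<i> * z)) = z * n z" by (simp flip: mult.assoc)
    then have "z * (- n (\<i> * z)) = z * n z" by simp
    then have "- n (\<i> * z) = n z" using that(2) by (simp only: mult_cancel_left) simp
    then show ?thesis by (simp add: minus_equation_iff)
  qed
  from rotation_symmetric_zero[OF n(1) r this] have "n 0 = 0" by simp
  moreover have "wp_reg z = c * z\<^sup>2 + z ^ 4 * n z" if "z \<in> ?B" for z
  proof -
    have "m z = c + z * (z * n z)" using p(2)[OF that] n(2)[OF that] by (simp add: algebra_simps)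
    then show ?thesis using reg_m[OF that] by (simp add: algebra_simps power2_eq_square power4_eq_xxxx)
  qed
  ultimately show thesis using that n(1) by blast
qed

text \<open>Rounding both coordinates leaves a distance of at most sqrt(1/2); 3/4 is a rational
  number between this and the radius 4/5.\<close>

lemma near_gauss_lattice: "\<exists>l\<in>gauss_lattice. norm (z - l) \<le> 3/4"
proof
  let ?l = "of_int (round (Re z)) + \<i> * of_int (round (Im z))"
  show "?l \<in> gauss_lattice" by (auto simp: gauss_lattice_def)
  have "\<bar>Re (z - ?l)\<bar> \<le> 1/2" "\<bar>Im (z - ?l)\<bar> \<le> 1/2"
    using of_int_round_abs_le[of "Re z"] of_int_round_abs_le[of "Im z"] by (simp_all add: abs_minus_commute)
  then have "(Re (z - ?l))\<^sup>2 \<le> (1/2)\<^sup>2" "(Im (z - ?l))\<^sup>2 \<le> (1/2)\<^sup>2"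
    using abs_le_square_iff[of "Re (z - ?l)" "1/2"] abs_le_square_iff[of "Im (z - ?l)" "1/2"] by simp_all
  then have "(norm (z - ?l))\<^sup>2 \<le> (3/4)\<^sup>2" unfolding cmod_power2 by (simp add: power2_eq_square)
  then show "norm (z - ?l) \<le> 3/4" by (rule power2_le_imp_le) simp
qed

lemma ball_gauss_lattice: "l \<in> gauss_lattice \<Longrightarrow> z \<in> ball l (4/5) \<Longrightarrow> z \<in> gauss_lattice \<Longrightarrow> z = l"
  using gauss_lattice_norm[of "z - l"] gauss_lattice_diff[of z l] by (auto simp: dist_norm norm_minus_commute)

text \<open>Using the same local form \<open>\<Phi>\<close> at every lattice point encodes both
  periodicity and removability of the singularities. Extended by 0 over the lattice,
  \<open>F\<close> is entire, and bounded since its values are taken by \<open>\<Phi>\<close> on a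
  compact disc; so it is constant, equal to \<open>\<Phi> 0\<close>.\<close>

lemma lattice_liouville:
  assumes hol: "\<Phi> holomorphic_on ball 0 (4/5)" and "\<Phi> 0 = 0"
    and F: "\<And>l z. l \<in> gauss_lattice \<Longrightarrow> z \<in> ball l (4/5) \<Longrightarrow> z \<noteq> l \<Longrightarrow> F z = \<Phi> (z - l)"
    and z: "z \<notin> gauss_lattice"
  shows "F z = 0"
proof -
  define G where "G z = (if z \<in> gauss_lattice then 0 else F z)" for z
  have G: "G z = \<Phi> (z - l)" if "l \<in> gauss_lattice" "z \<in> ball l (4/5)" for l z
  proof (cases "z = l")
    case False
    then have "z \<notin> gauss_lattice" using ball_gauss_lattice[OF that] by blast
    then show ?thesis using F[OF that False] by (simp add: G_def)
  qed (use that assms(2) in \<open>simp add: G_def\<close>)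
  have "G field_differentiable at z" for z
  proof -
    obtain l where l: "l \<in> gauss_lattice" "norm (z - l) \<le> 3/4" using near_gauss_lattice by blast
    have "\<Phi> \<circ> (\<lambda>z. z - l) holomorphic_on ball l (4/5)"
      by (rule holomorphic_on_compose_gen[OF _ hol])
         (auto intro!: holomorphic_intros simp: dist_norm norm_minus_commute)
    then have "(\<lambda>z. \<Phi> (z - l)) holomorphic_on ball l (4/5)" by (simp add: o_def)
    then have "G holomorphic_on ball l (4/5)"
      by (rule holomorphic_transform) (use G l in auto)
    then show ?thesis using l by (auto simp: holomorphic_on_open dist_norm norm_minus_commute field_differentiable_def)
  qed
  then have "G holomorphic_on UNIV" by (simp add: holomorphic_on_def)
  moreover have "bounded (range G)"
  proof (rule bounded_subset)
    have "continuous_on (cball 0 (3/4)) \<Phi>"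
      by (rule continuous_on_subset[OF holomorphic_on_imp_continuous_on[OF hol]]) auto
    then show "bounded (\<Phi> ` cball 0 (3/4))" by (intro compact_imp_bounded compact_continuous_image) auto
    show "range G \<subseteq> \<Phi> ` cball 0 (3/4)"
    proof safe
      fix z obtain l where l: "l \<in> gauss_lattice" "norm (z - l) \<le> 3/4" using near_gauss_lattice by blast
      then show "G z \<in> \<Phi> ` cball 0 (3/4)" using G[of l z] by (auto simp: dist_norm norm_minus_commute)
    qed
  qed
  ultimately obtain c where "\<And>z. G z = c" using Liouville_theorem[of G] unfolding constant_on_def by auto
  moreover have "G 0 = 0" using gauss_lattice_0 by (simp add: G_def)
  ultimately have "G z = 0" by metis
  then show ?thesis using z by (simp add: G_def)
qed

lemma wp_near:
  assumes "l \<in> gauss_lattice" shows "wp z = 1 / (z - l)\<^sup>2 + wp_reg (z - l)"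
  using wp_periodic[OF assms, of "z - l"] wp_eq_reg[of "z - l"] by simp

text \<open>Multiplied by \<open>z^2\<close>, the second summand tends to 0, whereas it would have
  to equal -1 near 0.\<close>

lemma wp_not_locally_zero:
  assumes "isCont h 0" "\<forall>\<^sub>F z in at (0::complex). 1 / z\<^sup>2 + h z = 0" shows False
proof -
  have "isCont (\<lambda>z. z\<^sup>2 * h z) 0" using assms(1) by (intro continuous_intros)
  then have "((\<lambda>z. z\<^sup>2 * h z) \<longlongrightarrow> 0) (at 0)" by (simp add: isCont_def)
  moreover have "\<forall>\<^sub>F z in at 0. z\<^sup>2 * h z = - 1"
    using assms(2) eventually_punctured_ball[OF zero_less_one]
  proof eventually_elim
    case (elim z)
    then have z: "z \<noteq> 0" and h: "h z = - (1 / z\<^sup>2)" by (auto simp: eq_neg_iff_add_eq_0 add.commute)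
    show ?case unfolding h using z by simp
  qed
  then have "((\<lambda>z. z\<^sup>2 * h z) \<longlongrightarrow> - 1) (at 0)" by (rule tendsto_eventually)
  ultimately show False using tendsto_unique[OF at_neq_bot] by fastforce
qed

lemma isCont_wp_reg_0: "isCont wp_reg 0"
  using wp_reg_holomorphic by (rule isCont_holomorphic_ball) simp

text \<open>If the value \<open>x\<close> were omitted, \<open>1 / (wp z - x)\<close> would have no
  pole and would tend to 0 at the lattice points, where \<open>wp\<close> has poles. By
  \<open>lattice_liouville\<close> it would vanish identically.\<close>

lemma wp_surj: "\<exists>z. z \<notin> gauss_lattice \<and> wp z = x"
proof (rule ccontr)
  assume none: "\<not> (\<exists>z. z \<notin> gauss_lattice \<and> wp z = x)"
  \<comment> \<open>This is \<open>z^2 * (wp z - x)\<close> continued to the origin with value 1, so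
    \<open>z^2 / D z\<close> is the local form of the reciprocal.\<close>
  define D where "D z = 1 + z\<^sup>2 * (wp_reg z - x)" for z
  have Dwp: "D (z - l) = (z - l)\<^sup>2 * (wp z - x)" if "l \<in> gauss_lattice" "z \<noteq> l" for l z
    using that by (simp add: D_def wp_near[OF that(1)] field_simps)
  have D0: "D z \<noteq> 0" if "z \<in> ball 0 (4/5)" for z
  proof (cases "z = 0")
    case False
    then have "z \<notin> gauss_lattice" using ball_gauss_lattice[OF gauss_lattice_0 that] by auto
    then have "wp z \<noteq> x" using none by auto
    then show ?thesis using Dwp[OF gauss_lattice_0 False] False by simp
  qed (simp add: D_def)
  have F: "1 / (wp z - x) = 0" if z: "z \<notin> gauss_lattice" for z
  proof (rule lattice_liouville[of "\<lambda>z. z\<^sup>2 / D z" "\<lambda>z. 1 / (wp z - x)", OF _ _ _ z])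
    show "(\<lambda>z. z\<^sup>2 / D z) holomorphic_on ball 0 (4/5)"
      using D0 unfolding D_def by (intro holomorphic_intros wp_reg_holomorphic) auto
    show "1 / (wp z - x) = (z - l)\<^sup>2 / D (z - l)" if "l \<in> gauss_lattice" "z \<in> ball l (4/5)" "z \<noteq> l" for l z
      using Dwp[OF that(1,3)] that by simp
  qed simp
  have "1/2 \<notin> gauss_lattice" using gauss_lattice_norm[of "1/2"] by auto
  then show False using F none by fastforce
qed

section \<open>Differential equations and injectivity modulo the lattice\<close>

lemma closed_gauss_lattice: "closed gauss_lattice"
proof -
  have "\<exists>e>0. \<forall>x\<in>gauss_lattice. \<forall>y\<in>gauss_lattice. dist y x < e \<longrightarrow> y = x"
    using gauss_lattice_norm gauss_lattice_diff by (intro exI[of _ 1]) (force simp: dist_norm)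
  then show ?thesis using discrete_imp_closed by blast
qed

lemma countable_gauss_lattice: "countable gauss_lattice"
  unfolding gauss_lattice_range by simp

text \<open>All Taylor coefficients of a solution of a linear second order equation vanish
  with its initial values.\<close>

lemma second_order_unique:
  assumes d: "d holomorphic_on S" and k: "k holomorphic_on S" and S: "open S" "connected S" and u: "u \<in> S"
    and ode: "\<And>z. z \<in> S \<Longrightarrow> deriv (deriv d) z = k z * d z" and init: "d u = 0" "deriv d u = 0" and w: "w \<in> S"
  shows "d w = 0"
proof (rule holomorphic_fun_eq_0_on_connected[OF d S _ u w])
  have "(deriv ^^ n) d u = 0" for n
  proof (induction n rule: less_induct)
    case (less n)
    consider "n = 0" | "n = 1" | m where "n = Suc (Suc m)" by (metis One_nat_def not0_implies_Suc)
    then show ?case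
    proof cases
      case 3
      have "(deriv ^^ n) d u = (deriv ^^ m) (deriv (deriv d)) u" by (simp only: 3 funpow_Suc_right o_def)
      also have "\<dots> = (deriv ^^ m) (\<lambda>z. k z * d z) u"
        by (rule higher_deriv_transform_within_open[OF _ _ S(1) u])
           (use ode d k S in \<open>auto intro!: holomorphic_intros holomorphic_deriv\<close>)
      also have "\<dots> = (\<Sum>i = 0..m. of_nat (m choose i) * (deriv ^^ i) k u * (deriv ^^ (m - i)) d u)"
        by (rule higher_deriv_mult[OF k d S(1) u])
      also have "\<dots> = 0" using less 3 by (intro sum.neutral) auto
      finally show ?thesis .
    qed (use init in auto)
  qed
  then show "\<And>n. (deriv ^^ n) d u = 0" .
qed

lemma has_field_derivative_inverse_powers:
  fixes z :: complex
  assumes "z \<noteq> l"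
  shows "((\<lambda>z. 1 / (z - l)\<^sup>2) has_field_derivative - 2 / (z - l) ^ 3) (at z)"
    and "((\<lambda>z. - 2 / (z - l) ^ 3) has_field_derivative 6 / (z - l) ^ 4) (at z)"
proof -
  have x: "z - l \<noteq> 0" using assms by simp
  have "((\<lambda>z. 1 / z\<^sup>2) has_field_derivative - 2 / x ^ 3) (at x)" if "x \<noteq> 0" for x :: complex
    using that by (auto intro!: derivative_eq_intros simp: field_simps power2_eq_square power3_eq_cube)
  from this[OF x] show "((\<lambda>z. 1 / (z - l)\<^sup>2) has_field_derivative - 2 / (z - l) ^ 3) (at z)"
    using DERIV_shift[of "\<lambda>z. 1 / z\<^sup>2" "- 2 / (z - l) ^ 3" z "- l"] by simp
  have "((\<lambda>z. - 2 / z ^ 3) has_field_derivative 6 / x ^ 4) (at x)" if "x \<noteq> 0" for x :: complex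
    using that by (auto intro!: derivative_eq_intros simp: field_simps power2_eq_square power3_eq_cube power4_eq_xxxx)
  from this[OF x] show "((\<lambda>z. - 2 / (z - l) ^ 3) has_field_derivative 6 / (z - l) ^ 4) (at z)"
    using DERIV_shift[of "\<lambda>z. - 2 / z ^ 3" "6 / (z - l) ^ 4" z "- l"] by simp
qed

text \<open>Both derivatives are written as an explicit pole plus a remainder, so that in
  \<open>wp_ode\<close> the poles cancel by algebra. The same \<open>c\<close> and \<open>n\<close>
  serve at every \<open>l\<close> by periodicity.\<close>

lemma wp_derivs:
  assumes n: "n holomorphic_on ball 0 (4/5)" and reg: "\<And>z. z \<in> ball 0 (4/5) \<Longrightarrow> wp_reg z = c * z\<^sup>2 + z ^ 4 * n z"
    and l: "l \<in> gauss_lattice" and z: "z \<in> ball l (4/5)" "z \<noteq> l"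
  shows "(wp has_field_derivative (- 2 / (z - l) ^ 3 + (2 * c * (z - l) + 4 * (z - l) ^ 3 * n (z - l) + (z - l) ^ 4 * deriv n (z - l)))) (at z)"
    and "(deriv wp has_field_derivative (6 / (z - l) ^ 4 + (2 * c + 12 * (z - l)\<^sup>2 * n (z - l) + 8 * (z - l) ^ 3 * deriv n (z - l)
       + (z - l) ^ 4 * deriv (deriv n) (z - l)))) (at z)"
proof -
  have zl: "z - l \<in> ball 0 (4/5)" if "z \<in> ball l (4/5)" for z using that by (simp add: dist_norm norm_minus_commute)
  have dn: "((\<lambda>z. n (z - l)) has_field_derivative deriv n (z - l)) (at z)" if "z \<in> ball l (4/5)" for z
    using DERIV_shift[of n "deriv n (z - l)" z "- l"] holomorphic_derivI[OF n open_ball zl[OF that], of UNIV] by simp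
  have dn': "((\<lambda>z. deriv n (z - l)) has_field_derivative deriv (deriv n) (z - l)) (at z)" if "z \<in> ball l (4/5)" for z
    using DERIV_shift[of "deriv n" "deriv (deriv n) (z - l)" z "- l"]
      holomorphic_derivI[OF holomorphic_deriv[OF n open_ball] open_ball zl[OF that], of UNIV] by simp
  let ?U = "ball l (4/5) - {l}"
  have opU: "open ?U" by (rule open_delete) simp
  have 1: "(wp has_field_derivative (- 2 / (z - l) ^ 3 + (2 * c * (z - l) + 4 * (z - l) ^ 3 * n (z - l) + (z - l) ^ 4 * deriv n (z - l)))) (at z)"
    if z: "z \<in> ?U" for z
  proof (rule has_field_derivative_transform_within_open[OF _ opU z])
    have "((\<lambda>z. 1 / (z - l)\<^sup>2) has_field_derivative - 2 / (z - l) ^ 3) (at z)"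
      using z by (intro has_field_derivative_inverse_powers) auto
    moreover have "((\<lambda>z. c * (z - l)\<^sup>2 + (z - l) ^ 4 * n (z - l)) has_field_derivative
       (2 * c * (z - l) + 4 * (z - l) ^ 3 * n (z - l) + (z - l) ^ 4 * deriv n (z - l))) (at z)"
      using z by (auto intro!: derivative_eq_intros dn)
    ultimately show "((\<lambda>z. 1 / (z - l)\<^sup>2 + (c * (z - l)\<^sup>2 + (z - l) ^ 4 * n (z - l))) has_field_derivative
      (- 2 / (z - l) ^ 3 + (2 * c * (z - l) + 4 * (z - l) ^ 3 * n (z - l) + (z - l) ^ 4 * deriv n (z - l)))) (at z)"
      by (rule DERIV_add)
    show "1 / (z - l)\<^sup>2 + (c * (z - l)\<^sup>2 + (z - l) ^ 4 * n (z - l)) = wp z" if "z \<in> ?U" for z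
      using wp_near[OF l, of z] reg[OF zl[of z]] that by simp
  qed
  have 2: "(deriv wp has_field_derivative (6 / (z - l) ^ 4 + (2 * c + 12 * (z - l)\<^sup>2 * n (z - l) + 8 * (z - l) ^ 3 * deriv n (z - l)
       + (z - l) ^ 4 * deriv (deriv n) (z - l)))) (at z)"
    if z: "z \<in> ?U" for z
  proof (rule has_field_derivative_transform_within_open[OF _ opU z])
    have "((\<lambda>z. - 2 / (z - l) ^ 3) has_field_derivative 6 / (z - l) ^ 4) (at z)"
      using z by (intro has_field_derivative_inverse_powers) auto
    moreover have "((\<lambda>z. 2 * c * (z - l) + 4 * (z - l) ^ 3 * n (z - l) + (z - l) ^ 4 * deriv n (z - l)) has_field_derivative
       (2 * c + 12 * (z - l)\<^sup>2 * n (z - l) + 8 * (z - l) ^ 3 * deriv n (z - l) + (z - l) ^ 4 * deriv (deriv n) (z - l))) (at z)"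
      using z by (auto intro!: derivative_eq_intros dn dn' simp: algebra_simps)
    ultimately show "((\<lambda>z. - 2 / (z - l) ^ 3 + (2 * c * (z - l) + 4 * (z - l) ^ 3 * n (z - l) + (z - l) ^ 4 * deriv n (z - l))) has_field_derivative
      (6 / (z - l) ^ 4 + (2 * c + 12 * (z - l)\<^sup>2 * n (z - l) + 8 * (z - l) ^ 3 * deriv n (z - l)
       + (z - l) ^ 4 * deriv (deriv n) (z - l)))) (at z)"
      by (rule DERIV_add)
    show "- 2 / (z - l) ^ 3 + (2 * c * (z - l) + 4 * (z - l) ^ 3 * n (z - l) + (z - l) ^ 4 * deriv n (z - l)) = deriv wp z" if "z \<in> ?U" for z
      using DERIV_imp_deriv[OF 1[OF that]] by simp
  qed
  show "(wp has_field_derivative (- 2 / (z - l) ^ 3 + (2 * c * (z - l) + 4 * (z - l) ^ 3 * n (z - l) + (z - l) ^ 4 * deriv n (z - l)))) (at z)"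
    "(deriv wp has_field_derivative (6 / (z - l) ^ 4 + (2 * c + 12 * (z - l)\<^sup>2 * n (z - l) + 8 * (z - l) ^ 3 * deriv n (z - l)
       + (z - l) ^ 4 * deriv (deriv n) (z - l)))) (at z)"
    using 1 2 z by auto
qed

text \<open>Every point is within 3/4 of a lattice point, inside the disc where the expansion holds;
  uniform convergence of the series is thus only used near 0.\<close>

lemma wp_holomorphic: "wp holomorphic_on - gauss_lattice"
proof -
  obtain c n where n: "n holomorphic_on ball 0 (4/5)" "\<And>z. z \<in> ball 0 (4/5) \<Longrightarrow> wp_reg z = c * z\<^sup>2 + z ^ 4 * n z"
    using wp_reg_expansion by metis
  have "wp field_differentiable at z" if z: "z \<notin> gauss_lattice" for z
  proof -
    obtain l where l: "l \<in> gauss_lattice" "norm (z - l) \<le> 3/4" using near_gauss_lattice by blast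
    have "(wp has_field_derivative (- 2 / (z - l) ^ 3 + (2 * c * (z - l) + 4 * (z - l) ^ 3 * n (z - l) + (z - l) ^ 4 * deriv n (z - l)))) (at z)"
      by (rule wp_derivs(1)[OF n l(1)]) (use l z in \<open>auto simp: dist_norm norm_minus_commute\<close>)
    then show ?thesis by (auto simp: field_differentiable_def)
  qed
  then show ?thesis by (auto simp: holomorphic_on_def intro: field_differentiable_at_within)
qed

text \<open>The classical equations with \<open>g2 = 20 * c\<close> and
  \<open>g3 = 28 * n 0 = 0\<close>, where \<open>c\<close> is the coefficient of \<open>z^2\<close>.
  Each combination of derivatives has a pole-free local form vanishing at the lattice points, so
  \<open>lattice_liouville\<close> applies.\<close>

lemma wp_ode:
  obtains c where "\<And>z. z \<notin> gauss_lattice \<Longrightarrow> (deriv wp z)\<^sup>2 = 4 * wp z ^ 3 - 20 * c * wp z"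
    "\<And>z. z \<notin> gauss_lattice \<Longrightarrow> deriv (deriv wp) z = 6 * (wp z)\<^sup>2 - 10 * c"
proof -
  obtain c n where n: "n holomorphic_on ball 0 (4/5)" "n 0 = 0" and reg: "\<And>z. z \<in> ball 0 (4/5) \<Longrightarrow> wp_reg z = c * z\<^sup>2 + z ^ 4 * n z"
    using wp_reg_expansion by metis
  have n': "deriv n holomorphic_on ball 0 (4/5)" "deriv (deriv n) holomorphic_on ball 0 (4/5)"
    using n by (auto intro!: holomorphic_deriv)
  define R where "R z = c * z\<^sup>2 + z ^ 4 * n z" for z
  define q where "q z = 2 * c * z + 4 * z ^ 3 * n z + z ^ 4 * deriv n z" for z
  have zl: "z - l \<in> ball 0 (4/5)" if "z \<in> ball l (4/5)" for z l :: complex using that by (simp add: dist_norm norm_minus_commute)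
  have wp: "wp z = 1 / (z - l)\<^sup>2 + R (z - l)" "deriv wp z = - 2 / (z - l) ^ 3 + q (z - l)"
    "deriv (deriv wp) z = 6 / (z - l) ^ 4 + (2 * c + 12 * (z - l)\<^sup>2 * n (z - l) + 8 * (z - l) ^ 3 * deriv n (z - l)
       + (z - l) ^ 4 * deriv (deriv n) (z - l))"
    if "l \<in> gauss_lattice" "z \<in> ball l (4/5)" "z \<noteq> l" for l z
    using wp_near[OF that(1), of z] reg[OF zl[OF that(2)]] DERIV_imp_deriv[OF wp_derivs(1)[OF n(1) reg that]]
      DERIV_imp_deriv[OF wp_derivs(2)[OF n(1) reg that]] by (auto simp: R_def q_def)
  have "(deriv wp z)\<^sup>2 - 4 * wp z ^ 3 + 20 * c * wp z = 0" if z: "z \<notin> gauss_lattice" for z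
  proof (rule lattice_liouville[of "\<lambda>z. - 28 * n z - 4 * z * deriv n z + (q z)\<^sup>2 - 12 * (c * z + z ^ 3 * n z)\<^sup>2 - 4 * R z ^ 3 + 20 * c * R z"
       "\<lambda>z. (deriv wp z)\<^sup>2 - 4 * wp z ^ 3 + 20 * c * wp z", OF _ _ _ z])
    show "(\<lambda>z. - 28 * n z - 4 * z * deriv n z + (q z)\<^sup>2 - 12 * (c * z + z ^ 3 * n z)\<^sup>2 - 4 * R z ^ 3 + 20 * c * R z) holomorphic_on ball 0 (4/5)"
      unfolding R_def q_def by (intro holomorphic_intros n n')
    fix l z assume lz: "l \<in> gauss_lattice" "z \<in> ball l (4/5)" "z \<noteq> l"
    have alg: "(- 2 / x ^ 3 + (2 * c * x + 4 * x ^ 3 * N + x ^ 4 * M))\<^sup>2 - 4 * (1 / x\<^sup>2 + (c * x\<^sup>2 + x ^ 4 * N)) ^ 3 + 20 * c * (1 / x\<^sup>2 + (c * x\<^sup>2 + x ^ 4 * N))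
      = - 28 * N - 4 * x * M + (2 * c * x + 4 * x ^ 3 * N + x ^ 4 * M)\<^sup>2 - 12 * (c * x + x ^ 3 * N)\<^sup>2 - 4 * (c * x\<^sup>2 + x ^ 4 * N) ^ 3 + 20 * c * (c * x\<^sup>2 + x ^ 4 * N)"
      if "x \<noteq> 0" for x N M :: complex
    proof -
      \<comment> \<open>Keeping \<open>1 / x\<close> as an atom makes the identity polynomial. The
        terms in \<open>a^6\<close> cancel, those in \<open>a^2\<close> add up to
        \<open>(- 8 - 12 + 20) * c = 0\<close>, and \<open>N\<close> collects -16 - 12 =
        -28.\<close>
      define a where "a = 1 / x"
      define q where "q = 2 * c * x + 4 * x ^ 3 * N + x ^ 4 * M"
      define R where "R = c * x\<^sup>2 + x ^ 4 * N"
      have facts: "a ^ 3 * q = 2 * c * a\<^sup>2 + 4 * N + x * M" "a ^ 4 * R = c * a\<^sup>2 + N" "a\<^sup>2 * R\<^sup>2 = (c * x + x ^ 3 * N)\<^sup>2"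
        using that by (simp_all add: a_def q_def R_def field_simps power2_eq_square power3_eq_cube power4_eq_xxxx)
      have "(- 2 * a ^ 3 + q)\<^sup>2 - 4 * (a\<^sup>2 + R) ^ 3 + 20 * c * (a\<^sup>2 + R)
        = q\<^sup>2 - 4 * (a ^ 3 * q) - 12 * (a ^ 4 * R) - 12 * (a\<^sup>2 * R\<^sup>2) - 4 * R ^ 3 + 20 * c * a\<^sup>2 + 20 * c * R"
        by (simp add: power2_eq_square power3_eq_cube power4_eq_xxxx algebra_simps)
      also have "\<dots> = - 28 * N - 4 * x * M + q\<^sup>2 - 12 * (c * x + x ^ 3 * N)\<^sup>2 - 4 * R ^ 3 + 20 * c * R"
        unfolding facts by (simp add: algebra_simps)
      finally show ?thesis unfolding q_def R_def a_def by (simp add: power_divide)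
    qed
    show "(deriv wp z)\<^sup>2 - 4 * wp z ^ 3 + 20 * c * wp z = - 28 * n (z - l) - 4 * (z - l) * deriv n (z - l) + (q (z - l))\<^sup>2
       - 12 * (c * (z - l) + (z - l) ^ 3 * n (z - l))\<^sup>2 - 4 * R (z - l) ^ 3 + 20 * c * R (z - l)"
      unfolding wp[OF lz] unfolding R_def q_def by (rule alg) (use lz in simp)
  qed (simp add: n q_def R_def)
  moreover have "deriv (deriv wp) z - 6 * (wp z)\<^sup>2 + 10 * c = 0" if z: "z \<notin> gauss_lattice" for z
  proof (rule lattice_liouville[of "\<lambda>z. 8 * z ^ 3 * deriv n z + z ^ 4 * deriv (deriv n) z - 6 * (R z)\<^sup>2"
       "\<lambda>z. deriv (deriv wp) z - 6 * (wp z)\<^sup>2 + 10 * c", OF _ _ _ z])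
    show "(\<lambda>z. 8 * z ^ 3 * deriv n z + z ^ 4 * deriv (deriv n) z - 6 * (R z)\<^sup>2) holomorphic_on ball 0 (4/5)"
      unfolding R_def by (intro holomorphic_intros n n')
    fix l z assume lz: "l \<in> gauss_lattice" "z \<in> ball l (4/5)" "z \<noteq> l"
    have alg: "6 / x ^ 4 + (2 * c + 12 * x\<^sup>2 * N + 8 * x ^ 3 * M + x ^ 4 * K) - 6 * (1 / x\<^sup>2 + (c * x\<^sup>2 + x ^ 4 * N))\<^sup>2 + 10 * c
      = 8 * x ^ 3 * M + x ^ 4 * K - 6 * (c * x\<^sup>2 + x ^ 4 * N)\<^sup>2"
      if "x \<noteq> 0" for x N M K :: complex
    proof -
      define a where "a = 1 / x"
      define R where "R = c * x\<^sup>2 + x ^ 4 * N"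
      have facts: "a\<^sup>2 * R = c + x\<^sup>2 * N"
        using that by (simp add: a_def R_def field_simps power2_eq_square power4_eq_xxxx)
      have "6 * a ^ 4 + (2 * c + 12 * x\<^sup>2 * N + 8 * x ^ 3 * M + x ^ 4 * K) - 6 * (a\<^sup>2 + R)\<^sup>2 + 10 * c
        = 12 * c + 12 * x\<^sup>2 * N + 8 * x ^ 3 * M + x ^ 4 * K - 12 * (a\<^sup>2 * R) - 6 * R\<^sup>2"
        by (simp add: power2_eq_square power3_eq_cube power4_eq_xxxx algebra_simps)
      also have "\<dots> = 8 * x ^ 3 * M + x ^ 4 * K - 6 * R\<^sup>2" unfolding facts by (simp add: algebra_simps)
      finally show ?thesis unfolding R_def a_def by (simp add: power_divide)
    qed
    show "deriv (deriv wp) z - 6 * (wp z)\<^sup>2 + 10 * c = 8 * (z - l) ^ 3 * deriv n (z - l) + (z - l) ^ 4 * deriv (deriv n) (z - l) - 6 * (R (z - l))\<^sup>2"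
      unfolding wp[OF lz] unfolding R_def by (rule alg) (use lz in simp)
  qed (simp add: R_def)
  ultimately show thesis using that[of c] by (simp add: algebra_simps)
qed

text \<open>Avoids counting zeros. The difference \<open>d\<close> of two translates of
  \<open>wp\<close> solves a linear second order equation, because a difference of squares factors,
  and it has zero initial values; so it vanishes. Then both translates have the same poles, which
  puts \<open>v' - v\<close> into the lattice.\<close>

lemma wp_inject:
  assumes v: "v \<notin> gauss_lattice" "v' \<notin> gauss_lattice" and eq: "wp v = wp v'" "deriv wp v = deriv wp v'"
  shows "v' - v \<in> gauss_lattice"
proof (rule ccontr)
  assume no: "v' - v \<notin> gauss_lattice"
  obtain c where ode: "\<And>z. z \<notin> gauss_lattice \<Longrightarrow> deriv (deriv wp) z = 6 * (wp z)\<^sup>2 - 10 * c"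
    using wp_ode by metis
  let ?L = "gauss_lattice"
  \<comment> \<open>The common domain of both translates. Its complement is countable, so it is
    connected.\<close>
  define S where "S = - ((\<lambda>l. l - v) ` ?L \<union> (\<lambda>l. l - v') ` ?L)"
  have S_iff: "u \<in> S \<longleftrightarrow> v + u \<notin> ?L \<and> v' + u \<notin> ?L" for u
    unfolding S_def image_iff Compl_iff Un_iff by (metis add_diff_cancel_left' diff_add_cancel add.commute)
  have "closed ((\<lambda>l. l - v) ` ?L)" for v
    using closed_translation[OF closed_gauss_lattice, of "- v"] by simp
  then have Sopen: "open S" unfolding S_def by (intro open_Compl closed_Un)
  have "connected S" unfolding S_def
    by (intro path_connected_imp_connected path_connected_complement_countable) (auto simp: countable_gauss_lattice)
  have wpd: "wp field_differentiable at z" "deriv wp field_differentiable at z" if "z \<notin> ?L" for z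
    using that wp_holomorphic holomorphic_deriv[OF wp_holomorphic] closed_gauss_lattice
    by (auto simp: holomorphic_on_imp_differentiable_at open_Compl)
  have D: "((\<lambda>u. wp (v + u)) has_field_derivative deriv wp (v + u)) (at u)"
     "((\<lambda>u. deriv wp (v + u)) has_field_derivative deriv (deriv wp) (v + u)) (at u)" if "v + u \<notin> ?L" for v u
    using DERIV_shift[of wp "deriv wp (v + u)" u v] DERIV_shift[of "deriv wp" "deriv (deriv wp) (v + u)" u v]
      wpd[OF that] by (simp_all add: add.commute field_differentiable_derivI)
  define d where "d u = wp (v + u) - wp (v' + u)" for u
  have d1: "(d has_field_derivative (deriv wp (v + u) - deriv wp (v' + u))) (at u)" if "u \<in> S" for u
    unfolding d_def[abs_def] using that by (intro DERIV_diff D) (auto simp: S_iff)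
  have d2: "(deriv d has_field_derivative (deriv (deriv wp) (v + u) - deriv (deriv wp) (v' + u))) (at u)" if "u \<in> S" for u
  proof (rule has_field_derivative_transform_within_open[OF _ Sopen that])
    show "((\<lambda>u. deriv wp (v + u) - deriv wp (v' + u)) has_field_derivative (deriv (deriv wp) (v + u) - deriv (deriv wp) (v' + u))) (at u)"
      using that by (intro DERIV_diff D) (auto simp: S_iff)
    show "deriv wp (v + x) - deriv wp (v' + x) = deriv d x" if "x \<in> S" for x using DERIV_imp_deriv[OF d1[OF that]] by simp
  qed
  have zero: "d w = 0" if "w \<in> S" for w
  proof (rule second_order_unique[of d S "\<lambda>u. 6 * (wp (v + u) + wp (v' + u))" 0 w])
    show "d holomorphic_on S" using d1 Sopen by (auto simp: holomorphic_on_open)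
    have "(\<lambda>u. wp (v + u)) holomorphic_on S" "(\<lambda>u. wp (v' + u)) holomorphic_on S"
      using D(1) Sopen S_iff by (fastforce simp: holomorphic_on_open)+
    then show "(\<lambda>u. 6 * (wp (v + u) + wp (v' + u))) holomorphic_on S" by (intro holomorphic_intros)
    show "0 \<in> S" using v by (simp add: S_iff)
    show "d 0 = 0" using eq by (simp add: d_def)
    show "deriv d 0 = 0" using DERIV_imp_deriv[OF d1[OF \<open>0 \<in> S\<close>]] eq by simp
    show "deriv (deriv d) z = 6 * (wp (v + z) + wp (v' + z)) * d z" if "z \<in> S" for z
      using DERIV_imp_deriv[OF d2[OF that]] that by (simp add: S_iff ode d_def power2_eq_square algebra_simps)
  qed (use \<open>connected S\<close> Sopen that in auto)
  \<comment> \<open>At \<open>u = z - v\<close> the vanishing of \<open>d\<close> reads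
    \<open>wp z = wp (v' - v + z)\<close>. As \<open>z\<close> tends to 0 the left side has a pole,
    while the right side is continuous by the assumption \<open>no\<close>.\<close>
  have "isCont (\<lambda>z. wp (v' - v + z)) 0" using D(1)[of "v' - v" 0] no DERIV_isCont by fastforce
  then have "isCont (\<lambda>z. wp_reg z - wp (v' - v + z)) 0" by (intro continuous_intros isCont_wp_reg_0)
  moreover have "\<forall>\<^sub>F z in at 0. 1 / z\<^sup>2 + (wp_reg z - wp (v' - v + z)) = 0"
  proof -
    have "\<forall>\<^sub>F z in nhds 0. v' - v + z \<notin> ?L"
    proof -
      have "open ((\<lambda>z. v' - v + z) -` (- ?L))" using closed_gauss_lattice by (intro open_vimage open_Compl continuous_intros)
      from eventually_nhds_in_open[OF this, of 0] show ?thesis using no by simp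
    qed
    then have "\<forall>\<^sub>F z in at 0. v' - v + z \<notin> ?L" by (simp add: eventually_at_filter eventually_mono)
    moreover have "\<forall>\<^sub>F z in at 0. z \<in> ball 0 (4/5) - {0::complex}" by (rule eventually_punctured_ball) simp
    ultimately show ?thesis
    proof eventually_elim
      case (elim z)
      then have "z \<notin> ?L" using ball_gauss_lattice[OF gauss_lattice_0, of z] by auto
      then have "z - v \<in> S" using elim by (simp add: S_iff algebra_simps)
      from zero[OF this] show ?case by (simp add: d_def wp_eq_reg[of z] algebra_simps)
    qed
  qed
  ultimately show False by (rule wp_not_locally_zero)
qed

text \<open>Nonvanishing is the point. If \<open>c\<close> were 0, then at a zero of
  \<open>wp\<close>, which exists by \<open>wp_surj\<close>, the derivative would vanish too; the
  equation would read \<open>wp'' = (6 * wp) * wp\<close> and force \<open>wp\<close> to be 0,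
  against its pole.\<close>

lemma wp_cubic:
  obtains a where "a \<noteq> 0" "\<And>z. z \<notin> gauss_lattice \<Longrightarrow> (deriv wp z / 2)\<^sup>2 = wp z ^ 3 + a * wp z"
proof -
  obtain c where ode: "\<And>z. z \<notin> gauss_lattice \<Longrightarrow> (deriv wp z)\<^sup>2 = 4 * wp z ^ 3 - 20 * c * wp z"
    "\<And>z. z \<notin> gauss_lattice \<Longrightarrow> deriv (deriv wp) z = 6 * (wp z)\<^sup>2 - 10 * c"
    using wp_ode by metis
  have "c \<noteq> 0"
  proof
    assume c: "c = 0"
    obtain z where z: "z \<notin> gauss_lattice" "wp z = 0" using wp_surj by blast
    have zero: "wp w = 0" if "w \<notin> gauss_lattice" for w
    proof (rule second_order_unique[of wp "- gauss_lattice" "\<lambda>z. 6 * wp z" z w])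
      show "(\<lambda>z. 6 * wp z) holomorphic_on - gauss_lattice" by (intro holomorphic_intros wp_holomorphic)
      show "connected (- gauss_lattice)"
        by (intro path_connected_imp_connected path_connected_complement_countable) (auto simp: countable_gauss_lattice)
      show "deriv (deriv wp) z = 6 * wp z * wp z" if "z \<in> - gauss_lattice" for z
        using ode(2)[of z] that c by (simp add: power2_eq_square)
      show "deriv wp z = 0" using ode(1)[OF z(1)] z(2) by simp
    qed (use z that closed_gauss_lattice wp_holomorphic in auto)
    have "\<forall>\<^sub>F z in at 0. z \<in> ball 0 (4/5) - {0::complex}" by (rule eventually_punctured_ball) simp
    then have "\<forall>\<^sub>F z in at 0. 1 / z\<^sup>2 + wp_reg z = 0"
    proof eventually_elim
      case (elim z)
      then have "z \<notin> gauss_lattice" using ball_gauss_lattice[OF gauss_lattice_0, of z] by auto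
      from zero[OF this] show ?case by (simp add: wp_eq_reg)
    qed
    then show False using wp_not_locally_zero isCont_wp_reg_0 by blast
  qed
  moreover have "(deriv wp z / 2)\<^sup>2 = wp z ^ 3 + (- 5 * c) * wp z" if "z \<notin> gauss_lattice" for z
    using ode(1)[OF that] by (simp add: power_divide)
  ultimately show thesis using that[of "- 5 * c"] by simp
qed

section \<open>The two surfaces\<close>

text \<open>This number is fixed by choice and known only to be nonzero. That suffices because
  \<open>curve_pt\<close> multiplies it by a fourth power at one's disposal.\<close>

definition wp_coeff :: complex where
  "wp_coeff = (SOME a. a \<noteq> 0 \<and> (\<forall>z. z \<notin> gauss_lattice \<longrightarrow> (deriv wp z / 2)\<^sup>2 = wp z ^ 3 + a * wp z))"

lemma wp_coeff: "wp_coeff \<noteq> 0" "z \<notin> gauss_lattice \<Longrightarrow> (deriv wp z / 2)\<^sup>2 = wp z ^ 3 + wp_coeff * wp z"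
proof -
  have "\<exists>a. a \<noteq> 0 \<and> (\<forall>z. z \<notin> gauss_lattice \<longrightarrow> (deriv wp z / 2)\<^sup>2 = wp z ^ 3 + a * wp z)"
    by (rule wp_cubic) blast
  from someI_ex[OF this] show "wp_coeff \<noteq> 0" "z \<notin> gauss_lattice \<Longrightarrow> (deriv wp z / 2)\<^sup>2 = wp z ^ 3 + wp_coeff * wp z"
    unfolding wp_coeff_def by blast+
qed

lemma deriv_wp_uminus: "z \<notin> gauss_lattice \<Longrightarrow> deriv wp (- z) = - deriv wp z"
proof -
  assume z: "z \<notin> gauss_lattice"
  have "(wp has_field_derivative deriv wp (- z)) (at (- z))"
    using wp_holomorphic z closed_gauss_lattice by (intro holomorphic_derivI) auto
  then have "((\<lambda>x. wp (- x)) has_field_derivative deriv wp (- z) * - 1) (at z)"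
    by (rule DERIV_chain2[where f=wp and g=uminus]) (auto intro!: derivative_eq_intros)
  then have "(wp has_field_derivative - deriv wp (- z)) (at z)" by (simp add: wp_uminus[abs_def])
  from DERIV_imp_deriv[OF this] show ?thesis by simp
qed

lemma deriv_wp_periodic: "z \<notin> gauss_lattice \<Longrightarrow> l \<in> gauss_lattice \<Longrightarrow> deriv wp (z + l) = deriv wp z"
proof -
  assume z: "z \<notin> gauss_lattice" and l: "l \<in> gauss_lattice"
  have "z + l \<notin> gauss_lattice" using gauss_lattice_diff[of "z + l" l] z l by auto
  then have "(wp has_field_derivative deriv wp (z + l)) (at (z + l))"
    using wp_holomorphic closed_gauss_lattice by (intro holomorphic_derivI) auto
  then have "((\<lambda>x. wp (x + l)) has_field_derivative deriv wp (z + l)) (at z)" by (simp add: DERIV_shift)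
  then have "(wp has_field_derivative deriv wp (z + l)) (at z)" by (simp add: wp_periodic[OF l])
  from DERIV_imp_deriv[OF this] show ?thesis by simp
qed

section \<open>Homogeneous coordinates and classes under the involution\<close>

definition proj_eq :: "cvec3 \<Rightarrow> cvec3 \<Rightarrow> bool" where
  "proj_eq r s \<longleftrightarrow> (\<exists>d. d \<noteq> 0 \<and> s = scaleC3 d r)"

lemma scaleC3_Pair [simp]: "scaleC3 c (x, y, z) = (c * x, c * y, c * z)"
  and cneg_Pair [simp]: "cneg (x, y, z) = (x, - y, z)"
  by (simp_all add: scaleC3_def cneg_def)

lemma cneg_cneg [simp]: "cneg (cneg r) = r"
  by (cases r) auto

lemma scaleC3_scaleC3 [simp]: "scaleC3 c (scaleC3 d r) = scaleC3 (c * d) r" "scaleC3 1 r = r"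
  and cneg_scaleC3: "cneg (scaleC3 c r) = scaleC3 c (cneg r)"
  by (cases r; simp)+

lemma proj_eq_refl [simp]: "proj_eq r r"
  unfolding proj_eq_def by (intro exI[of _ 1]) simp

lemma proj_eq_sym: "proj_eq r s \<Longrightarrow> proj_eq s r"
  unfolding proj_eq_def
proof (elim exE conjE)
  fix d assume "d \<noteq> 0" "s = scaleC3 d r"
  then show "\<exists>d. d \<noteq> 0 \<and> r = scaleC3 d s" by (intro exI[of _ "1 / d"]) simp
qed

lemma proj_eq_trans: "proj_eq r s \<Longrightarrow> proj_eq s t \<Longrightarrow> proj_eq r t"
  unfolding proj_eq_def
proof (elim exE conjE)
  fix d e assume "d \<noteq> 0" "s = scaleC3 d r" "e \<noteq> 0" "t = scaleC3 e s"
  then show "\<exists>d. d \<noteq> 0 \<and> t = scaleC3 d r" by (intro exI[of _ "e * d"]) simp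
qed

lemma proj_eq_cneg: "proj_eq r s \<Longrightarrow> proj_eq (cneg r) (cneg s)"
  unfolding proj_eq_def by (auto simp: cneg_scaleC3)

lemma proj_eq_cneg_iff: "proj_eq (cneg r) s \<longleftrightarrow> proj_eq r (cneg s)"
  using proj_eq_cneg[of "cneg r" s] proj_eq_cneg[of r "cneg s"] by auto

lemma inv_class_mem: "(v', w') \<in> inv_class (v, w) \<longleftrightarrow> (proj_eq v v' \<and> proj_eq w w') \<or> (proj_eq (cneg v) v' \<and> proj_eq (cneg w) w')"
  by (auto simp: inv_class_def proj_eq_def)

lemma inv_class_eq_iff:
  "inv_class (v, w) = inv_class (v', w') \<longleftrightarrow> (proj_eq v v' \<and> proj_eq w w') \<or> (proj_eq (cneg v) v' \<and> proj_eq (cneg w) w')"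
proof
  assume "inv_class (v, w) = inv_class (v', w')"
  moreover have "(v', w') \<in> inv_class (v', w')" by (simp add: inv_class_mem)
  ultimately show "(proj_eq v v' \<and> proj_eq w w') \<or> (proj_eq (cneg v) v' \<and> proj_eq (cneg w) w')"
    by (simp flip: inv_class_mem)
next
  have sub: "inv_class (v', w') \<subseteq> inv_class (v, w)"
    if "(proj_eq v v' \<and> proj_eq w w') \<or> (proj_eq (cneg v) v' \<and> proj_eq (cneg w) w')" for v w v' w'
  proof (clarify)
    fix a b assume "(a, b) \<in> inv_class (v', w')"
    then consider "proj_eq v' a" "proj_eq w' b" | "proj_eq (cneg v') a" "proj_eq (cneg w') b" by (auto simp: inv_class_mem)
    then show "(a, b) \<in> inv_class (v, w)" unfolding inv_class_mem
    proof cases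
      case 1
      then show "proj_eq v a \<and> proj_eq w b \<or> proj_eq (cneg v) a \<and> proj_eq (cneg w) b"
        using that proj_eq_trans by blast
    next
      case 2
      have "(proj_eq (cneg v) (cneg v') \<and> proj_eq (cneg w) (cneg w')) \<or> (proj_eq v (cneg v') \<and> proj_eq w (cneg w'))"
        using that proj_eq_cneg[of v v'] proj_eq_cneg[of w w'] by (auto simp: proj_eq_cneg_iff)
      then show "proj_eq v a \<and> proj_eq w b \<or> proj_eq (cneg v) a \<and> proj_eq (cneg w) b"
        using 2 proj_eq_trans by blast
    qed
  qed
  assume *: "(proj_eq v v' \<and> proj_eq w w') \<or> (proj_eq (cneg v) v' \<and> proj_eq (cneg w) w')"
  then have "(proj_eq v' v \<and> proj_eq w' w) \<or> (proj_eq (cneg v') v \<and> proj_eq (cneg w') w)"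
    using proj_eq_sym[of v v'] proj_eq_sym[of w w'] proj_eq_sym[of "cneg v" v'] proj_eq_sym[of "cneg w" w']
    by (auto simp: proj_eq_cneg_iff)
  from sub[OF *] sub[OF this] show "inv_class (v, w) = inv_class (v', w')" by auto
qed

text \<open>The 2x2 minors of two vectors. For nonzero vectors their vanishing means
  proportionality, which turns \<open>proj_eq\<close> into a polynomial, hence closed,
  condition.\<close>

definition cross :: "cvec3 \<Rightarrow> cvec3 \<Rightarrow> cvec3" where
  "cross r s = (case r of (x, y, z) \<Rightarrow> case s of (x', y', z') \<Rightarrow> (x * y' - y * x', y * z' - z * y', x * z' - z * x'))"

lemma cross_scaleC3: "cross r (scaleC3 d s) = scaleC3 d (cross r s)"
  by (cases r; cases s) (simp add: cross_def algebra_simps)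

lemma cross_self: "cross r r = 0"
  by (cases r) (simp add: cross_def zero_prod_def)

lemma cross_zero_imp_proj_eq:
  assumes "cross r s = 0" "r \<noteq> 0" "s \<noteq> 0" shows "proj_eq s r"
proof -
  obtain x y z x' y' z' where rs: "r = (x, y, z)" "s = (x', y', z')" by (metis surj_pair)
  have eq: "x * y' = y * x'" "y * z' = z * y'" "x * z' = z * x'" using assms(1) by (auto simp: rs cross_def zero_prod_def)
  consider "x' \<noteq> 0" | "y' \<noteq> 0" | "z' \<noteq> 0" using assms(3) by (auto simp: rs zero_prod_def)
  then have "\<exists>d. r = scaleC3 d s"
  proof cases
    case 1 then show ?thesis using eq by (intro exI[of _ "x / x'"]) (simp add: rs field_simps)
  next
    case 2 then show ?thesis using eq by (intro exI[of _ "y / y'"]) (simp add: rs field_simps)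
  next
    case 3 then show ?thesis using eq by (intro exI[of _ "z / z'"]) (simp add: rs field_simps)
  qed
  then obtain d where d: "r = scaleC3 d s" by blast
  then have "d \<noteq> 0" using assms(2) by (auto simp: rs zero_prod_def)
  then show ?thesis using d by (auto simp: proj_eq_def)
qed

lemma continuous_on_cross [continuous_intros]:
  assumes "continuous_on A f" "continuous_on A g" shows "continuous_on A (\<lambda>x. cross (f x) (g x))"
  unfolding cross_def case_prod_unfold using assms by (intro continuous_intros)

section \<open>Parametrization of the complete curve by the plane\<close>

lemma curve_reps_proj_eq: "proj_eq r s \<Longrightarrow> r \<in> curve_reps a \<Longrightarrow> s \<in> curve_reps a"
proof -
  assume "proj_eq r s" and r: "r \<in> curve_reps a"
  then obtain d where d: "d \<noteq> 0" "s = scaleC3 d r" by (auto simp: proj_eq_def)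
  obtain x y z where xyz: "r = (x, y, z)" by (metis surj_pair)
  have "wcubic a s = d ^ 3 * wcubic a r"
    by (simp add: d xyz wcubic_def power2_eq_square power3_eq_cube algebra_simps)
  then show ?thesis using r d by (auto simp: curve_reps_def xyz zero_prod_def)
qed

text \<open>As a map to vectors this is discontinuous at the lattice, where the affine coordinates
  have poles and the origin \<open>(0, 1, 0)\<close> is inserted by hand;
  \<open>curve_pt_local\<close> repairs this up to scaling. The parameter \<open>u\<close> rescales
  the coefficient of the cubic by \<open>u ^ 4\<close>.\<close>

definition curve_pt :: "complex \<Rightarrow> complex \<Rightarrow> cvec3" where
  "curve_pt u z = (if z \<in> gauss_lattice then (0, 1, 0) else (u\<^sup>2 * wp z, u ^ 3 * (deriv wp z / 2), 1))"

lemma curve_pt_nonzero: "curve_pt u z \<noteq> 0" by (auto simp: curve_pt_def zero_prod_def)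

lemma curve_pt_cubic:
  assumes "z \<notin> gauss_lattice"
  shows "(u ^ 3 * (deriv wp z / 2))\<^sup>2 = (u\<^sup>2 * wp z) ^ 3 + (u ^ 4 * wp_coeff) * (u\<^sup>2 * wp z)"
proof -
  have "(u ^ 3 * d)\<^sup>2 = u ^ 6 * d\<^sup>2" for d by (simp add: power_mult_distrib flip: power_mult)
  then have "(u ^ 3 * (deriv wp z / 2))\<^sup>2 = u ^ 6 * (wp z ^ 3 + wp_coeff * wp z)"
    unfolding wp_coeff(2)[OF assms, symmetric] .
  also have "\<dots> = (u\<^sup>2 * wp z) ^ 3 + (u ^ 4 * wp_coeff) * (u\<^sup>2 * wp z)"
    by (simp add: power_mult_distrib algebra_simps flip: power_mult power_add)
  finally show ?thesis .
qed

lemma curve_pt_in: "curve_pt u z \<in> curve_reps (u ^ 4 * wp_coeff)"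
proof (cases "z \<in> gauss_lattice")
  case False
  then show ?thesis using curve_pt_cubic[OF False, of u]
    by (simp only: curve_reps_def curve_pt_def wcubic_def) (simp add: zero_prod_def)
qed (simp add: curve_reps_def curve_pt_def wcubic_def zero_prod_def)

lemma curve_pt_periodic: "l \<in> gauss_lattice \<Longrightarrow> curve_pt u (z + l) = curve_pt u z"
  using gauss_lattice_add[of z l] gauss_lattice_diff[of "z + l" l]
  by (auto simp: curve_pt_def wp_periodic deriv_wp_periodic)

lemma curve_pt_uminus: "proj_eq (cneg (curve_pt u z)) (curve_pt u (- z))"
proof (cases "z \<in> gauss_lattice")
  case True
  then show ?thesis unfolding proj_eq_def by (intro exI[of _ "- 1"]) (simp add: curve_pt_def)
next
  case False
  then have "curve_pt u (- z) = cneg (curve_pt u z)" by (simp add: curve_pt_def wp_uminus deriv_wp_uminus)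
  then show ?thesis by simp
qed

lemma curve_pt_proj_eq_iff:
  assumes "u \<noteq> 0" shows "proj_eq (curve_pt u z) (curve_pt u z') \<longleftrightarrow> z' - z \<in> gauss_lattice"
proof
  assume "z' - z \<in> gauss_lattice"
  from curve_pt_periodic[OF this, of u z] show "proj_eq (curve_pt u z) (curve_pt u z')" by simp
next
  assume "proj_eq (curve_pt u z) (curve_pt u z')"
  then obtain d where d: "d \<noteq> 0" "curve_pt u z' = scaleC3 d (curve_pt u z)" by (auto simp: proj_eq_def)
  show "z' - z \<in> gauss_lattice"
  proof (cases "z \<in> gauss_lattice")
    case True
    then have "z' \<in> gauss_lattice" using d by (auto simp: curve_pt_def split: if_splits)
    then show ?thesis using True by (rule gauss_lattice_diff)
  next
    case False
    then have z': "z' \<notin> gauss_lattice" using d by (auto simp: curve_pt_def split: if_splits)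
    have "wp z' = wp z" "deriv wp z' = deriv wp z" using d False z' assms by (auto simp: curve_pt_def)
    then show ?thesis using wp_inject[OF False z'] by simp
  qed
qed

lemma curve_pt_surj:
  assumes u: "u \<noteq> 0" and r: "r \<in> curve_reps (u ^ 4 * wp_coeff)" shows "\<exists>z. proj_eq (curve_pt u z) r"
proof -
  obtain x y t where xyz: "r = (x, y, t)" by (metis surj_pair)
  have eq: "y\<^sup>2 * t - x ^ 3 - (u ^ 4 * wp_coeff) * x * t\<^sup>2 = 0" and nz: "r \<noteq> 0" using r by (auto simp: curve_reps_def wcubic_def xyz)
  show ?thesis
  proof (cases "t = 0")
    case True
    then have "x = 0" using eq by simp
    then have "y \<noteq> 0" using nz True by (auto simp: xyz zero_prod_def)
    then have "proj_eq (curve_pt u 0) r" unfolding proj_eq_def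
      using True \<open>x = 0\<close> gauss_lattice_0 by (intro exI[of _ y]) (simp add: curve_pt_def xyz)
    then show ?thesis by blast
  next
    case False
    define p q where "p = x / t" and "q = y / t"
    have "q\<^sup>2 = p ^ 3 + (u ^ 4 * wp_coeff) * p"
      using eq False by (simp add: p_def q_def field_simps power2_eq_square power3_eq_cube)
    obtain z where z: "z \<notin> gauss_lattice" "wp z = p / u\<^sup>2" using wp_surj by blast
    have p: "u\<^sup>2 * wp z = p" using z u by simp
    have "(u ^ 3 * (deriv wp z / 2))\<^sup>2 = q\<^sup>2"
      unfolding curve_pt_cubic[OF z(1)] p using \<open>q\<^sup>2 = _\<close> by simp
    \<comment> \<open>The first coordinate determines the second up to sign, and passing from
      \<open>z\<close> to \<open>- z\<close> changes that sign.\<close>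
    then have "u ^ 3 * (deriv wp z / 2) = q \<or> u ^ 3 * (deriv wp z / 2) = - q" by (simp add: power2_eq_iff)
    then obtain z' where "curve_pt u z' = (p, q, 1)"
    proof
      assume "u ^ 3 * (deriv wp z / 2) = q"
      then show thesis using that[of z] z p by (simp add: curve_pt_def)
    next
      assume "u ^ 3 * (deriv wp z / 2) = - q"
      then show thesis using that[of "- z"] z p by (simp add: curve_pt_def wp_uminus deriv_wp_uminus)
    qed
    then have "r = scaleC3 t (curve_pt u z')" using False by (simp add: xyz p_def q_def)
    then show ?thesis using False by (auto simp: proj_eq_def)
  qed
qed

text \<open>Near a lattice point \<open>l\<close> the vector is multiplied by
  \<open>(z - l)^3\<close>, matching the order of the pole of \<open>deriv wp\<close>. The product
  \<open>\<psi>\<close> extends continuously over \<open>l\<close>, with value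
  \<open>(0, - u ^ 3, 0)\<close>, a multiple of the origin of the curve.\<close>

lemma curve_pt_local:
  assumes u: "u \<noteq> 0"
  shows "\<exists>D \<phi>. open D \<and> z0 \<in> D \<and> continuous_on D \<phi> \<and> (\<forall>z\<in>D. proj_eq (curve_pt u z) (\<phi> z))"
proof (cases "z0 \<in> gauss_lattice")
  case False
  have cont: "continuous_on (- gauss_lattice) wp" "continuous_on (- gauss_lattice) (deriv wp)"
    using wp_holomorphic closed_gauss_lattice by (auto intro!: holomorphic_on_imp_continuous_on holomorphic_deriv)
  have "continuous_on (- gauss_lattice) (\<lambda>z. (u\<^sup>2 * wp z, u ^ 3 * (deriv wp z / 2), 1 :: complex))"
    by (intro continuous_intros cont) auto
  then show ?thesis using False closed_gauss_lattice
    by (intro exI[of _ "- gauss_lattice"] exI[of _ "\<lambda>z. (u\<^sup>2 * wp z, u ^ 3 * (deriv wp z / 2), 1)"]) (auto simp: curve_pt_def)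
next
  case l: True
  obtain c n where n: "n holomorphic_on ball 0 (4/5)" "\<And>z. z \<in> ball 0 (4/5) \<Longrightarrow> wp_reg z = c * z\<^sup>2 + z ^ 4 * n z"
    using wp_reg_expansion by metis
  define q where "q x = 2 * c * x + 4 * x ^ 3 * n x + x ^ 4 * deriv n x" for x
  define \<psi> where "\<psi> x = (u\<^sup>2 * (x + x ^ 3 * wp_reg x), u ^ 3 * (- 1 + x ^ 3 * q x / 2), x ^ 3)" for x
  have "continuous_on (ball 0 (4/5)) n" "continuous_on (ball 0 (4/5)) (deriv n)" "continuous_on (ball 0 (4/5)) wp_reg"
    using n wp_reg_holomorphic by (auto intro!: holomorphic_on_imp_continuous_on holomorphic_deriv)
  then have "continuous_on (ball 0 (4/5)) \<psi>"
    unfolding \<psi>_def q_def by (intro continuous_intros) auto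
  then have "continuous_on (ball z0 (4/5)) (\<lambda>z. \<psi> (z - z0))"
    by (rule continuous_on_compose2) (auto simp: dist_norm norm_minus_commute intro!: continuous_intros)
  moreover have "proj_eq (curve_pt u z) (\<psi> (z - z0))" if z: "z \<in> ball z0 (4/5)" for z
  proof (cases "z = z0")
    case True
    then show ?thesis unfolding proj_eq_def using u l
      by (intro exI[of _ "- (u ^ 3)"]) (simp add: curve_pt_def \<psi>_def)
  next
    case False
    define x where "x = z - z0"
    have x: "x \<noteq> 0" using False by (simp add: x_def)
    have "z \<notin> gauss_lattice" using ball_gauss_lattice[OF l z] False by blast
    moreover have "wp z = 1 / x\<^sup>2 + wp_reg x" using wp_near[OF l, of z] by (simp add: x_def)
    moreover have "deriv wp z = - 2 / x ^ 3 + q x"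
      using DERIV_imp_deriv[OF wp_derivs(1)[OF n l z False]] by (simp add: x_def q_def)
    ultimately have "curve_pt u z = (u\<^sup>2 * (1 / x\<^sup>2 + wp_reg x), u ^ 3 * ((- 2 / x ^ 3 + q x) / 2), 1)"
      by (simp add: curve_pt_def)
    then have "\<psi> x = scaleC3 (x ^ 3) (curve_pt u z)"
      using x by (simp add: \<psi>_def field_simps power2_eq_square power3_eq_cube)
    then show ?thesis unfolding proj_eq_def using x by (intro exI[of _ "x ^ 3"]) (simp add: x_def)
  qed
  ultimately show ?thesis by (intro exI[of _ "ball z0 (4/5)"] exI[of _ "\<lambda>z. \<psi> (z - z0)"]) auto
qed

text \<open>Openness of the complement is local in \<open>z\<close>, and locally
  \<open>curve_pt\<close> may be replaced by a continuous representative, since scaling does not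
  change the zeros of \<open>cross\<close>.\<close>

lemma closed_proj_eq_curve_pt:
  assumes "u \<noteq> 0" shows "closed {(r, z). cross r (curve_pt u z) = 0}"
proof -
  have "\<exists>T. open T \<and> (r0, z0) \<in> T \<and> T \<subseteq> - {(r, z). cross r (curve_pt u z) = 0}"
    if nz: "cross r0 (curve_pt u z0) \<noteq> 0" for r0 z0
  proof -
    obtain D \<phi> where D: "open D" "z0 \<in> D" "continuous_on D \<phi>" "\<And>z. z \<in> D \<Longrightarrow> proj_eq (curve_pt u z) (\<phi> z)"
      using curve_pt_local[OF assms, of z0] by blast
    have iff: "cross r (\<phi> z) = 0 \<longleftrightarrow> cross r (curve_pt u z) = 0" if "z \<in> D" for r z
    proof -
      obtain d where d: "d \<noteq> 0" "\<phi> z = scaleC3 d (curve_pt u z)" using D(4)[OF \<open>z \<in> D\<close>] by (auto simp: proj_eq_def)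
      show ?thesis unfolding d(2) cross_scaleC3 using d(1) by (cases "cross r (curve_pt u z)") (auto simp: zero_prod_def)
    qed
    have "continuous_on (UNIV \<times> D) (\<lambda>w. cross (fst w) (\<phi> (snd w)))"
      by (intro continuous_intros continuous_on_compose2[OF D(3)]) auto
    then have "open ((UNIV \<times> D) \<inter> (\<lambda>w. cross (fst w) (\<phi> (snd w))) -` (- {0}))"
      by (rule continuous_open_preimage) (auto intro: open_Times D)
    moreover have "(r0, z0) \<in> (UNIV \<times> D) \<inter> (\<lambda>w. cross (fst w) (\<phi> (snd w))) -` (- {0})"
      using D(2) iff[of z0 r0] nz by simp
    moreover have "(UNIV \<times> D) \<inter> (\<lambda>w. cross (fst w) (\<phi> (snd w))) -` (- {0}) \<subseteq> - {(r, z). cross r (curve_pt u z) = 0}"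
    proof
      fix w assume w: "w \<in> (UNIV \<times> D) \<inter> (\<lambda>w. cross (fst w) (\<phi> (snd w))) -` (- {0})"
      then have "snd w \<in> D" by (cases w) simp
      then show "w \<in> - {(r, z). cross r (curve_pt u z) = 0}"
        using w iff[of "snd w" "fst w"] by (simp add: case_prod_unfold)
    qed
    ultimately show ?thesis by blast
  qed
  then have "open (- {(r, z). cross r (curve_pt u z) = 0})"
    by (subst open_subopen) auto
  then show ?thesis by (simp add: closed_def)
qed

text \<open>The torus is compact, so the points of the curve whose parameters avoid an open set form a
  closed set: this replaces a discussion of local parameters on the curve.\<close>

lemma curve_pt_open:
  assumes u: "u \<noteq> 0" and D: "open D"
  shows "openin (top_of_set (curve_reps (u ^ 4 * wp_coeff))) {r \<in> curve_reps (u ^ 4 * wp_coeff). \<exists>z\<in>D. proj_eq (curve_pt u z) r}"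
proof -
  let ?C = "curve_reps (u ^ 4 * wp_coeff)" and ?K0 = "cbox 0 (Complex 1 1)"
  \<comment> \<open>The union of all lattice translates of \<open>D\<close>. As the unit square
    meets every class of parameters, a point of the curve has no parameter in \<open>D\<close>
    exactly when it has one in \<open>K\<close>.\<close>
  define D' where "D' = (\<Union>l\<in>gauss_lattice. (+) l ` D)"
  have "open D'" unfolding D'_def using D by (intro open_UN ballI open_translation)
  define K where "K = ?K0 - D'"
  have K: "compact K" unfolding K_def using \<open>open D'\<close> by (intro compact_diff compact_cbox)
  let ?Q = "(?C \<times> K) \<inter> {(r, z). cross r (curve_pt u z) = 0}"
  have "closedin (top_of_set (?C \<times> K)) ?Q"
    using closed_proj_eq_curve_pt[OF u] by (auto simp: closedin_closed)
  then have "closedin (prod_topology (top_of_set ?C) (top_of_set K)) ?Q" by simp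
  moreover have "closed_map (prod_topology (top_of_set ?C) (top_of_set K)) (top_of_set ?C) fst"
    using K by (intro closed_map_fst) (simp add: compact_space_subtopology)
  ultimately have cl: "closedin (top_of_set ?C) (fst ` ?Q)" by (auto simp: closed_map_def)
  have "?C - fst ` ?Q = {r \<in> ?C. \<exists>z\<in>D. proj_eq (curve_pt u z) r}"
  proof (intro equalityI subsetI)
    fix r assume r: "r \<in> ?C - fst ` ?Q"
    then obtain z where z: "proj_eq (curve_pt u z) r" using curve_pt_surj[OF u] by blast
    define l where "l = of_int \<lfloor>Re z\<rfloor> + \<i> * of_int \<lfloor>Im z\<rfloor>"
    have l: "l \<in> gauss_lattice" by (auto simp: l_def gauss_lattice_def)
    have "z - l \<in> ?K0"
      unfolding l_def by (simp add: in_cbox_complex_iff) linarith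
    have pz: "proj_eq (curve_pt u (z - l)) r" using z curve_pt_periodic[OF l, of u "z - l"] by simp
    have "cross r (curve_pt u (z - l)) = 0"
      using proj_eq_sym[OF pz] by (auto simp: proj_eq_def cross_scaleC3 cross_self zero_prod_def)
    have "z - l \<in> D'"
    proof (rule ccontr)
      assume "z - l \<notin> D'"
      then have "(r, z - l) \<in> ?Q"
        using r \<open>z - l \<in> ?K0\<close> \<open>cross r (curve_pt u (z - l)) = 0\<close> by (simp add: K_def)
      then have "r \<in> fst ` ?Q" by force
      then show False using r by simp
    qed
    then obtain l' w where w: "l' \<in> gauss_lattice" "w \<in> D" "z - l = l' + w" by (auto simp: D'_def)
    then have "proj_eq (curve_pt u w) r" using pz curve_pt_periodic[OF w(1), of u w] by (simp add: add.commute)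
    then show "r \<in> {r \<in> ?C. \<exists>z\<in>D. proj_eq (curve_pt u z) r}" using r w by auto
  next
    fix r assume "r \<in> {r \<in> ?C. \<exists>z\<in>D. proj_eq (curve_pt u z) r}"
    then obtain z where z: "r \<in> ?C" "z \<in> D" "proj_eq (curve_pt u z) r" by auto
    have "r \<notin> fst ` ?Q"
    proof
      assume "r \<in> fst ` ?Q"
      then obtain w where w: "w \<in> K" "cross r (curve_pt u w) = 0" by auto
      have "r \<noteq> 0" using z(1) by (auto simp: curve_reps_def)
      then have "proj_eq (curve_pt u w) r" using cross_zero_imp_proj_eq[OF w(2)] curve_pt_nonzero by auto
      then have "proj_eq (curve_pt u z) (curve_pt u w)" using z(3) proj_eq_trans proj_eq_sym by blast
      then have "w - z \<in> gauss_lattice" using curve_pt_proj_eq_iff[OF u] by simp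
      then have "w \<in> D'" unfolding D'_def using z(2) by (auto intro!: bexI[of _ "w - z"] image_eqI[of _ _ z])
      then show False using w(1) by (simp add: K_def)
    qed
    then show "r \<in> ?C - fst ` ?Q" using z(1) by simp
  qed
  then show ?thesis using cl openin_diff[OF openin_topspace[of "top_of_set ?C"] cl] by simp
qed

section \<open>Quotient topologies\<close>

lemma openin_quotient_topology:
  "openin (quotient_topology Y f) U \<longleftrightarrow> U \<subseteq> f ` topspace Y \<and> openin Y {p \<in> topspace Y. f p \<in> U}"
proof -
  define P where "P U \<longleftrightarrow> U \<subseteq> f ` topspace Y \<and> openin Y {p \<in> topspace Y. f p \<in> U}" for U
  have "istopology P"
    unfolding istopology_def
  proof (intro conjI allI impI)
    fix S T assume "P S" "P T"
    moreover have "{p \<in> topspace Y. f p \<in> S \<inter> T} = {p \<in> topspace Y. f p \<in> S} \<inter> {p \<in> topspace Y. f p \<in> T}" by auto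
    ultimately show "P (S \<inter> T)" unfolding P_def by auto
  next
    fix K assume K: "\<forall>S\<in>K. P S"
    have "{p \<in> topspace Y. f p \<in> \<Union>K} = (\<Union>S\<in>K. {p \<in> topspace Y. f p \<in> S})" by auto
    then show "P (\<Union>K)" using K unfolding P_def by auto
  qed
  moreover have "quotient_topology Y f = topology P" unfolding quotient_topology_def P_def ..
  ultimately have "openin (quotient_topology Y f) = P" using topology_inverse'[of P] by simp
  then show ?thesis by (simp only: P_def)
qed

lemma topspace_quotient_topology: "topspace (quotient_topology Y f) = f ` topspace Y"
proof
  have "{p \<in> topspace Y. f p \<in> f ` topspace Y} = topspace Y" by auto
  then have "openin (quotient_topology Y f) (f ` topspace Y)" unfolding openin_quotient_topology by simp
  then show "f ` topspace Y \<subseteq> topspace (quotient_topology Y f)" by (rule openin_subset)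
  show "topspace (quotient_topology Y f) \<subseteq> f ` topspace Y"
    using openin_topspace[of "quotient_topology Y f"] unfolding openin_quotient_topology by blast
qed

lemma openin_swap:
  assumes "openin (top_of_set (A \<times> B)) S" shows "openin (top_of_set (B \<times> A)) (prod.swap -` S)"
proof -
  obtain T where "open T" "S = (A \<times> B) \<inter> T" using assms by (auto simp: openin_open)
  then have "open (prod.swap -` T)" "prod.swap -` S = (B \<times> A) \<inter> prod.swap -` T"
    by (auto intro!: open_vimage continuous_on_swap)
  then show ?thesis by (auto simp: openin_open)
qed

text \<open>In the second surface the punctured factor comes last; the swap brings it to the order
  of the first surface, so that one locale covers both.\<close>

lemma quotient_topology_swap:
  fixes A :: "'a::topological_space set" and B :: "'b::topological_space set"
  shows "quotient_topology (top_of_set (A \<times> B)) f = quotient_topology (top_of_set (B \<times> A)) (f \<circ> prod.swap)"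
proof -
  have "openin (quotient_topology (top_of_set (A \<times> B)) f) U \<longleftrightarrow> openin (quotient_topology (top_of_set (B \<times> A)) (f \<circ> prod.swap)) U" for U
  proof -
    have eq: "{p \<in> B \<times> A. f (prod.swap p) \<in> U} = prod.swap -` {p \<in> A \<times> B. f p \<in> U}"
      "{p \<in> A \<times> B. f p \<in> U} = prod.swap -` {p \<in> B \<times> A. f (prod.swap p) \<in> U}" by auto
    have im: "(f \<circ> prod.swap) ` (B \<times> A) = f ` (A \<times> B)" by (simp only: image_comp[symmetric] product_swap)
    have "openin (top_of_set (A \<times> B)) {p \<in> A \<times> B. f p \<in> U} \<longleftrightarrow> openin (top_of_set (B \<times> A)) {p \<in> B \<times> A. f (prod.swap p) \<in> U}"
      using openin_swap[of A B "{p \<in> A \<times> B. f p \<in> U}"] openin_swap[of B A "{p \<in> B \<times> A. f (prod.swap p) \<in> U}"]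
      unfolding eq[symmetric] by blast
    then show ?thesis unfolding openin_quotient_topology topspace_euclidean_subtopology im o_apply by blast
  qed
  then show ?thesis by (simp add: topology_eq)
qed

text \<open>The substitution \<open>(x, y) -> (t^2 * x, t^3 * y)\<close> carries
  \<open>y^2 = x^3 - 4 * x\<close> to the curve with coefficient \<open>- 4 * t ^ 4\<close>. With
  \<open>t = 1\<close> this is \<open>E\<close>, with \<open>t ^ 4 = - 1 / 4\<close> it is
  \<open>E'\<close>, so \<open>affine_cubic\<close> models the punctured factor of both
  surfaces.\<close>

definition affine_pt :: "complex \<Rightarrow> complex \<times> complex \<Rightarrow> cvec3" where
  "affine_pt t w = (t\<^sup>2 * fst w, t ^ 3 * snd w, 1)"

definition affine_coords :: "complex \<Rightarrow> cvec3 \<Rightarrow> complex \<times> complex" where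
  "affine_coords t r = (case r of (x, y, z) \<Rightarrow> (x / (z * t\<^sup>2), y / (z * t ^ 3)))"

lemma affine_cubic_scaled:
  fixes t x y :: complex
  assumes "t \<noteq> 0"
  shows "(t ^ 3 * y)\<^sup>2 - (t\<^sup>2 * x) ^ 3 - (- 4 * t ^ 4) * (t\<^sup>2 * x) = t ^ 6 * (y\<^sup>2 - (x ^ 3 - 4 * x))"
  by (simp add: power_mult_distrib algebra_simps flip: power_mult power_add)

lemma affine_pt_in:
  assumes t: "t \<noteq> 0" and w: "w \<in> affine_cubic"
  shows "affine_pt t w \<in> curve_reps (- 4 * t ^ 4) - two_torsion_reps (- 4 * t ^ 4)"
proof -
  obtain x y where xy: "w = (x, y)" by (cases w)
  have "y\<^sup>2 = x ^ 3 - 4 * x" "y \<noteq> 0" using w by (auto simp: affine_cubic_def xy)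
  then have "wcubic (- 4 * t ^ 4) (affine_pt t w) = 0"
    using affine_cubic_scaled[OF t, of y x] by (simp add: wcubic_def affine_pt_def xy)
  then show ?thesis using t \<open>y \<noteq> 0\<close>
    by (auto simp: curve_reps_def two_torsion_reps_def affine_pt_def xy zero_prod_def)
qed

lemma affine_coords_in:
  assumes t: "t \<noteq> 0" and r: "r \<in> curve_reps (- 4 * t ^ 4) - two_torsion_reps (- 4 * t ^ 4)"
  shows "affine_coords t r \<in> affine_cubic" "proj_eq (affine_pt t (affine_coords t r)) r"
proof -
  obtain x y z where xyz: "r = (x, y, z)" by (metis surj_pair)
  have nz: "y \<noteq> 0" "z \<noteq> 0" and eq: "wcubic (- 4 * t ^ 4) (x, y, z) = 0" using r by (auto simp: two_torsion_reps_def curve_reps_def xyz)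
  define p q where "p = x / (z * t\<^sup>2)" and "q = y / (z * t ^ 3)"
  have x: "x = z * (t\<^sup>2 * p)" and y: "y = z * (t ^ 3 * q)" using nz t by (simp_all add: p_def q_def)
  have "z ^ 3 * (t ^ 6 * (q\<^sup>2 - (p ^ 3 - 4 * p))) = 0"
    unfolding affine_cubic_scaled[OF t, symmetric] using eq
    by (simp add: wcubic_def x y power2_eq_square power3_eq_cube algebra_simps)
  then have "q\<^sup>2 = p ^ 3 - 4 * p" using nz t by simp
  moreover have "q \<noteq> 0" using nz t by (simp add: q_def)
  ultimately show "affine_coords t r \<in> affine_cubic" by (simp add: affine_coords_def xyz affine_cubic_def flip: p_def q_def)
  have "r = scaleC3 z (affine_pt t (affine_coords t r))"
    by (simp add: xyz affine_coords_def affine_pt_def flip: p_def q_def) (simp add: x y)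
  then show "proj_eq (affine_pt t (affine_coords t r)) r" using nz by (auto simp: proj_eq_def)
qed

lemma affine_coords_proj_eq:
  assumes "t \<noteq> 0" "proj_eq (affine_pt t w) r" shows "affine_coords t r = w"
proof -
  obtain d where "d \<noteq> 0" "r = scaleC3 d (affine_pt t w)" using assms(2) by (auto simp: proj_eq_def)
  then show ?thesis using assms(1) by (cases w) (simp add: affine_pt_def affine_coords_def)
qed

lemma affine_pt_proj_eq_iff:
  assumes "t \<noteq> 0" shows "proj_eq (affine_pt t w) (affine_pt t w') \<longleftrightarrow> w = w'"
  using affine_coords_proj_eq[OF assms, of w "affine_pt t w'"] affine_coords_proj_eq[OF assms, of w' "affine_pt t w'"] by auto

lemma cneg_affine_pt: "cneg (affine_pt t w) = affine_pt t (fst w, - snd w)"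
  by (simp add: affine_pt_def)

lemma continuous_on_affine_coords:
  assumes "t \<noteq> 0" shows "continuous_on (curve_reps a - two_torsion_reps a) (affine_coords t)"
proof -
  have "snd (snd r) * t ^ k \<noteq> 0" if "r \<in> curve_reps a - two_torsion_reps a" for r k
    using that assms by (cases r) (auto simp: two_torsion_reps_def)
  then show ?thesis
    unfolding affine_coords_def case_prod_unfold by (intro continuous_intros) auto
qed

text \<open>The class map is kept abstract because it is \<open>inv_class\<close> for the first
  surface and \<open>inv_class\<close> after a swap for the second; only its fibres matter.\<close>

locale curve_pair =
  fixes t u :: complex and cls :: "cvec3 \<times> cvec3 \<Rightarrow> 'a"
  assumes t: "t \<noteq> 0" and u: "u \<noteq> 0"
    and cls: "\<And>v w v' w'. cls (v, w) = cls (v', w') \<longleftrightarrow>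
        (proj_eq v v' \<and> proj_eq w w') \<or> (proj_eq (cneg v) v' \<and> proj_eq (cneg w) w')"
begin

abbreviation C1 where "C1 \<equiv> curve_reps (- 4 * t ^ 4) - two_torsion_reps (- 4 * t ^ 4)"
abbreviation C2 where "C2 \<equiv> curve_reps (u ^ 4 * wp_coeff)"

definition quot :: "'a topology" where "quot = quotient_topology (top_of_set (C1 \<times> C2)) cls"

definition param :: "(complex \<times> complex) \<times> complex \<Rightarrow> 'a" where
  "param c = cls (affine_pt t (fst c), curve_pt u (snd c))"

lemma cls_eq_param:
  assumes "w \<in> affine_cubic" "proj_eq (affine_pt t w) r" "proj_eq (curve_pt u v) s" shows "cls (r, s) = param (w, v)"
  using assms cls proj_eq_sym by (simp add: param_def)

lemma param_eq_iff:
  "param ((x, y), v) = param ((x', y'), v') \<longleftrightarrow>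
     x' = x \<and> ((y' = y \<and> v' - v \<in> gauss_lattice) \<or> (y' = - y \<and> v' + v \<in> gauss_lattice))"
proof -
  have "proj_eq (cneg (curve_pt u v)) (curve_pt u v') \<longleftrightarrow> proj_eq (curve_pt u (- v)) (curve_pt u v')"
    using curve_pt_uminus[of u v] proj_eq_trans proj_eq_sym by blast
  then show ?thesis
    unfolding param_def cls fst_conv snd_conv cneg_affine_pt
    by (auto simp: affine_pt_proj_eq_iff[OF t] curve_pt_proj_eq_iff[OF u])
qed

text \<open>\<open>curve_pt\<close> is not continuous, but \<open>cls\<close> ignores scaling, so
  locally \<open>param\<close> equals \<open>cls\<close> composed with the continuous representative
  from \<open>curve_pt_local\<close>.\<close>

lemma param_continuous: "continuous_map (top_of_set (affine_cubic \<times> UNIV)) quot param"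
  unfolding continuous_map_def
proof (intro conjI allI impI)
  show "param \<in> topspace (top_of_set (affine_cubic \<times> UNIV)) \<rightarrow> topspace quot"
    using affine_pt_in[OF t] curve_pt_in[of u] by (auto simp: quot_def topspace_quotient_topology param_def)
  fix U assume "openin quot U"
  then have "openin (top_of_set (C1 \<times> C2)) {r \<in> C1 \<times> C2. cls r \<in> U}"
    unfolding quot_def openin_quotient_topology by simp
  then obtain T where T: "open T" "{r \<in> C1 \<times> C2. cls r \<in> U} = (C1 \<times> C2) \<inter> T" by (auto simp: openin_open)
  show "openin (top_of_set (affine_cubic \<times> UNIV)) {c \<in> topspace (top_of_set (affine_cubic \<times> UNIV)). param c \<in> U}"
  proof (rule openin_subopen[THEN iffD2], intro ballI)
    fix c0 assume "c0 \<in> {c \<in> topspace (top_of_set (affine_cubic \<times> UNIV)). param c \<in> U}"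
    then obtain w0 v0 where c0: "c0 = (w0, v0)" "w0 \<in> affine_cubic" "param (w0, v0) \<in> U" by (cases c0) auto
    obtain D \<phi> where D: "open D" "v0 \<in> D" "continuous_on D \<phi>" "\<And>v. v \<in> D \<Longrightarrow> proj_eq (curve_pt u v) (\<phi> v)"
      using curve_pt_local[OF u, of v0] by blast
    let ?f = "\<lambda>c. (affine_pt t (fst c), \<phi> (snd c))"
    have f: "?f c \<in> C1 \<times> C2" "cls (?f c) = param c" if "c \<in> affine_cubic \<times> D" for c
    proof -
      have c: "fst c \<in> affine_cubic" "snd c \<in> D" using that by auto
      have "\<phi> (snd c) \<in> C2" by (rule curve_reps_proj_eq[OF D(4)[OF c(2)] curve_pt_in])
      then show "?f c \<in> C1 \<times> C2" using affine_pt_in[OF t c(1)] by simp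
      show "cls (?f c) = param c" using cls_eq_param[OF c(1) proj_eq_refl D(4)[OF c(2)]] by simp
    qed
    have fc: "continuous_on (affine_cubic \<times> D) ?f"
      unfolding affine_pt_def by (intro continuous_intros continuous_on_compose2[OF D(3)]) auto
    have "openin (top_of_set (affine_cubic \<times> D)) ((affine_cubic \<times> D) \<inter> ?f -` T)"
      by (rule continuous_openin_preimage_gen[OF fc T(1)])
    moreover have "openin (top_of_set (affine_cubic \<times> UNIV)) (affine_cubic \<times> D)"
      using D(1) by (intro openin_Times) auto
    ultimately have "openin (top_of_set (affine_cubic \<times> UNIV)) ((affine_cubic \<times> D) \<inter> ?f -` T)"
      by (rule openin_trans)
    moreover have "c0 \<in> (affine_cubic \<times> D) \<inter> ?f -` T"
    proof -
      have "c0 \<in> affine_cubic \<times> D" using c0 D by auto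
      moreover from f[OF this] have "?f c0 \<in> {r \<in> C1 \<times> C2. cls r \<in> U}" using c0 by auto
      ultimately show ?thesis unfolding T(2) by blast
    qed
    moreover have "(affine_cubic \<times> D) \<inter> ?f -` T \<subseteq> {c \<in> topspace (top_of_set (affine_cubic \<times> UNIV)). param c \<in> U}"
    proof
      fix c assume c: "c \<in> (affine_cubic \<times> D) \<inter> ?f -` T"
      then have "?f c \<in> {r \<in> C1 \<times> C2. cls r \<in> U}" unfolding T(2) using f(1)[of c] by blast
      then show "c \<in> {c \<in> topspace (top_of_set (affine_cubic \<times> UNIV)). param c \<in> U}" using f(2)[of c] c by auto
    qed
    ultimately show "\<exists>N. openin (top_of_set (affine_cubic \<times> UNIV)) N \<and> c0 \<in> N \<and> N \<subseteq> {c \<in> topspace (top_of_set (affine_cubic \<times> UNIV)). param c \<in> U}"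
      by blast
  qed
qed

lemma param_open: "open_map (top_of_set (affine_cubic \<times> UNIV)) quot param"
  unfolding open_map_def
proof (intro allI impI)
  fix A assume "openin (top_of_set (affine_cubic \<times> (UNIV :: complex set))) A"
  then obtain T where T: "open T" "A = (affine_cubic \<times> UNIV) \<inter> T" by (auto simp: openin_open)
  \<comment> \<open>Adjoining the image of \<open>T\<close> under the involution makes
    \<open>mem\<close> true with the one lift \<open>affine_coords t r\<close>, so that
    \<open>(x, - y)\<close> need not be considered separately.\<close>
  define T' where "T' = T \<union> (\<lambda>c. ((fst (fst c), - snd (fst c)), - snd c)) -` T"
  have T': "open T'" unfolding T'_def using T(1) by (intro open_Un open_vimage continuous_intros)
  have mem: "cls (r, s) \<in> param ` A \<longleftrightarrow> (\<exists>v. (affine_coords t r, v) \<in> T' \<and> proj_eq (curve_pt u v) s)"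
    if rs: "r \<in> C1" "s \<in> C2" for r s
  proof
    let ?w = "affine_coords t r"
    have w: "?w \<in> affine_cubic" "proj_eq (affine_pt t ?w) r" using affine_coords_in[OF t rs(1)] .
    obtain v0 where v0: "proj_eq (curve_pt u v0) s" using curve_pt_surj[OF u rs(2)] by blast
    have wc: "(fst ?w, - snd ?w) \<in> affine_cubic" using w(1) affine_cubic_neg[of "fst ?w" "snd ?w"] by simp
    {
      assume "cls (r, s) \<in> param ` A"
      then obtain x y v where c: "((x, y), v) \<in> A" "cls (r, s) = param ((x, y), v)" by force
      have "param ((fst ?w, snd ?w), v0) = param ((x, y), v)" using c(2) cls_eq_param[OF w v0] by simp
      then have "x = fst ?w" "(y = snd ?w \<and> v - v0 \<in> gauss_lattice) \<or> (y = - snd ?w \<and> v + v0 \<in> gauss_lattice)"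
        unfolding param_eq_iff by auto
      then consider "(x, y) = ?w" "v - v0 \<in> gauss_lattice" | "(x, y) = (fst ?w, - snd ?w)" "- v - v0 \<in> gauss_lattice"
        using gauss_lattice_minus[of "v + v0"] by (auto simp: prod_eq_iff)
      then show "\<exists>v. (?w, v) \<in> T' \<and> proj_eq (curve_pt u v) s"
      proof cases
        case 1
        then have "proj_eq (curve_pt u v0) (curve_pt u v)" by (simp add: curve_pt_proj_eq_iff[OF u])
        then have "proj_eq (curve_pt u v) s" using v0 proj_eq_sym proj_eq_trans by blast
        moreover have "(?w, v) \<in> T'" using c(1) 1 T(2) by (auto simp: T'_def)
        ultimately show ?thesis by blast
      next
        case 2
        then have "proj_eq (curve_pt u v0) (curve_pt u (- v))" by (simp add: curve_pt_proj_eq_iff[OF u])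
        then have "proj_eq (curve_pt u (- v)) s" using v0 proj_eq_sym proj_eq_trans by blast
        moreover have "(?w, - v) \<in> T'" using c(1) 2 T(2) by (auto simp: T'_def)
        ultimately show ?thesis by blast
      qed
    }
    assume "\<exists>v. (?w, v) \<in> T' \<and> proj_eq (curve_pt u v) s"
    then obtain v where v: "(?w, v) \<in> T'" "proj_eq (curve_pt u v) s" by blast
    have eq: "cls (r, s) = param ((fst ?w, snd ?w), v)" using cls_eq_param[OF w v(2)] by simp
    consider "(?w, v) \<in> T" | "((fst ?w, - snd ?w), - v) \<in> T" using v(1) by (auto simp: T'_def)
    then show "cls (r, s) \<in> param ` A"
    proof cases
      case 1
      then have "(?w, v) \<in> A" using w(1) by (simp add: T(2))
      then show ?thesis using eq by force
    next
      case 2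
      then have "((fst ?w, - snd ?w), - v) \<in> A" using wc by (simp add: T(2))
      moreover have "cls (r, s) = param ((fst ?w, - snd ?w), - v)"
        unfolding eq param_eq_iff using gauss_lattice_0 by simp
      ultimately show ?thesis by blast
    qed
  qed
  have "openin (top_of_set (C1 \<times> C2)) {r \<in> C1 \<times> C2. cls r \<in> param ` A}"
  proof (rule openin_subopen[THEN iffD2], intro ballI)
    fix rs assume "rs \<in> {r \<in> C1 \<times> C2. cls r \<in> param ` A}"
    then obtain r0 s0 where rs: "rs = (r0, s0)" "r0 \<in> C1" "s0 \<in> C2" "cls (r0, s0) \<in> param ` A" by (cases rs) auto
    then obtain v0 where v0: "(affine_coords t r0, v0) \<in> T'" "proj_eq (curve_pt u v0) s0" using mem by blast
    obtain T1 T2 where T12: "open T1" "open T2" "affine_coords t r0 \<in> T1" "v0 \<in> T2" "T1 \<times> T2 \<subseteq> T'"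
      using open_prod_elim[OF T' v0(1)] by (metis mem_Sigma_iff)
    let ?N1 = "C1 \<inter> affine_coords t -` T1" and ?N2 = "{s \<in> C2. \<exists>v\<in>T2. proj_eq (curve_pt u v) s}"
    have "openin (top_of_set C1) ?N1"
      by (rule continuous_openin_preimage_gen[OF continuous_on_affine_coords[OF t] T12(1)])
    moreover have "openin (top_of_set C2) ?N2" by (rule curve_pt_open[OF u T12(2)])
    ultimately have "openin (top_of_set (C1 \<times> C2)) (?N1 \<times> ?N2)" by (rule openin_Times)
    moreover have "rs \<in> ?N1 \<times> ?N2" using rs v0(2) T12(3,4) by auto
    moreover have "?N1 \<times> ?N2 \<subseteq> {r \<in> C1 \<times> C2. cls r \<in> param ` A}"
    proof
      fix q assume q: "q \<in> ?N1 \<times> ?N2"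
      obtain r s where rs: "q = (r, s)" by (cases q)
      then obtain v where v: "r \<in> C1" "s \<in> C2" "affine_coords t r \<in> T1" "v \<in> T2" "proj_eq (curve_pt u v) s" using q by blast
      then have "(affine_coords t r, v) \<in> T'" using T12(5) by blast
      then have "cls (r, s) \<in> param ` A" using mem[OF v(1,2)] v(5) by blast
      then show "q \<in> {r \<in> C1 \<times> C2. cls r \<in> param ` A}" using rs v by blast
    qed
    ultimately show "\<exists>N. openin (top_of_set (C1 \<times> C2)) N \<and> rs \<in> N \<and> N \<subseteq> {r \<in> C1 \<times> C2. cls r \<in> param ` A}" by blast
  qed
  moreover have "param ` A \<subseteq> cls ` (C1 \<times> C2)"
  proof
    fix b assume "b \<in> param ` A"
    then obtain c where c: "c \<in> A" "b = param c" by blast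
    then have "fst c \<in> affine_cubic" by (auto simp: T(2))
    then show "b \<in> cls ` (C1 \<times> C2)"
      using affine_pt_in[OF t] curve_pt_in[of u] unfolding c(2) param_def by blast
  qed
  ultimately show "openin quot (param ` A)" by (simp add: quot_def openin_quotient_topology)
qed

sublocale inv_quotient quot param
proof
  show "param ` (affine_cubic \<times> UNIV) = topspace quot"
  proof
    show "param ` (affine_cubic \<times> UNIV) \<subseteq> topspace quot"
      using continuous_map_image_subset_topspace[OF param_continuous] by simp
    show "topspace quot \<subseteq> param ` (affine_cubic \<times> UNIV)"
    proof
      fix b assume "b \<in> topspace quot"
      then obtain r s where rs: "r \<in> C1" "s \<in> C2" "b = cls (r, s)"
        by (auto simp: quot_def topspace_quotient_topology)
      obtain v where v: "proj_eq (curve_pt u v) s" using curve_pt_surj[OF u rs(2)] by blast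
      have "b = param (affine_coords t r, v)"
        using cls_eq_param[OF affine_coords_in[OF t rs(1)] v] rs(3) by simp
      then show "b \<in> param ` (affine_cubic \<times> UNIV)" using affine_coords_in(1)[OF t rs(1)] by blast
    qed
  qed
qed (rule param_continuous param_open param_eq_iff)+

end

lemma fourth_root: "\<exists>z. z ^ 4 = (a::complex)"
proof
  have "csqrt (csqrt a) ^ 4 = ((csqrt (csqrt a))\<^sup>2)\<^sup>2" by (simp only: power_mult[symmetric]) simp
  then show "csqrt (csqrt a) ^ 4 = a" by simp
qed

theorem theorem3p3:
  shows "(\<forall>s \<in> topspace S1_space. is_F3_semidirect_Z2 (fundamental_group S1_space s))
       \<and> (\<forall>s \<in> topspace S2_space. is_F3_semidirect_Z2 (fundamental_group S2_space s))"
proof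
  \<comment> \<open>Gives the complete curve \<open>C2\<close> the coefficient of \<open>E'\<close>;
    the punctured curve is \<open>E\<close> itself, with \<open>t = 1\<close>.\<close>
  obtain u where u: "u ^ 4 = E'_a / wp_coeff" using fourth_root by blast
  have "u \<noteq> 0" using u wp_coeff(1) by (auto simp: E'_a_def)
  interpret S1: curve_pair 1 u inv_class
    by unfold_locales (simp_all add: inv_class_eq_iff \<open>u \<noteq> 0\<close>)
  have "S1_space = S1.quot"
    using u wp_coeff(1) by (simp add: S1_space_def S1.quot_def E_a_def)
  then show "\<forall>s \<in> topspace S1_space. is_F3_semidirect_Z2 (fundamental_group S1_space s)"
    using S1.is_F3_semidirect_Z2_fundamental_group by simp
next
  obtain u where u: "u ^ 4 = E_a / wp_coeff" using fourth_root by blast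
  have "u \<noteq> 0" using u wp_coeff(1) by (auto simp: E_a_def)
  \<comment> \<open>Now \<open>- 4 * t ^ 4 = 1\<close>, so the punctured curve \<open>C1\<close> is
    \<open>E'\<close>, while \<open>u\<close> has turned the complete curve \<open>C2\<close> into
    \<open>E\<close>.\<close>
  obtain t where t: "t ^ 4 = - 1 / (4::complex)" using fourth_root by blast
  have "t \<noteq> 0" using t by auto
  interpret S2: curve_pair t u "inv_class \<circ> prod.swap"
    by unfold_locales (auto simp add: inv_class_eq_iff \<open>u \<noteq> 0\<close> \<open>t \<noteq> 0\<close>)
  have "S2_space = S2.quot"
    unfolding S2_space_def S2.quot_def quotient_topology_swap[of "curve_reps E_a"]
    using u t wp_coeff(1) by (simp add: E'_a_def)
  then show "\<forall>s \<in> topspace S2_space. is_F3_semidirect_Z2 (fundamental_group S2_space s)"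
    using S2.is_F3_semidirect_Z2_fundamental_group by simp
qed

end
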